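(* Let $r\ge 1$, let $\Psi$ be a distribution function on $\mathbb{R}$ and let $\omega:\mathbb{R}\to[0,\infty)$ be bounded and continuous. Let $\bm Z=(Z_1,\dots,Z_n)$ be i.i.d. with distribution function $\Psi$, let $\bm\psi=(\psi_1,\dots,\psi_n)$ with $\psi_k=\Psi^{-1}(k/(n+1))$, and $\bm w=(\omega(\psi_1),\dots,\omega(\psi_n))$. Let $\kappa:(0,1)\to[1,\infty)$ be a measurable function with $$\lim_{u\downarrow 0}\frac{\min\{\kappa(u),\kappa(1-u)\}}{\sqrt{\log\log(1/u)}}=\infty .$$ Assume that: (i) $\Psi$ is absolutely continuous, with a continuous density $\Psi'$ which is strictly positive in the interior of the support of $\Psi$; (ii) either $\omega\circ\Psi^{-1}$ is supported on a compact subset of $(0,1)$, or the function $\eta=1/(\Psi'\circ\Psi^{-1})$ varies regularly at both endpoints $0$ and $1$; (iii) the function $u\mapsto\omega(\Psi^{-1}(u))\,\big[\kappa(u)\,\eta(u)\sqrt{u(1-u)}\big]^r$ is bounded on $(0,1)$ by a Lebesgue integrable function which varies regularly at both endpoints $0$ and $1$. Then, as $n\to\infty$, $$n^{\frac r2-1}\,\langle\bm w,|\bm Z^{\uparrow}-\bm\psi|^r\rangle\;\xrightarrow{\;d\;}\;\int_0^1\omega(\Psi^{-1}(u))\,\eta(u)^r\,|\beta_u|^r\,du,$$ where $\beta$ is a standard Brownian bridge on $[0,1]$ and $\xrightarrow{d}$ denotes convergence in distribution.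
   Context: $\Psi^{-1}(u)=\inf\{x\in\mathbb{R}:\Psi(x)\ge u\}$ for $u\in(0,1)$, and $\eta=(\Psi^{-1})'=1/(\Psi'\circ\Psi^{-1})$ on $(0,1)$ (so $\Psi^{-1}$ is differentiable on $(0,1)$, i.e. the support of $\Psi$ is an interval). $\bm x^{\uparrow}$ is the non-decreasing rearrangement of $\bm x\in\mathbb{R}^n$; powers and absolute values of vectors are coordinatewise; $\langle\cdot,\cdot\rangle$ is the Euclidean inner product. A positive measurable function $f$ varies regularly at $0$ with index $\rho\in\mathbb{R}$ if $f(\lambda t)/f(t)\to\lambda^\rho$ as $t\downarrow 0$ for every $\lambda>0$; $f:(0,1)\to\mathbb{R}$ varies regularly at $1$ if $t\mapsto f(1-t)$ varies regularly at $0$. *)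

theory Defs
  imports "HOL-Probability.Probability"
begin

definition distribution_function :: "(real \<Rightarrow> real) \<Rightarrow> bool" where
  "distribution_function F \<longleftrightarrow>
     mono F \<and> (\<forall>x. continuous (at_right x) F) \<and>
     (F \<longlongrightarrow> 0) at_bot \<and> (F \<longlongrightarrow> 1) at_top"

definition quantile :: "(real \<Rightarrow> real) \<Rightarrow> real \<Rightarrow> real" where
  "quantile F u = Inf {x. u \<le> F x}"

text \<open>
  The topological support of the probability measure with distribution function F:
  x lies in it iff every interval (x - e, x + e] has positive mass.
\<close>
definition df_support :: "(real \<Rightarrow> real) \<Rightarrow> real set" where
  "df_support F = {x. \<forall>e>0. F (x - e) < F (x + e)}"

definition has_density :: "(real \<Rightarrow> real) \<Rightarrow> (real \<Rightarrow> real) \<Rightarrow> bool" where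
  "has_density F f \<longleftrightarrow>
     f \<in> borel_measurable borel \<and> (\<forall>x. 0 \<le> f x) \<and>
     (\<forall>x. (\<integral>\<^sup>+ y \<in> {..x}. ennreal (f y) \<partial>lborel) = ennreal (F x))"

text \<open>
  The derivative of the quantile function of a distribution function F with density f;
  only its values on (0,1) are meaningful.
\<close>
definition quantile_density :: "(real \<Rightarrow> real) \<Rightarrow> (real \<Rightarrow> real) \<Rightarrow> real \<Rightarrow> real" where
  "quantile_density F f u = 1 / f (quantile F u)"

text \<open>Regular variation of functions on (0,1); values outside (0,1) play no role.\<close>
definition regularly_varying_at_0 :: "(real \<Rightarrow> real) \<Rightarrow> real \<Rightarrow> bool" where
  "regularly_varying_at_0 f \<rho> \<longleftrightarrow>
     (\<forall>t\<in>{0<..<1}. 0 < f t) \<and>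
     f \<in> borel_measurable (lebesgue_on {0<..<1}) \<and>
     (\<forall>c>0. ((\<lambda>t. f (c * t) / f t) \<longlongrightarrow> c powr \<rho>) (at_right 0))"

definition regularly_varying_at_1 :: "(real \<Rightarrow> real) \<Rightarrow> real \<Rightarrow> bool" where
  "regularly_varying_at_1 f \<rho> \<longleftrightarrow> regularly_varying_at_0 (\<lambda>t. f (1 - t)) \<rho>"

definition regularly_varying_at_endpoints :: "(real \<Rightarrow> real) \<Rightarrow> bool" where
  "regularly_varying_at_endpoints f \<longleftrightarrow>
     (\<exists>\<rho>. regularly_varying_at_0 f \<rho>) \<and> (\<exists>\<rho>. regularly_varying_at_1 f \<rho>)"

text \<open>
  The k-th smallest of x 1, ..., x n (with multiplicity), for k between 1 and n: the k-th entry
  of the non-decreasing rearrangement of (x 1, ..., x n).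
\<close>
definition order_stat :: "nat \<Rightarrow> (nat \<Rightarrow> real) \<Rightarrow> nat \<Rightarrow> real" where
  "order_stat n x k = sort (map x [1..<n + 1]) ! (k - 1)"

text \<open>Gaussian laws on the line, including the degenerate ones (point masses).\<close>
definition gaussian_law :: "real measure \<Rightarrow> bool" where
  "gaussian_law \<mu> \<longleftrightarrow>
     (\<exists>m. \<mu> = return borel m) \<or>
     (\<exists>m \<sigma>. 0 < \<sigma> \<and> \<mu> = density lborel (\<lambda>x. ennreal (normal_density m \<sigma> x)))"

text \<open>
  A standard Brownian bridge: a centred Gaussian process on [0,1] with continuous paths and
  covariance min(s,t) - s t.  A process is Gaussian if every finite linear combination of its
  values has a (possibly degenerate) Gaussian law.
\<close>
definition standard_brownian_bridge :: "'b measure \<Rightarrow> (real \<Rightarrow> 'b \<Rightarrow> real) \<Rightarrow> bool" where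
  "standard_brownian_bridge N \<beta> \<longleftrightarrow>
     prob_space N \<and>
     (\<forall>t\<in>{0..1}. \<beta> t \<in> borel_measurable N) \<and>
     (\<forall>x\<in>space N. continuous_on {0..1} (\<lambda>t. \<beta> t x)) \<and>
     (\<forall>J c. finite J \<and> J \<subseteq> {0..1} \<longrightarrow>
        gaussian_law (distr N borel (\<lambda>x. \<Sum>t\<in>J. c t * \<beta> t x))) \<and>
     (\<forall>t\<in>{0..1}. (\<integral>x. \<beta> t x \<partial>N) = 0) \<and>
     (\<forall>s\<in>{0..1}. \<forall>t\<in>{0..1}. (\<integral>x. \<beta> s x * \<beta> t x \<partial>N) = min s t - s * t)"

text \<open>
  Convergence in distribution of real random variables, each possibly defined on its own
  probability space.
\<close>
definition converges_in_distribution ::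
  "(nat \<Rightarrow> 'a measure) \<Rightarrow> (nat \<Rightarrow> 'a \<Rightarrow> real) \<Rightarrow> 'b measure \<Rightarrow> ('b \<Rightarrow> real) \<Rightarrow> bool" where
  "converges_in_distribution M X N Y \<longleftrightarrow>
     (\<forall>n. X n \<in> borel_measurable (M n)) \<and> Y \<in> borel_measurable N \<and>
     weak_conv_m (\<lambda>n. distr (M n) borel (X n)) (distr N borel Y)"

end

(*
  Write Z_k = Q(U_k) with i.i.d. uniform U_k and Q the quantile function of Psi. The statistic is
  the integral over u in (0,1) of |D_n(u)|^r, where, for u in ((k-1)/n, k/n],
    D_n(u) = omega(psi_k)^(1/r) sqrt(n) (Q(U_(k)) - psi_k).
  For integral functionals no tightness in a function space is needed: convergence of the
  finite-dimensional laws together with uniform integrability suffices. Indeed |x|^r is approximated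
  by p(cos(a x)) with a polynomial p, and the moments of the integral of p(cos(a D_n)) are, by Fubini,
  integrals of finite combinations of characteristic functions of finite-dimensional laws.

  The finite-dimensional laws converge by the delta method, the Bahadur representation (normalised
  uniform order statistics are close to minus the empirical process) and the central limit theorem.
  For uniform integrability, outside an event of small probability all U_(k) and 1 - U_(k) are within
  a constant factor of their means; there regular variation of eta gives
    |Q(U_(k)) - psi_k| <= C eta(u) |U_(k) - u|,  u = k/(n+1),
  the Beta variable U_(k) satisfies E|U_(k) - u|^p <= C (u (1 - u) / n)^(p/2), and near the endpoints
  what remains is bounded by a Riemann sum of the regularly varying integrable majorant.
*)
theory Submission
  imports Defs "HOL-Real_Asymp.Real_Asymp"
begin

subsection \<open>Smooth quantile functions\<close>

text \<open>The obstacle is that the statistic may have no moments: one order statistic close to an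
  endpoint can make E|Q(U_(k)) - psi_k|^r infinite. So the process is truncated (\<open>D'\<close>)
  where an order statistic is not within a factor \<open>L\<close> of its mean. For fixed
  \<open>L\<close> the truncated process has moments of the right size, and its limit
  \<open>Y\<close> does not depend on \<open>L\<close>; the truncation is active only on
  \<open>far_event\<close>, whose probability tends to 0 as \<open>L\<close> grows, uniformly in
  \<open>n\<close>. Hence \<open>L\<close> is fixed before \<open>n\<close> and no double limit
  arises. Moments suffice because the functional with p(cos(a x)) in place of |x|^r is bounded by a
  constant common to all \<open>n\<close>, so that its characteristic function is a power series in
  its moments, converging uniformly in \<open>n\<close>. All limits are taken for characteristic
  functions, which see only laws. This is why the rows \<open>Z n\<close>, possibly on unrelated
  spaces, can be replaced by quantile transforms of one sequence of uniform variables. Regular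
  variation enters through local comparability alone: values at arguments of bounded ratio agree up
  to a constant.\<close>

lemma distribution_function_right_continuous_mono:
  "distribution_function F \<Longrightarrow> right_continuous_mono F 0 1"
  by (auto simp: distribution_function_def right_continuous_mono_def)

lemma quantile_le_iff:
  assumes "distribution_function F" "0 < u" "u < 1"
  shows "quantile F u \<le> x \<longleftrightarrow> u \<le> F x"
  unfolding quantile_def
  by (rule right_continuous_mono.pseudoinverse[OF distribution_function_right_continuous_mono, OF assms, symmetric])

lemma quantile_mono_on:
  assumes "distribution_function F"
  shows "mono_on {0<..<1} (quantile F)"
  using right_continuous_mono.mono_I[OF distribution_function_right_continuous_mono, OF assms]
  by (simp add: quantile_def[abs_def])

lemma distribution_function_bounds:
  assumes "distribution_function F"
  shows "0 \<le> F x" "F x \<le> 1"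
proof -
  have m: "mono F" and b: "(F \<longlongrightarrow> 0) at_bot" and t: "(F \<longlongrightarrow> 1) at_top"
    using assms by (auto simp: distribution_function_def)
  have "eventually (\<lambda>y. F y \<le> F x) at_bot"
    using eventually_le_at_bot[of x] by eventually_elim (use m in \<open>auto simp: mono_def\<close>)
  then show "0 \<le> F x" using tendsto_upperbound[OF b] by simp
  have "eventually (\<lambda>y. F x \<le> F y) at_top"
    using eventually_ge_at_top[of x] by eventually_elim (use m in \<open>auto simp: mono_def\<close>)
  then show "F x \<le> 1" using tendsto_lowerbound[OF t] by simp
qed

text \<open>The density is given through Lebesgue integrals over half-lines. Splitting at
  \<open>x - 1\<close> leaves an integral of a continuous function over a compact interval, to which
  the fundamental theorem of calculus applies.\<close>

lemma has_density_DERIV: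
  assumes F: "distribution_function F" and d: "has_density F f" and c: "continuous_on UNIV f"
  shows "(F has_real_derivative f x) (at x)"
proof -
  define a b where "a = x - 1" and "b = x + 1"
  have f[measurable]: "f \<in> borel_measurable borel" and nn: "\<And>x. 0 \<le> f x"
    and eq: "\<And>x. (\<integral>\<^sup>+ y \<in> {..x}. ennreal (f y) \<partial>lborel) = ennreal (F x)"
    using d by (auto simp: has_density_def)
  have F_eq: "F y = F a + integral {a..y} f" if "a \<le> y" for y
  proof -
    have ii: "f integrable_on {a..y}"
      by (rule integrable_continuous_real) (use c in \<open>auto intro: continuous_on_subset\<close>)
    have I: "(\<integral>\<^sup>+z. indicator {a..y} z * f z \<partial>lborel) = ennreal (integral {a..y} f)"
      by (rule nn_integral_has_integral_lebesgue) (use nn ii in \<open>auto intro: integrable_integral\<close>)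
    have "ennreal (F y) = (\<integral>\<^sup>+ z. ennreal (f z) * indicator {..a} z + ennreal (f z) * indicator {a<..y} z \<partial>lborel)"
      unfolding eq[symmetric] using that by (intro nn_integral_cong) (auto split: split_indicator)
    also have "\<dots> = ennreal (F a) + (\<integral>\<^sup>+ z. ennreal (f z) * indicator {a<..y} z \<partial>lborel)"
      by (subst nn_integral_add) (auto simp: eq)
    also have "(\<integral>\<^sup>+ z. ennreal (f z) * indicator {a<..y} z \<partial>lborel) = (\<integral>\<^sup>+z. indicator {a..y} z * f z \<partial>lborel)"
      using AE_lborel_singleton[of a]
      by (intro nn_integral_cong_AE) (auto elim!: eventually_mono split: split_indicator)
    also note I
    finally show ?thesis
      using distribution_function_bounds(1)[OF F] nn
      by (metis Henstock_Kurzweil_Integration.integral_nonneg ennreal_inj ennreal_plus add_nonneg_nonneg ii)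
  qed
  have "((\<lambda>y. F a + integral {a..y} f) has_real_derivative (0 + f x)) (at x within {a..b})"
    by (intro DERIV_add DERIV_const integral_has_real_derivative)
       (use c in \<open>auto intro: continuous_on_subset simp: a_def b_def\<close>)
  then have "((\<lambda>y. F a + integral {a..y} f) has_real_derivative f x) (at x)"
    by (subst (asm) at_within_interior) (auto simp: a_def b_def)
  then show ?thesis
  proof (rule has_field_derivative_transform_within_open[where S="{a<..}"])
    fix y assume "y \<in> {a<..}"
    then show "F a + integral {a..y} f = F y" using F_eq[of y] by auto
  qed (auto simp: a_def)
qed

locale smooth_df =
  fixes F f :: "real \<Rightarrow> real"
  assumes F: "distribution_function F"
    and density: "has_density F f"
    and f_cont: "continuous_on UNIV f"
    and f_pos: "\<And>x. x \<in> interior (df_support F) \<Longrightarrow> 0 < f x"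
    and Q_diff: "\<And>u. u \<in> {0<..<1} \<Longrightarrow> quantile F differentiable at u"
begin

abbreviation "Q \<equiv> quantile F"
abbreviation "\<eta> \<equiv> quantile_density F f"

lemma F_deriv: "(F has_real_derivative f x) (at x)"
  by (rule has_density_DERIV[OF F density f_cont])

lemma F_isCont: "isCont F x"
  using F_deriv by (rule DERIV_isCont)

lemma F_mono: "x \<le> y \<Longrightarrow> F x \<le> F y"
  using F by (auto simp: distribution_function_def mono_def)

lemma Q_isCont: "0 < u \<Longrightarrow> u < 1 \<Longrightarrow> isCont Q u"
  by (rule differentiable_imp_continuous_within) (simp add: Q_diff)

text \<open>If \<open>F (Q u)\<close> exceeded \<open>u\<close>, continuity would keep
  \<open>F\<close> above \<open>u\<close> slightly to the left of \<open>Q u\<close>, against the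
  minimality of \<open>Q u\<close>.\<close>

lemma F_Q:
  assumes u: "0 < u" "u < 1" shows "F (Q u) = u"
proof (rule antisym)
  show "u \<le> F (Q u)" using quantile_le_iff[OF F u] by auto
  show "F (Q u) \<le> u"
  proof (rule ccontr)
    assume "\<not> F (Q u) \<le> u"
    then have "eventually (\<lambda>x. u < F x) (at (Q u))"
      using F_isCont[of "Q u"] by (intro order_tendstoD(1)) (auto simp: isCont_def)
    then have "eventually (\<lambda>x. u < F x) (at_left (Q u))"
      by (simp add: eventually_at_split)
    then obtain b where b: "b < Q u" "\<And>x. b < x \<Longrightarrow> x < Q u \<Longrightarrow> u < F x"
      by (auto simp: eventually_at_left_field)
    obtain x where "b < x" "x < Q u" using dense[OF b(1)] by blast
    with b(2) have "u < F x" "x < Q u" by auto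
    then show False using quantile_le_iff[OF F u, of x] by auto
  qed
qed

text \<open>A flat piece of \<open>F\<close> at a level inside (0,1) would be a jump of
  \<open>Q\<close> at that level, which continuity of \<open>Q\<close> excludes. This is what makes
  the positivity assumption on the density available at every \<open>Q u\<close>.\<close>

lemma interior_support:
  "{x. 0 < F x \<and> F x < 1} \<subseteq> interior (df_support F)"
proof (rule interior_maximal)
  have "continuous_on UNIV F" using F_isCont by (simp add: continuous_at_imp_continuous_on)
  then show "open {x. 0 < F x \<and> F x < 1}"
    by (intro open_Collect_conj open_Collect_less) auto
  show "{x. 0 < F x \<and> F x < 1} \<subseteq> df_support F"
  proof safe
    fix x assume x: "0 < F x" "F x < 1"
    show "x \<in> df_support F" unfolding df_support_def
    proof safe
      fix e :: real assume e: "e > 0"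
      show "F (x - e) < F (x + e)"
      proof (rule ccontr)
        assume "\<not> F (x - e) < F (x + e)"
        then have eq: "F (x - e) = F x" "F (x + e) = F x"
          using F_mono[of "x - e" x] F_mono[of x "x + e"] e by auto
        have "Q (F x) \<le> x - e" using quantile_le_iff[OF F x] eq by auto
        \<comment> \<open>Levels just above \<open>F x\<close> are reached only beyond
          \<open>x + e\<close>; the right limit of \<open>Q\<close> at \<open>F x\<close> inherits
          this.\<close>
        moreover have "x + e \<le> Q (F x)"
        proof (rule tendsto_lowerbound)
          show "(Q \<longlongrightarrow> Q (F x)) (at_right (F x))"
            using Q_isCont[OF x] by (auto simp: isCont_def filterlim_at_split)
          show "eventually (\<lambda>u. x + e \<le> Q u) (at_right (F x))"
            unfolding eventually_at_right_field
          proof (intro exI[of _ 1] conjI allI impI)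
            fix u assume "F x < u" "u < 1"
            then show "x + e \<le> Q u" using quantile_le_iff[OF F, of u "x+e"] x eq by auto
          qed (use x in auto)
        qed simp
        ultimately show False using e by auto
      qed
    qed
  qed
qed

lemma f_Q_pos: "0 < u \<Longrightarrow> u < 1 \<Longrightarrow> 0 < f (Q u)"
  by (intro f_pos subsetD[OF interior_support]) (simp add: F_Q)

lemma \<eta>_pos: "0 < u \<Longrightarrow> u < 1 \<Longrightarrow> 0 < \<eta> u"
  by (simp add: quantile_density_def f_Q_pos)

lemma Q_deriv:
  assumes "0 < u" "u < 1" shows "(Q has_real_derivative \<eta> u) (at u)"
proof -
  have "(Q has_real_derivative inverse (f (Q u))) (at u)"
  proof (rule DERIV_inverse_function[where f=F and a=0 and b=1])
    show "f (Q u) \<noteq> 0" using f_Q_pos[OF assms] by simp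
  qed (fact assms F_deriv F_Q Q_isCont[OF assms])+
  then show ?thesis by (simp add: quantile_density_def inverse_eq_divide)
qed

lemma Q_cont: "continuous_on {0<..<1} Q"
proof (rule continuous_at_imp_continuous_on, rule ballI)
  fix u :: real assume "u \<in> {0<..<1}"
  then show "isCont Q u" by (intro Q_isCont) auto
qed

lemma \<eta>_cont: "continuous_on {0<..<1} \<eta>"
proof -
  have "continuous_on {0<..<1} (\<lambda>u. f (Q u))"
    by (rule continuous_on_compose2[OF f_cont Q_cont]) auto
  then have "continuous_on {0<..<1} (\<lambda>u. 1 / f (Q u))"
  proof (intro continuous_on_divide continuous_on_const ballI)
    fix u :: real assume "u \<in> {0<..<1}"
    then show "f (Q u) \<noteq> 0" using f_Q_pos[of u] by auto
  qed
  then show ?thesis by (simp add: quantile_density_def[abs_def])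
qed

text \<open>The order of \<open>a\<close> and \<open>b\<close> is left open because an order
  statistic may lie on either side of its mean.\<close>

lemma Q_mvt:
  assumes "a \<in> {0<..<1}" "b \<in> {0<..<1}"
  shows "\<exists>\<theta>\<in>{min a b..max a b}. Q a - Q b = \<eta> \<theta> * (a - b)"
proof -
  have main: "\<exists>\<theta>\<in>{a..b}. Q b - Q a = \<eta> \<theta> * (b - a)" if "a < b" "0 < a" "b < 1" for a b
  proof -
    have "\<exists>z>a. z < b \<and> Q b - Q a = (b - a) * \<eta> z"
    proof (rule MVT2[OF \<open>a < b\<close>])
      fix x assume "a \<le> x" "x \<le> b"
      then show "(Q has_real_derivative \<eta> x) (at x)" using that by (intro Q_deriv) linarith+
    qed
    then obtain z where "a < z" "z < b" "Q b - Q a = (b - a) * \<eta> z" by blast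
    then show ?thesis by (intro bexI[of _ z]) (simp_all add: mult.commute)
  qed
  consider "a < b" | "a = b" | "b < a" by linarith
  then show ?thesis
  proof cases
    case 1
    then obtain \<theta> where "\<theta> \<in> {a..b}" "Q b - Q a = \<eta> \<theta> * (b - a)" using main[of a b] assms by auto
    then have "Q a - Q b = \<eta> \<theta> * (a - b)" by (simp add: algebra_simps)
    then show ?thesis using 1 \<open>\<theta> \<in> {a..b}\<close> by auto
  next
    case 3
    then show ?thesis using main[of b a] assms by auto
  qed auto
qed

end

subsection \<open>Regular variation\<close>

text \<open>The function is only Lebesgue measurable, and only on (0,1). The set of scales is the
  preimage of a level set under a dilation, and dilations are measurable for the completed
  measure.\<close>

lemma regularly_varying_at_0_level_sets:
  assumes "regularly_varying_at_0 f \<rho>" and c: "0 < c" and ab: "0 < a" "b * c < 1"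
  shows "{v\<in>{a..b}. A \<le> f (v * c) \<and> f (v * c) \<le> B} \<in> sets lebesgue"
proof -
  define E where "E = {t\<in>{0<..<1}. A \<le> f t \<and> f t \<le> B}"
  have m: "f \<in> borel_measurable (lebesgue_on {0<..<1})"
    using assms by (auto simp: regularly_varying_at_0_def)
  have "E = f -` {A..B} \<inter> space (lebesgue_on {0<..<1})" by (auto simp: E_def)
  also have "\<dots> \<in> sets (lebesgue_on {0<..<1})" by (rule measurable_sets[OF m]) auto
  finally have E: "E \<in> sets lebesgue"
    by (auto simp: sets_restrict_space_iff)
  have "(\<lambda>v. 0 + c * v) \<in> lebesgue \<rightarrow>\<^sub>M lebesgue"
  proof -
    have eq: "(\<lambda>v. 0 + c * v) = (*\<^sub>R) c" by (auto simp: fun_eq_iff)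
    show ?thesis by (subst eq) (rule lebesgue_measurable_scaling)
  qed
  then have "(\<lambda>v. 0 + c * v) -` E \<inter> space lebesgue \<in> sets lebesgue"
    using E by (rule measurable_sets)
  then have "((\<lambda>v. 0 + c * v) -` E \<inter> space lebesgue) \<inter> {a..b} \<in> sets lebesgue" by auto
  also have "((\<lambda>v. 0 + c * v) -` E \<inter> space lebesgue) \<inter> {a..b} = {v\<in>{a..b}. A \<le> f (v * c) \<and> f (v * c) \<le> B}"
  proof -
    have "0 < c * v \<and> c * v < 1" if "a \<le> v" "v \<le> b" for v
    proof -
      have "c * v \<le> c * b" using that c by (intro mult_left_mono) auto
      then have "c * v < 1" using ab(2) by (simp add: mult.commute)
      moreover have "0 < c * v" using that c ab(1) by (intro mult_pos_pos) auto
      ultimately show ?thesis by simp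
    qed
    then show ?thesis by (auto simp: E_def mult.commute)
  qed
  finally show ?thesis .
qed

text \<open>Each fixed scale \<open>v\<close> eventually belongs to the set, since the ratio at
  \<open>v\<close> converges to a number strictly between \<open>1 / K\<close> and \<open>K\<close>.
  Dominated convergence turns this pointwise fact into one about measures, which needs no uniformity
  in \<open>v\<close>.\<close>

lemma regularly_varying_at_0_level_measure:
  fixes y :: "nat \<Rightarrow> real"
  assumes rv: "regularly_varying_at_0 f \<rho>" and y: "\<And>m. 0 < y m" "\<And>m. y m < 1/8" "y \<longlonglongrightarrow> 0"
    and K: "K = 2 * 4 powr \<bar>\<rho>\<bar>" and b: "1 \<le> b" "b \<le> 4"
  shows "(\<lambda>m. measure lebesgue {v\<in>{1..b}. f (y m) / K \<le> f (v * y m) \<and> f (v * y m) \<le> K * f (y m)}) \<longlonglongrightarrow> b - 1"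
proof -
  define A where "A m = {v\<in>{1..b}. f (y m) / K \<le> f (v * y m) \<and> f (v * y m) \<le> K * f (y m)}" for m
  have "K \<ge> 2" using K by (auto intro!: ge_one_powr_ge_zero)
  have fpos: "0 < f (y m)" for m using rv y(1,2)[of m] by (auto simp: regularly_varying_at_0_def)
  have A[measurable]: "A m \<in> sets lebesgue" for m
    unfolding A_def by (rule regularly_varying_at_0_level_sets[OF rv]) (use y(1,2)[of m] b mult_mono[of b 4 "y m" "1/8"] in auto)
  have lim: "(\<lambda>m. f (v * y m) / f (y m)) \<longlonglongrightarrow> v powr \<rho>" if "v > 0" for v
  proof -
    have "filterlim y (at_right 0) sequentially"
      unfolding filterlim_at using y(3) y(1) by (intro conjI always_eventually allI) (simp_all add: less_imp_neq[symmetric])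
    moreover have "((\<lambda>t. f (v * t) / f t) \<longlongrightarrow> v powr \<rho>) (at_right 0)"
      using rv that by (auto simp: regularly_varying_at_0_def)
    ultimately show ?thesis by (rule filterlim_compose[rotated])
  qed
  have ind: "(\<lambda>m. indicator (A m) v :: real) \<longlonglongrightarrow> indicator {1..b} v" for v
  proof (cases "v \<in> {1..b}")
    case True
    \<comment> \<open>For \<open>v\<close> in [1,4] the limit lies between the powers of 4 with
      exponents -|\<rho>| and |\<rho>|. The factor 2 in \<open>K\<close> makes both inequalities
      strict, so that they hold for large \<open>m\<close>.\<close>
    have p: "v powr \<rho> < K" "1 / K < v powr \<rho>"
    proof -
      have "v powr \<rho> \<le> 4 powr \<bar>\<rho>\<bar>"
        using True b by (metis abs_ge_self atLeastAtMost_iff order.trans powr_mono powr_mono2 abs_ge_zero order_trans zero_le_one)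
      then show "v powr \<rho> < K" using K by (smt (verit) powr_gt_zero)
      have "v powr (- \<rho>) \<le> 4 powr \<bar>\<rho>\<bar>"
        using True b by (metis abs_minus_cancel abs_ge_self atLeastAtMost_iff order.trans powr_mono powr_mono2 abs_ge_zero order_trans zero_le_one)
      then have "v powr (- \<rho>) < K" using K by (smt (verit) powr_gt_zero)
      then show "1 / K < v powr \<rho>" using \<open>K \<ge> 2\<close> True
        by (simp add: powr_minus field_simps)
    qed
    have "eventually (\<lambda>m. 1 / K < f (v * y m) / f (y m)) sequentially"
         "eventually (\<lambda>m. f (v * y m) / f (y m) < K) sequentially"
      using lim[of v] p True by (auto intro: order_tendstoD)
    then have "eventually (\<lambda>m. indicator (A m) v = (indicator {1..b} v :: real)) sequentially"
    proof eventually_elim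
      case (elim m)
      then show ?case using True fpos[of m] \<open>K \<ge> 2\<close> by (auto simp: A_def field_simps indicator_def)
    qed
    then show ?thesis by (rule tendsto_eventually)
  qed (auto simp: A_def indicator_def)
  have "(\<lambda>m. integral\<^sup>L lebesgue (indicator (A m) :: real \<Rightarrow> real)) \<longlonglongrightarrow> integral\<^sup>L lebesgue (indicator {1..b} :: real \<Rightarrow> real)"
  proof (rule integral_dominated_convergence[where w="indicator {1..b}"])
    show "AE v in lebesgue. (\<lambda>m. indicator (A m) v :: real) \<longlonglongrightarrow> indicator {1..b} v"
      using ind by simp
    show "AE v in lebesgue. norm (indicator (A m) v :: real) \<le> indicator {1..b} v" for m
      by (auto simp: A_def split: split_indicator)
    show "integrable lebesgue (indicator {1..b} :: real \<Rightarrow> real)"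
      by (rule integrable_real_indicator) (auto simp: emeasure_lborel_Icc_eq)
    show "(indicator {1..b} :: real \<Rightarrow> real) \<in> borel_measurable lebesgue"
      by (rule borel_measurable_indicator) auto
    show "(indicator (A m) :: real \<Rightarrow> real) \<in> borel_measurable lebesgue" for m
      by (rule borel_measurable_indicator) (rule A)
  qed
  then have "(\<lambda>m. measure lebesgue (A m)) \<longlonglongrightarrow> b - 1" using b by simp
  then show ?thesis unfolding A_def .
qed

text \<open>If the conclusion fails along $x_m \downarrow 0$, $s_m \in [1,2]$, then the sets of scales
  $v$ at which $f(v x_m)$ is comparable to $f(x_m)$, respectively to $f(s_m x_m)$, are almost full
  in $[1,4]$, respectively in $[s_m, 2 s_m]$, hence meet.\<close>
lemma regularly_varying_at_0_doubling:
  assumes rv: "regularly_varying_at_0 f \<rho>"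
  shows "\<exists>C t0. 0 < t0 \<and> t0 \<le> 1/8 \<and> 1 \<le> C \<and>
    (\<forall>x\<in>{0<..<t0}. \<forall>s\<in>{1..2}. f (s * x) \<le> C * f x \<and> f x \<le> C * f (s * x))"
proof (rule ccontr)
  assume no: "\<not> ?thesis"
  \<comment> \<open>The 16 keeps \<open>x\<close> below 1/16 and \<open>s * x\<close> below 1/8, so
    that the level-set lemmas apply at both base points.\<close>
  have "\<exists>x s. x \<in> {0<..<1 / (real n + 16)} \<and> s \<in> {1..2} \<and>
     \<not> (f (s * x) \<le> (real n + 1) * f x \<and> f x \<le> (real n + 1) * f (s * x))" for n
  proof (rule ccontr)
    assume "\<not> ?thesis"
    then have "\<forall>x\<in>{0<..<1 / (real n + 16)}. \<forall>s\<in>{1..2}.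
       f (s * x) \<le> (real n + 1) * f x \<and> f x \<le> (real n + 1) * f (s * x)" by blast
    moreover have "0 < 1 / (real n + 16)" "1 / (real n + 16) \<le> 1/8" "1 \<le> real n + 1" by (auto simp: field_simps)
    ultimately show False using no by blast
  qed
  then obtain x s where x: "\<And>n. x n \<in> {0<..<1 / (real n + 16)}" and s: "\<And>n. s n \<in> {1..2}"
    and bad: "\<And>n. \<not> (f (s n * x n) \<le> (real n + 1) * f (x n) \<and> f (x n) \<le> (real n + 1) * f (s n * x n))"
    by metis
  define y where "y n = s n * x n" for n
  define K where "K = 2 * 4 powr \<bar>\<rho>\<bar>"
  have "K \<ge> 2" by (auto simp: K_def intro!: ge_one_powr_ge_zero)
  have x0: "0 < x n" "x n < 1/16" for n
  proof -
    show "0 < x n" using x[of n] by simp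
    have "x n < 1 / (real n + 16)" using x[of n] by simp
    also have "\<dots> \<le> 1 / 16" by (intro divide_left_mono) auto
    finally show "x n < 1/16" .
  qed
  have y0: "0 < y n" "y n < 1/8" "y n \<le> 2 * x n" for n
  proof -
    show "0 < y n" unfolding y_def using x0(1)[of n] s[of n] by (intro mult_pos_pos) auto
    show "y n \<le> 2 * x n" using x0[of n] s[of n] by (auto simp: y_def)
    then show "y n < 1/8" using x0[of n] by auto
  qed
  have xlim: "x \<longlonglongrightarrow> 0"
  proof (rule tendsto_sandwich[where f="\<lambda>_. 0"])
    show "(\<lambda>n. 1 / (real n + 16)) \<longlonglongrightarrow> 0" by real_asymp
    show "eventually (\<lambda>n. x n \<le> 1 / (real n + 16)) sequentially"
      using x by (intro always_eventually allI) (simp add: less_imp_le)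
    show "eventually (\<lambda>n. 0 \<le> x n) sequentially"
      using x0(1) by (intro always_eventually allI) (simp add: less_imp_le)
  qed simp
  have ylim: "y \<longlonglongrightarrow> 0"
  proof (rule tendsto_sandwich[where f="\<lambda>_. 0"])
    show "(\<lambda>n. 2 * x n) \<longlonglongrightarrow> 0" using tendsto_mult_left[OF xlim, of 2] by simp
    show "eventually (\<lambda>n. y n \<le> 2 * x n) sequentially" using y0(3) by simp
    show "eventually (\<lambda>n. 0 \<le> y n) sequentially"
      using y0(1) by (intro always_eventually allI) (simp add: less_imp_le)
  qed simp
  define A where "A m = {v\<in>{1..4}. f (x m) / K \<le> f (v * x m) \<and> f (v * x m) \<le> K * f (x m)}" for m
  define B where "B m = {v\<in>{1..2}. f (y m) / K \<le> f (v * y m) \<and> f (v * y m) \<le> K * f (y m)}" for m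
  have Alim: "(\<lambda>m. measure lebesgue (A m)) \<longlonglongrightarrow> 4 - 1"
    unfolding A_def by (rule regularly_varying_at_0_level_measure[OF rv _ _ xlim K_def]) (use x0(1) x0(2)[THEN less_trans, of "1/8"] in auto)
  have Blim: "(\<lambda>m. measure lebesgue (B m)) \<longlonglongrightarrow> 2 - 1"
    unfolding B_def by (rule regularly_varying_at_0_level_measure[OF rv _ _ ylim K_def]) (use y0 in auto)
  have A_s: "A m \<in> sets lebesgue" for m unfolding A_def
    by (rule regularly_varying_at_0_level_sets[OF rv]) (use x0[of m] in auto)
  have B_s: "B m \<in> sets lebesgue" for m unfolding B_def
    by (rule regularly_varying_at_0_level_sets[OF rv]) (use y0[of m] in auto)
  \<comment> \<open>Scales relative to \<open>y m\<close> become scales relative to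
    \<open>x m\<close> after multiplication by \<open>s m\<close>, so \<open>A m\<close> and
    \<open>B' m\<close> live in the same interval [1,4].\<close>
  define B' where "B' m = (\<lambda>v. 0 + s m *\<^sub>R v) ` B m" for m
  have B'_m: "measure lebesgue (B' m) = s m * measure lebesgue (B m)" for m
    unfolding B'_def using measure_lebesgue_affine[of "s m" 0 "B m"] s[of m] by simp
  have B'_s: "B' m \<in> sets lebesgue" for m
  proof -
    have "B' m = (\<lambda>v. 0 + (1 / s m) * v) -` B m \<inter> space lebesgue"
      using s[of m] by (auto simp: B'_def image_iff field_simps intro!: bexI[of _ "_ / s m"])
    moreover have "(\<lambda>v. 0 + (1 / s m) * v) \<in> lebesgue \<rightarrow>\<^sub>M lebesgue"
    proof -
      have eq: "(\<lambda>v. 0 + (1 / s m) * v) = (*\<^sub>R) (1 / s m)" by (auto simp: fun_eq_iff)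
      show ?thesis by (subst eq) (rule lebesgue_measurable_scaling)
    qed
    ultimately show ?thesis using B_s measurable_sets by metis
  qed
  have B'_sub: "B' m \<subseteq> {1..4}" for m
  proof
    fix w assume "w \<in> B' m"
    then obtain v where v: "w = s m * v" "1 \<le> v" "v \<le> 2" by (auto simp: B'_def B_def)
    then show "w \<in> {1..4}" using s[of m] mult_mono[of 1 "s m" 1 v] mult_mono[of "s m" 2 v 2] by auto
  qed
  \<comment> \<open>At a common scale both \<open>f (x m)\<close> and \<open>f (y m)\<close> would
    be comparable to one and the same value, hence to each other up to \<open>K * K\<close>, which
    \<open>bad\<close> forbids once \<open>m\<close> is large.\<close>
  have disj: "A m \<inter> B' m = {}" if m: "real m + 1 \<ge> K * K" for m
  proof (rule ccontr)
    assume "A m \<inter> B' m \<noteq> {}"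
    then obtain w v where wv: "w \<in> A m" "v \<in> B m" "w = s m * v" by (auto simp: B'_def)
    have eq: "w * x m = v * y m" by (simp add: wv y_def)
    have fp: "0 < f (x m)" "0 < f (y m)"
      using rv x0[of m] y0[of m] by (auto simp: regularly_varying_at_0_def)
    have 1: "f (x m) / K \<le> f (v * y m)" "f (v * y m) \<le> K * f (x m)"
      using wv(1) eq by (auto simp: A_def)
    have 2: "f (y m) / K \<le> f (v * y m)" "f (v * y m) \<le> K * f (y m)"
      using wv(2) by (auto simp: B_def)
    have "f (y m) \<le> K * (K * f (x m))" "f (x m) \<le> K * (K * f (y m))"
      using order_trans[OF 2(1) 1(2)] order_trans[OF 1(1) 2(2)] \<open>K \<ge> 2\<close> by (auto simp: field_simps)
    moreover have "K * (K * f (x m)) \<le> (real m + 1) * f (x m)" "K * (K * f (y m)) \<le> (real m + 1) * f (y m)"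
      using m fp by (auto simp: mult.assoc[symmetric] intro!: mult_right_mono)
    ultimately show False using bad[of m] by (auto simp: y_def)
  qed
  have "eventually (\<lambda>m. real m + 1 \<ge> K * K) sequentially" by real_asymp
  \<comment> \<open>The measures of \<open>A m\<close> and \<open>B m\<close> tend to 3 and 1. The
    thresholds 5/2 and 3/4 only have to add up to more than 3, the length of [1,4].\<close>
  moreover have "eventually (\<lambda>m. measure lebesgue (A m) > 5/2) sequentially"
    using Alim by (rule order_tendstoD) simp
  moreover have "eventually (\<lambda>m. measure lebesgue (B m) > 3/4) sequentially"
    using Blim by (rule order_tendstoD) simp
  ultimately have "eventually (\<lambda>m::nat. False) sequentially"
  proof eventually_elim
    case (elim m)
    have bd: "A m \<subseteq> {1..4}" "B' m \<subseteq> {1..4}" using B'_sub by (auto simp: A_def)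
    have Af: "A m \<in> lmeasurable" "B' m \<in> lmeasurable"
      using bd A_s B'_s by (auto intro!: bounded_set_imp_lmeasurable bounded_subset[OF bounded_closed_interval])
    have "measure lebesgue (A m) + measure lebesgue (B' m) = measure lebesgue (A m \<union> B' m)"
      using Af disj[OF elim(1)] by (auto simp: measure_Un3)
    also have "\<dots> \<le> measure lebesgue {1..4::real}"
      using bd Af by (intro measure_mono_fmeasurable) auto
    also have "\<dots> = 3" by simp
    finally have le: "measure lebesgue (A m) + s m * measure lebesgue (B m) \<le> 3" by (simp add: B'_m)
    have "1 * measure lebesgue (B m) \<le> s m * measure lebesgue (B m)"
      using s[of m] by (intro mult_right_mono) auto
    then show False using le elim by linarith
  qed
  then show False by simp
qed

text \<open>A ratio of at most \<open>L\<close> is a product of at most \<open>j\<close> factors in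
  [1,2] when \<open>L\<close> is at most 2^j, so the doubling bound is iterated \<open>j\<close>
  times.\<close>

lemma regularly_varying_at_0_comparable:
  assumes rv: "regularly_varying_at_0 f \<rho>" and L: "1 \<le> L"
  shows "\<exists>C t0. 0 < t0 \<and> t0 \<le> 1/8 \<and> 1 \<le> C \<and>
    (\<forall>x\<in>{0<..<t0}. \<forall>y\<in>{0<..<t0}. y \<le> L * x \<longrightarrow> x \<le> L * y \<longrightarrow> f y \<le> C * f x)"
proof -
  obtain C t0 where t0: "0 < t0" "t0 \<le> 1/8" and C: "1 \<le> C"
    and H: "\<And>x s. x \<in> {0<..<t0} \<Longrightarrow> s \<in> {1..2} \<Longrightarrow> f (s * x) \<le> C * f x \<and> f x \<le> C * f (s * x)"
    using regularly_varying_at_0_doubling[OF rv] by metis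
  obtain j :: nat where j: "L \<le> 2 ^ j" using real_arch_pow[of 2 L] by (auto intro: less_imp_le)
  have fp: "0 < f x" if "x \<in> {0<..<t0}" for x
    using rv that t0 by (auto simp: regularly_varying_at_0_def)
  have main: "f y \<le> C ^ i * f x \<and> f x \<le> C ^ i * f y"
    if "x \<in> {0<..<t0}" "y \<in> {0<..<t0}" "x \<le> y" "y \<le> 2 ^ i * x" for x y i
    using that
  proof (induction i arbitrary: y)
    case 0 then show ?case by auto
  next
    case (Suc i)
    show ?case
    proof (cases "y \<le> 2 ^ i * x")
      case True
      then have IH: "f y \<le> C ^ i * f x" "f x \<le> C ^ i * f y" using Suc by auto
      have "C ^ i * f x \<le> C ^ Suc i * f x" "C ^ i * f y \<le> C ^ Suc i * f y"
        using C fp[OF Suc.prems(1)] fp[OF Suc.prems(2)] by (auto intro!: mult_right_mono power_increasing)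
      then show ?thesis using IH by linarith
    next
      case False
      \<comment> \<open>Step down from \<open>y\<close> by a factor 2, or by exactly
        \<open>y / x\<close> if a factor 2 would overshoot \<open>x\<close>.\<close>
      define s where "s = min 2 (y / x)"
      define z where "z = y / s"
      have s: "s \<in> {1..2}" using Suc.prems by (auto simp: s_def field_simps)
      have z: "z \<in> {0<..<t0}" "x \<le> z" "z \<le> 2 ^ i * x"
      proof -
        have "s \<le> y / x" by (simp add: s_def)
        then show "x \<le> z" using s Suc.prems by (auto simp: z_def field_simps)
        have "z \<le> y" using s Suc.prems by (auto simp: z_def field_simps mult_le_cancel_left1)
        then show "z \<in> {0<..<t0}" using \<open>x \<le> z\<close> Suc.prems by auto
        show "z \<le> 2 ^ i * x"
        proof (cases "y / x \<le> 2")
          case True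
          then have "z = x" using Suc.prems by (auto simp: z_def s_def)
          then show ?thesis using Suc.prems one_le_power[of "2::real" i] by auto
        next
          case False
          then have "s = 2" by (auto simp: s_def)
          then show ?thesis using Suc.prems by (auto simp: z_def)
        qed
      qed
      have IH: "f z \<le> C ^ i * f x" "f x \<le> C ^ i * f z" using Suc.IH[of z] z Suc.prems by auto
      have "s * z = y" using s by (auto simp: z_def)
      then have st: "f y \<le> C * f z" "f z \<le> C * f y" using H[of z s] z s by auto
      have "C * f z \<le> C * (C ^ i * f x)" using C IH by (intro mult_left_mono) auto
      moreover have "C ^ i * f z \<le> C ^ i * (C * f y)" using C st by (intro mult_left_mono) auto
      ultimately show ?thesis using IH st by (auto simp: algebra_simps)
    qed
  qed
  have "f y \<le> C ^ j * f x" if "x \<in> {0<..<t0}" "y \<in> {0<..<t0}" "y \<le> L * x" "x \<le> L * y" for x y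
  proof (cases "x \<le> y")
    case True
    have "L * x \<le> 2 ^ j * x" using j that by (intro mult_right_mono) auto
    then show ?thesis using main[of x y j] that True by auto
  next
    case False
    have "L * y \<le> 2 ^ j * y" using j that by (intro mult_right_mono) auto
    then show ?thesis using main[of y x j] that False by auto
  qed
  then show ?thesis using t0 C one_le_power[OF C] by blast
qed

section \<open>Comparability on the whole unit interval\<close>

lemma comparable_on_compact:
  fixes h :: "real \<Rightarrow> real"
  assumes "continuous_on {0<..<1} h" and pos: "\<And>u. u \<in> {0<..<1} \<Longrightarrow> 0 < h u" and a: "0 < a"
  shows "\<exists>C\<ge>1. \<forall>u\<in>{a..1-a}. \<forall>\<theta>\<in>{a..1-a}. h \<theta> \<le> C * h u"
proof (cases "a \<le> 1 - a")
  case True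
  have c: "continuous_on {a..1-a} h"
    by (rule continuous_on_subset[OF assms(1)]) (use a in auto)
  obtain p where p: "p \<in> {a..1-a}" "\<And>u. u \<in> {a..1-a} \<Longrightarrow> h u \<le> h p"
    using continuous_attains_sup[OF _ _ c] True by auto
  obtain q where q: "q \<in> {a..1-a}" "\<And>u. u \<in> {a..1-a} \<Longrightarrow> h q \<le> h u"
    using continuous_attains_inf[OF _ _ c] True by auto
  have hq: "0 < h q" using pos[of q] q a by auto
  show ?thesis
  proof (intro exI[of _ "h p / h q"] conjI ballI)
    show "1 \<le> h p / h q" using p(2)[OF q(1)] hq by simp
    fix u \<theta> assume u: "u \<in> {a..1-a}" and t: "\<theta> \<in> {a..1-a}"
    have "0 \<le> h p / h q" using \<open>1 \<le> h p / h q\<close> by simp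
    have "h \<theta> \<le> h p" by (rule p(2)[OF t])
    also have "h p = h p / h q * h q" using hq by simp
    also have "\<dots> \<le> h p / h q * h u" by (rule mult_left_mono[OF q(2)[OF u] \<open>0 \<le> h p / h q\<close>])
    finally show "h \<theta> \<le> h p / h q * h u" .
  qed
qed (auto intro!: exI[of _ 1])

text \<open>Closeness on the multiplicative scale natural for regular variation at both ends: near 0
  the first two inequalities are the restrictive ones, near 1 the last two.\<close>

definition close_ratio :: "real \<Rightarrow> real \<Rightarrow> real \<Rightarrow> bool" where
  "close_ratio L u \<theta> \<longleftrightarrow> u \<le> L * \<theta> \<and> \<theta> \<le> L * u \<and> 1 - u \<le> L * (1 - \<theta>) \<and> 1 - \<theta> \<le> L * (1 - u)"

text \<open>Near 0 and near 1 regular variation of \<open>h\<close>, respectively of its reflection,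
  gives the bound; in between a positive continuous function on a compact interval is comparable to
  a constant.\<close>

lemma regularly_varying_comparable:
  fixes h :: "real \<Rightarrow> real"
  assumes cont: "continuous_on {0<..<1} h" and rv: "regularly_varying_at_endpoints h" and L: "1 \<le> L"
  shows "\<exists>C\<ge>1. \<forall>u\<in>{0<..<1}. \<forall>\<theta>\<in>{0<..<1}. close_ratio L u \<theta> \<longrightarrow> h \<theta> \<le> C * h u"
proof -
  obtain \<rho>0 \<rho>1 where rv0: "regularly_varying_at_0 h \<rho>0" and rv1: "regularly_varying_at_0 (\<lambda>t. h (1 - t)) \<rho>1"
    using rv by (auto simp: regularly_varying_at_endpoints_def regularly_varying_at_1_def)
  have pos: "0 < h u" if "u \<in> {0<..<1}" for u using rv0 that by (auto simp: regularly_varying_at_0_def)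
  obtain C0 t0 where C0: "0 < t0" "1 \<le> C0"
    "\<And>x y. x \<in> {0<..<t0} \<Longrightarrow> y \<in> {0<..<t0} \<Longrightarrow> y \<le> L * x \<Longrightarrow> x \<le> L * y \<Longrightarrow> h y \<le> C0 * h x"
    using regularly_varying_at_0_comparable[OF rv0 L] by metis
  obtain C1 t1 where C1: "0 < t1" "1 \<le> C1"
    "\<And>x y. x \<in> {0<..<t1} \<Longrightarrow> y \<in> {0<..<t1} \<Longrightarrow> y \<le> L * x \<Longrightarrow> x \<le> L * y \<Longrightarrow> h (1 - y) \<le> C1 * h (1 - x)"
    using regularly_varying_at_0_comparable[OF rv1 L] by metis
  define t where "t = min t0 t1"
  \<comment> \<open>One division by \<open>L\<close> keeps the companion of a small \<open>u\<close>
    below \<open>t\<close>; for the remaining \<open>u\<close> the companion can shrink by a further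
    factor \<open>L\<close>, and the compact interval has to reach that far.\<close>
  define a where "a = t / L / L"
  have t: "0 < t" using C0 C1 by (auto simp: t_def)
  have aL: "L * a \<le> t / L" "a \<le> t / L" "0 < a" "L * (t / L) = t"
  proof -
    show "0 < a" using t L by (simp add: a_def)
    show "L * a \<le> t / L" using L by (simp add: a_def)
    have "1 * a \<le> L * a" using L \<open>0 < a\<close> by (intro mult_right_mono) auto
    then show "a \<le> t / L" using \<open>L * a \<le> t / L\<close> by simp
    show "L * (t / L) = t" using L by simp
  qed
  obtain C2 where C2: "1 \<le> C2" "\<And>u \<theta>. u \<in> {a..1-a} \<Longrightarrow> \<theta> \<in> {a..1-a} \<Longrightarrow> h \<theta> \<le> C2 * h u"
    using comparable_on_compact[OF cont pos aL(3)] by metis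
  define C where "C = C0 + C1 + C2"
  have "h \<theta> \<le> C * h u" if u: "u \<in> {0<..<1}" and th: "\<theta> \<in> {0<..<1}" and r: "close_ratio L u \<theta>" for u \<theta>
  proof -
    have le: "C' * h u \<le> C * h u" if "C' \<le> C" for C' using pos[OF u] that by (intro mult_right_mono) auto
    consider "u < t / L" | "1 - u < t / L" | "t / L \<le> u" "t / L \<le> 1 - u" by linarith
    then show ?thesis
    proof cases
      case 1
      have "L * u < t" using 1 L by (simp add: field_simps)
      then have "\<theta> < t" using r by (auto simp: close_ratio_def)
      moreover have "1 * u \<le> L * u" using L u by (intro mult_right_mono) auto
      then have "u < t" using \<open>L * u < t\<close> by linarith
      ultimately have "h \<theta> \<le> C0 * h u"
        by (intro C0(3)) (use u th r in \<open>auto simp: t_def close_ratio_def\<close>)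
      also have "\<dots> \<le> C * h u" using C0 C1 C2 by (intro le) (auto simp: C_def)
      finally show ?thesis .
    next
      case 2
      have "L * (1 - u) < t" using 2 L by (simp add: field_simps)
      then have "1 - \<theta> < t" using r by (auto simp: close_ratio_def)
      moreover have "1 * (1 - u) \<le> L * (1 - u)" using L u by (intro mult_right_mono) auto
      then have "1 - u < t" using \<open>L * (1 - u) < t\<close> by (metis mult_1 order.strict_trans1)
      ultimately have "h (1 - (1 - \<theta>)) \<le> C1 * h (1 - (1 - u))"
        by (intro C1(3)) (use u th r in \<open>auto simp: t_def close_ratio_def\<close>)
      also have "\<dots> \<le> C * h u" using C0 C1 C2 le[of C1] by (auto simp: C_def)
      finally show ?thesis by simp
    next
      case 3
      have "t / L \<le> L * \<theta>" "t / L \<le> L * (1 - \<theta>)"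
        using 3 r by (auto simp: close_ratio_def)
      then have "a \<le> \<theta>" "a \<le> 1 - \<theta>" using L by (auto simp: a_def field_simps)
      then have "h \<theta> \<le> C2 * h u" by (intro C2(2)) (use 3 aL in auto)
      also have "\<dots> \<le> C * h u" using C0 C1 C2 by (intro le) (auto simp: C_def)
      finally show ?thesis .
    qed
  qed
  moreover have "1 \<le> C" using C0 C1 C2 by (auto simp: C_def)
  ultimately show ?thesis by blast
qed

text \<open>The counterpart for weights of compact support: only \<open>u\<close> is confined to
  \<open>K\<close>, and its companions then stay in a slightly larger compact interval, so
  continuity of \<open>h\<close> is enough.\<close>

lemma compact_subset_comparable:
  fixes h :: "real \<Rightarrow> real"
  assumes cont: "continuous_on {0<..<1} h" and pos: "\<And>u. u \<in> {0<..<1} \<Longrightarrow> 0 < h u" and L: "1 \<le> L"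
    and K: "compact K" "K \<subseteq> {0<..<1}"
  shows "\<exists>C\<ge>1. \<forall>u\<in>K. \<forall>\<theta>\<in>{0<..<1}. close_ratio L u \<theta> \<longrightarrow> h \<theta> \<le> C * h u"
proof (cases "K = {}")
  case False
  obtain p where p: "p \<in> K" "\<And>u. u \<in> K \<Longrightarrow> p \<le> u" using compact_attains_inf[OF K(1) False] by auto
  obtain q where q: "q \<in> K" "\<And>u. u \<in> K \<Longrightarrow> u \<le> q" using compact_attains_sup[OF K(1) False] by auto
  define a where "a = min p (1 - q) / L"
  have "p \<in> {0<..<1}" "q \<in> {0<..<1}" using p(1) q(1) K(2) by blast+
  then have a: "0 < a" unfolding a_def using L by (intro divide_pos_pos) auto
  obtain C where C: "1 \<le> C" "\<And>u \<theta>. u \<in> {a..1-a} \<Longrightarrow> \<theta> \<in> {a..1-a} \<Longrightarrow> h \<theta> \<le> C * h u"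
    using comparable_on_compact[OF cont pos a] by metis
  have "h \<theta> \<le> C * h u" if u: "u \<in> K" and th: "\<theta> \<in> {0<..<1}" and r: "close_ratio L u \<theta>" for u \<theta>
  proof (rule C(2))
    have La: "L * a \<le> p" "L * a \<le> 1 - q" using L by (auto simp: a_def)
    have "L * a \<le> u" "L * a \<le> 1 - u" using La p(2)[OF u] q(2)[OF u] by auto
    moreover have "a \<le> L * a" using mult_right_mono[OF L, of a] a by simp
    ultimately show "u \<in> {a..1-a}" by auto
    have "L * a \<le> L * \<theta>" "L * a \<le> L * (1 - \<theta>)"
      using r \<open>L * a \<le> u\<close> \<open>L * a \<le> 1 - u\<close> by (auto simp: close_ratio_def)
    then have "a \<le> \<theta>" "a \<le> 1 - \<theta>" using L by auto
    then show "\<theta> \<in> {a..1-a}" by auto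
  qed
  then show ?thesis using C(1) by blast
qed auto

section \<open>Riemann sums of a regularly varying integrable function near an endpoint\<close>

lemma set_integral_tail_tendsto_0:
  fixes g :: "real \<Rightarrow> real"
  assumes g: "set_integrable lebesgue {0<..<1} g"
  shows "(\<lambda>n. LINT x:{0<..1 / (real n + 2)}|lebesgue. g x) \<longlonglongrightarrow> 0"
proof -
  have "(\<lambda>n. integral\<^sup>L lebesgue (\<lambda>x. indicator {0<..1 / (real n + 2)} x *\<^sub>R g x)) \<longlonglongrightarrow> integral\<^sup>L lebesgue (\<lambda>x::real. 0::real)"
  proof (rule integral_dominated_convergence[where w="\<lambda>x. norm (indicator {0<..<1} x *\<^sub>R g x)"])
    show "integrable lebesgue (\<lambda>x. norm (indicator {0<..<1} x *\<^sub>R g x))"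
      using g unfolding set_integrable_def by (rule integrable_norm)
    have lt: "1 / (real n + 2) < 1" for n by (simp add: field_simps)
    have eq: "indicator {0<..1 / (real n + 2)} x *\<^sub>R g x = indicator {0<..1 / (real n + 2)} x *\<^sub>R (indicator {0<..<1} x *\<^sub>R g x)" for n x
      using order.strict_trans1[OF _ lt[of n], of x] by (cases "x \<le> 1 / (real n + 2)") (auto simp: indicator_def)
    show "(\<lambda>x. indicator {0<..1 / (real n + 2)} x *\<^sub>R g x) \<in> borel_measurable lebesgue" for n
      unfolding eq using g unfolding set_integrable_def
      by (intro borel_measurable_scaleR borel_measurable_indicator borel_measurable_integrable) auto
    show "AE x in lebesgue. norm (indicator {0<..1 / (real n + 2)} x *\<^sub>R g x) \<le> norm (indicator {0<..<1} x *\<^sub>R g x)" for n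
      unfolding eq by (auto simp: indicator_def)
    show "AE x in lebesgue. (\<lambda>n. indicator {0<..1 / (real n + 2)} x *\<^sub>R g x) \<longlonglongrightarrow> 0"
    proof (rule AE_I2)
      fix x :: real
      show "(\<lambda>n. indicator {0<..1 / (real n + 2)} x *\<^sub>R g x) \<longlonglongrightarrow> 0"
      proof (cases "x > 0")
        case True
        have "(\<lambda>n. 1 / (real n + 2)) \<longlonglongrightarrow> 0" by real_asymp
        then have "eventually (\<lambda>n. 1 / (real n + 2) < x) sequentially"
          using True by (rule order_tendstoD)
        then have "eventually (\<lambda>n. indicator {0<..1 / (real n + 2)} x *\<^sub>R g x = 0) sequentially"
          by eventually_elim (auto simp: indicator_def)
        then show ?thesis by (rule tendsto_eventually)
      qed auto
    qed
  qed auto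
  then show ?thesis by (simp add: set_lebesgue_integral_def)
qed

text \<open>An integrable function can have large Riemann sums, but comparability bounds the value
  at a node by \<open>C\<close> times every value on the half cell to its left. These half cells are
  disjoint, so the sum is at most a multiple of the integral over (0,t].\<close>

lemma regularly_varying_riemann_sum_tail:
  assumes rv: "regularly_varying_at_0 g \<rho>" and int: "integrable (lebesgue_on {0<..<1}) g" and e: "0 < e"
  shows "\<exists>t>0. \<forall>n m. 1 \<le> n \<longrightarrow> real m / (real n + 1) \<le> t \<longrightarrow> (\<Sum>k = 1..m. g (real k / (real n + 1)) / real n) \<le> e"
proof -
  obtain C t0 where t0: "0 < t0" "t0 \<le> 1/8" and C: "1 \<le> C"
    and H: "\<And>x y. x \<in> {0<..<t0} \<Longrightarrow> y \<in> {0<..<t0} \<Longrightarrow> y \<le> 2 * x \<Longrightarrow> x \<le> 2 * y \<Longrightarrow> g y \<le> C * g x"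
    using regularly_varying_at_0_comparable[OF rv, of 2] by (metis one_le_numeral)
  have gpos: "0 < g x" if "x \<in> {0<..<1}" for x using rv that by (auto simp: regularly_varying_at_0_def)
  have g_int: "set_integrable lebesgue {0<..<1} g"
    using int by (subst (asm) integrable_restrict_space) (auto simp: set_integrable_def)
  define I where "I a = (LINT x:{0<..a}|lebesgue. g x)" for a
  \<comment> \<open>The 4 pays for two losses: a half cell has length 1/2 of the mesh, and the mesh
    \<open>1 / (real n + 1)\<close> is replaced by \<open>1 / real n\<close>.\<close>
  have "eventually (\<lambda>n. I (1 / (real n + 2)) < e / (4 * C)) sequentially"
    using set_integral_tail_tendsto_0[OF g_int] C e unfolding I_def by (intro order_tendstoD(2)) auto
  moreover have "eventually (\<lambda>n. 1 / (real n + 2) < t0) sequentially"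
    by (rule order_tendstoD(2)[OF _ t0(1)]) real_asymp
  ultimately have "eventually (\<lambda>n. I (1 / (real n + 2)) < e / (4 * C) \<and> 1 / (real n + 2) < t0) sequentially"
    by eventually_elim auto
  then obtain n0 :: nat where n0: "I (1 / (real n0 + 2)) < e / (4 * C)" "1 / (real n0 + 2) < t0"
    using eventually_happens'[OF sequentially_bot] by blast
  define t where "t = 1 / (real n0 + 2)"
  have t: "0 < t" "t < t0" "I t \<le> e / (4 * C)" using n0 by (auto simp: t_def)
  have int_t: "integrable lebesgue (\<lambda>x. indicator {0<..t} x *\<^sub>R g x)"
  proof -
    have "{0<..t} \<subseteq> {0<..<1}" using t t0 by auto
    then have "set_integrable lebesgue {0<..t} g" by (intro set_integrable_subset[OF g_int]) auto
    then show ?thesis by (simp add: set_integrable_def)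
  qed
  have "(\<Sum>k = 1..m. g (real k / (real n + 1)) / real n) \<le> e" if n: "1 \<le> n" and m: "real m / (real n + 1) \<le> t" for n m
  proof -
    define u where "u k = real k / (real n + 1)" for k
    \<comment> \<open>Starting at \<open>k - 1/2\<close> instead of \<open>k - 1\<close> keeps the
      first cell away from 0, so that every point of a cell is within a factor 2 of its
      node.\<close>
    define J where "J k = {(real k - 1/2) / (real n + 1) <.. u k}" for k
    have u: "0 < u k" "u k \<le> t" "J k \<subseteq> {0<..t}" if "k \<in> {1..m}" for k
    proof -
      show "0 < u k" using that by (auto simp: u_def)
      have "u k \<le> u m" using that by (auto simp: u_def divide_right_mono)
      then show "u k \<le> t" using m by (simp add: u_def)
      moreover have "0 < (real k - 1/2) / (real n + 1)" using that by (intro divide_pos_pos) auto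
      ultimately show "J k \<subseteq> {0<..t}" unfolding J_def by (auto intro: less_trans)
    qed
    have mJ: "measure lebesgue (J k) = 1 / (2 * (real n + 1))" for k
      by (auto simp: J_def u_def divide_right_mono diff_divide_distrib)
    have emJ: "emeasure lebesgue (J k) < \<infinity>" for k by (simp add: J_def u_def divide_right_mono)
    have Jsets: "J k \<in> sets lebesgue" for k by (auto simp: J_def)
    have ptw: "(\<Sum>k = 1..m. g (u k) * indicator (J k) x) \<le> C * (indicator {0<..t} x *\<^sub>R g x)" for x
    proof (cases "\<exists>k\<in>{1..m}. x \<in> J k")
      case True
      then obtain k where k: "k \<in> {1..m}" "x \<in> J k" by auto
      have "x \<notin> J l" if "l \<in> {1..m}" "l \<noteq> k" for l
      proof
        assume "x \<in> J l"
        then have "real l - 1/2 < real k" "real k - 1/2 < real l"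
          using k by (auto simp: J_def u_def field_simps intro: less_le_trans)
        then have "l = k" by linarith
        then show False using that by simp
      qed
      then have "(\<Sum>k = 1..m. g (u k) * indicator (J k) x) = (\<Sum>l\<in>{k}. g (u l) * indicator (J l) x)"
        using k by (intro sum.mono_neutral_right) auto
      also have "\<dots> = g (u k)" using k by simp
      also have "\<dots> \<le> C * g x"
      proof (rule H)
        have x: "x \<in> {0<..t}" using u(3)[OF k(1)] k(2) by auto
        then show "x \<in> {0<..<t0}" using t by auto
        show "u k \<in> {0<..<t0}" using u[OF k(1)] t by auto
        have "(real k - 1/2) / (real n + 1) < x" "x \<le> u k" using k(2) by (auto simp: J_def)
        then show "x \<le> 2 * u k" using u(1)[OF k(1)] by auto
        have "real k / (real n + 1) \<le> (2 * (real k - 1/2)) / (real n + 1)" using k(1) by (intro divide_right_mono) auto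
        then have "u k \<le> 2 * ((real k - 1/2) / (real n + 1))" by (simp add: u_def)
        then show "u k \<le> 2 * x" using \<open>_ < x\<close> by linarith
      qed
      finally show ?thesis using u(3)[OF k(1)] k(2) by auto
    next
      case False
      then have "(\<Sum>k = 1..m. g (u k) * indicator (J k) x) = 0" by (intro sum.neutral) auto
      moreover have "0 \<le> C * (indicator {0<..t} x *\<^sub>R g x)"
        using C gpos[of x] t t0 by (auto simp: indicator_def)
      ultimately show ?thesis by simp
    qed
    have iJ: "integrable lebesgue (\<lambda>x. g (u k) * indicator (J k) x)" for k
      using integrable_real_indicator[OF Jsets emJ] by (rule integrable_mult_right)
    have "(\<Sum>k = 1..m. g (u k) * (1 / (2 * (real n + 1)))) = (\<Sum>k = 1..m. integral\<^sup>L lebesgue (\<lambda>x. g (u k) * indicator (J k) x))"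
      using Jsets by (simp add: mJ)
    also have "\<dots> = integral\<^sup>L lebesgue (\<lambda>x. \<Sum>k = 1..m. g (u k) * indicator (J k) x)"
      by (rule Bochner_Integration.integral_sum[symmetric]) (rule iJ)
    also have "\<dots> \<le> integral\<^sup>L lebesgue (\<lambda>x. C * (indicator {0<..t} x *\<^sub>R g x))"
      by (intro integral_mono Bochner_Integration.integrable_sum iJ integrable_mult_right int_t ptw)
    also have "\<dots> = C * I t" by (simp add: I_def set_lebesgue_integral_def)
    also have "\<dots> \<le> C * (e / (4 * C))" using C t by (intro mult_left_mono) auto
    also have "\<dots> = e / 4" using C by simp
    finally have "(\<Sum>k = 1..m. g (u k)) * (1 / (2 * (real n + 1))) \<le> e / 4" by (simp only: sum_distrib_right)
    then have "(\<Sum>k = 1..m. g (u k)) \<le> e / 4 * (2 * (real n + 1))" by (simp add: field_simps)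
    also have "\<dots> \<le> e / 4 * (4 * real n)" using e n by (intro mult_left_mono) auto
    finally have "(\<Sum>k = 1..m. g (u k)) / real n \<le> e" using n by (simp add: divide_le_eq)
    then show ?thesis by (simp add: sum_divide_distrib u_def)
  qed
  then show ?thesis using t by blast
qed

subsection \<open>Order statistics\<close>

text \<open>Sorting does not change the number of entries up to \<open>t\<close>, and in a sorted
  list these entries form an initial segment.\<close>

lemma sort_nth_le_iff:
  fixes xs :: "real list"
  assumes "i < length xs"
  shows "sort xs ! i \<le> t \<longleftrightarrow> i < length (filter (\<lambda>x. x \<le> t) xs)"
proof -
  define ys where "ys = sort xs"
  have s: "sorted ys" and l: "i < length ys" using assms by (auto simp: ys_def)
  have "length (filter (\<lambda>x. x \<le> t) ys) = length (filter (\<lambda>x. x \<le> t) xs)"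
    unfolding ys_def by (metis mset_filter mset_sort size_mset)
  moreover have "ys ! i \<le> t \<longleftrightarrow> i < length (filter (\<lambda>x. x \<le> t) ys)"
    using s l
  proof (induction ys arbitrary: i)
    case (Cons y ys)
    show ?case
    proof (cases "y \<le> t")
      case True
      show ?thesis
      proof (cases i)
        case (Suc k)
        then show ?thesis using Cons True by auto
      qed (use True in auto)
    next
      case False
      then have "filter (\<lambda>x. x \<le> t) (y # ys) = []" using Cons.prems by (auto simp: filter_empty_conv)
      moreover have "y \<le> (y # ys) ! i" using Cons.prems by (cases i) (auto simp: nth_Cons)
      ultimately show ?thesis using False by auto
    qed
  qed auto
  ultimately show ?thesis by (simp add: ys_def)
qed

text \<open>The duality between order statistics and counts, from which measurability, the binomial
  distribution function and the Bahadur representation are derived.\<close>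

lemma order_stat_le_iff:
  assumes "1 \<le> k" "k \<le> n"
  shows "order_stat n x k \<le> t \<longleftrightarrow> k \<le> card {j\<in>{1..n}. x j \<le> t}"
proof -
  have "length (filter (\<lambda>y. y \<le> t) (map x [1..<n+1])) = card {j\<in>{1..n}. x j \<le> t}"
  proof -
    have "length (filter (\<lambda>y. y \<le> t) (map x [1..<n+1])) = length (filter (\<lambda>j. x j \<le> t) [1..<n+1])"
      by (simp add: filter_map o_def del: upt_Suc)
    also have "\<dots> = card (set (filter (\<lambda>j. x j \<le> t) [1..<n+1]))"
      by (subst distinct_card) auto
    also have "set (filter (\<lambda>j. x j \<le> t) [1..<n+1]) = {j\<in>{1..n}. x j \<le> t}" by auto
    finally show ?thesis .
  qed
  then show ?thesis
    using sort_nth_le_iff[of "k - 1" "map x [1..<n+1]" t] assms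
    by (auto simp: order_stat_def simp del: upt_Suc)
qed

lemma order_stat_in:
  assumes "1 \<le> k" "k \<le> n"
  shows "order_stat n x k \<in> x ` {1..n}"
proof -
  have "order_stat n x k \<in> set (sort (map x [1..<n+1]))"
    unfolding order_stat_def using assms by (intro nth_mem) auto
  then show ?thesis by auto
qed

text \<open>A monotone map commutes with sorting. Monotonicity is asked only on the sample values
  because the quantile function is used only on (0,1).\<close>

lemma order_stat_mono:
  assumes "1 \<le> k" "k \<le> n" and f: "mono_on (x ` {1..n}) f"
  shows "order_stat n (\<lambda>j. f (x j)) k = f (order_stat n x k)"
proof -
  let ?xs = "map x [1..<n+1]"
  have st: "set (sort ?xs) = x ` {1..n}" by auto
  have "sort (map f ?xs) = map f (sort ?xs)"
  proof (rule properties_for_sort)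
    show "mset (map f (sort ?xs)) = mset (map f ?xs)" by (simp only: mset_map mset_sort)
    show "sorted (map f (sort ?xs))"
      by (rule sorted_map_mono) (use f st in \<open>auto simp del: upt_Suc\<close>)
  qed
  moreover have "map f ?xs = map (\<lambda>j. f (x j)) [1..<n+1]" by simp
  ultimately have "sort (map (\<lambda>j. f (x j)) [1..<n+1]) = map f (sort ?xs)" by metis
  then show ?thesis unfolding order_stat_def using assms by (simp del: upt_Suc)
qed

lemma order_stat_cong: "(\<And>j. j \<in> {1..n} \<Longrightarrow> x j = y j) \<Longrightarrow> order_stat n x k = order_stat n y k"
  unfolding order_stat_def by (intro arg_cong2[where f=nth] arg_cong[where f=sort] map_cong) auto

lemma borel_measurable_order_stat:
  assumes X: "\<And>j. j \<in> {1..n} \<Longrightarrow> X j \<in> borel_measurable M" and k: "1 \<le> k" "k \<le> n"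
  shows "(\<lambda>x. order_stat n (\<lambda>j. X j x) k) \<in> borel_measurable M"
proof (rule borel_measurableI_le)
  fix t
  have "real k \<le> (\<Sum>j\<in>{1..n}. indicator {x\<in>space M. X j x \<le> t} x) \<longleftrightarrow> order_stat n (\<lambda>j. X j x) k \<le> t"
    if "x \<in> space M" for x
  proof -
    have "(\<Sum>j\<in>{1..n}. indicator {x\<in>space M. X j x \<le> t} x) = (\<Sum>j\<in>{1..n}. if X j x \<le> t then 1 else 0 :: real)"
      using that by (intro sum.cong) (auto simp: indicator_def)
    also have "\<dots> = real (card {j\<in>{1..n}. X j x \<le> t})"
      by (subst sum.inter_filter[symmetric]) auto
    finally show ?thesis by (simp add: order_stat_le_iff[OF k])
  qed
  then have "{x \<in> space M. order_stat n (\<lambda>j. X j x) k \<le> t}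
     = {x \<in> space M. real k \<le> (\<Sum>j\<in>{1..n}. indicator {x\<in>space M. X j x \<le> t} x)}"
    by auto
  also have "\<dots> \<in> sets M"
  proof -
    have [measurable]: "{x\<in>space M. X j x \<le> t} \<in> sets M" if "j \<in> {1..n}" for j using X[OF that] by measurable
    show ?thesis by measurable
  qed
  finally show "{x \<in> space M. order_stat n (\<lambda>j. X j x) k \<le> t} \<in> sets M" .
qed

subsection \<open>Integral functionals of a process\<close>

text \<open>Linear combinations of characters of finite-dimensional marginals: the functionals of a
  path whose expectations are governed by joint characteristic functions. Exponents add under
  multiplication, so the class is an algebra; this is what lets powers of an integral be
  treated.\<close>

inductive trig_poly :: "'i set \<Rightarrow> (('i \<Rightarrow> real) \<Rightarrow> complex) \<Rightarrow> bool" for S where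
  basic: "finite J \<Longrightarrow> J \<subseteq> S \<Longrightarrow> trig_poly S (\<lambda>d. iexp (\<Sum>u\<in>J. c u * d u))"
| add: "trig_poly S F \<Longrightarrow> trig_poly S G \<Longrightarrow> trig_poly S (\<lambda>d. F d + G d)"
| scale: "trig_poly S F \<Longrightarrow> trig_poly S (\<lambda>d. a * F d)"

lemma trig_poly_const: "trig_poly S (\<lambda>d. a)"
  using trig_poly.scale[OF trig_poly.basic[of "{}" S undefined], of a] by simp

lemma trig_poly_basic_mult:
  assumes J: "finite J" "J \<subseteq> S" and F: "trig_poly S F"
  shows "trig_poly S (\<lambda>d. iexp (\<Sum>u\<in>J. c u * d u) * F d)"
  using F
proof induction
  case (basic J' c')
  \<comment> \<open>Both coefficient families are extended by 0 to the union of the index sets and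
    added there.\<close>
  define c'' where "c'' u = (if u \<in> J then c u else 0) + (if u \<in> J' then c' u else 0)" for u
  have "(\<Sum>u\<in>J. c u * d u) + (\<Sum>u\<in>J'. c' u * d u) = (\<Sum>u\<in>J \<union> J'. c'' u * d u)" for d
  proof -
    have "(\<Sum>u\<in>J. c u * d u) = (\<Sum>u\<in>J \<union> J'. (if u \<in> J then c u else 0) * d u)"
      using J basic by (intro sum.mono_neutral_cong_left) auto
    moreover have "(\<Sum>u\<in>J'. c' u * d u) = (\<Sum>u\<in>J \<union> J'. (if u \<in> J' then c' u else 0) * d u)"
      using J basic by (intro sum.mono_neutral_cong_left) auto
    ultimately show ?thesis by (simp add: c''_def sum.distrib[symmetric] algebra_simps)
  qed
  then have "iexp (\<Sum>u\<in>J. c u * d u) * iexp (\<Sum>u\<in>J'. c' u * d u) = iexp (\<Sum>u\<in>J \<union> J'. c'' u * d u)" for d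
    by (metis distrib_left exp_add of_real_add)
  then show ?case using trig_poly.basic[of "J \<union> J'" S c''] J basic by simp
next
  case (add F G)
  then show ?case using trig_poly.add[OF add.IH] by (simp add: algebra_simps)
next
  case (scale F a)
  then show ?case using trig_poly.scale[OF scale.IH, of a] by (simp add: algebra_simps)
qed

lemma trig_poly_mult:
  assumes F: "trig_poly S F" and G: "trig_poly S G"
  shows "trig_poly S (\<lambda>d. F d * G d)"
  using F
proof induction
  case (basic J c)
  then show ?case using trig_poly_basic_mult[OF _ _ G] by simp
next
  case (add F F')
  then show ?case using trig_poly.add[OF add.IH] by (simp add: algebra_simps)
next
  case (scale F a)
  then show ?case using trig_poly.scale[OF scale.IH, of a] by (simp add: algebra_simps)
qed

lemma trig_poly_cos:
  assumes "u \<in> S" shows "trig_poly S (\<lambda>d. complex_of_real (cos (a * d u)))"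
proof -
  have cos_eq: "complex_of_real (cos x) = 1/2 * (iexp x + iexp (- x))" for x
    by (simp add: cos_of_real[symmetric] cos_exp_eq of_real_minus)
  have eq: "(\<lambda>d. complex_of_real (cos (a * d u)))
     = (\<lambda>d. 1/2 * (iexp (\<Sum>u\<in>{u}. (\<lambda>_. a) u * d u) + iexp (\<Sum>u\<in>{u}. (\<lambda>_. - a) u * d u)))"
    by (rule ext) (simp add: cos_eq)
  show ?thesis unfolding eq
    using assms by (intro trig_poly.scale trig_poly.add trig_poly.basic) auto
qed

lemma trig_poly_polynomial_cos:
  fixes p :: "real \<Rightarrow> real"
  assumes "real_polynomial_function p" "u \<in> S"
  shows "trig_poly S (\<lambda>d. complex_of_real (p (cos (a * d u))))"
  using assms(1)
proof induction
  case (linear f)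
  then obtain c where "f = (\<lambda>x. x * c)" by (auto simp: real_bounded_linear)
  then show ?case using trig_poly.scale[OF trig_poly_cos[OF assms(2)], of "complex_of_real c" a] by (simp add: mult.commute)
next
  case (add f g)
  then show ?case using trig_poly.add[OF add.IH] by simp
next
  case (mult f g)
  then show ?case using trig_poly_mult[OF mult.IH] by simp
qed (rule trig_poly_const)

lemma trig_poly_bounded:
  assumes "trig_poly S F" shows "\<exists>B\<ge>0. \<forall>d. cmod (F d) \<le> B"
  using assms
proof induction
  case (basic J c)
  then show ?case by (intro exI[of _ 1]) simp
next
  case (add F G)
  then obtain A B where "0 \<le> A" "0 \<le> B" "\<And>d. cmod (F d) \<le> A" "\<And>d. cmod (G d) \<le> B" by auto
  then show ?case by (intro exI[of _ "A + B"]) (auto intro: norm_triangle_le add_mono)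
next
  case (scale F a)
  then obtain A where "0 \<le> A" "\<And>d. cmod (F d) \<le> A" by auto
  then show ?case by (intro exI[of _ "cmod a * A"]) (auto simp: norm_mult intro: mult_left_mono)
qed

lemma trig_poly_measurable:
  assumes F: "trig_poly S F" and D: "\<And>u. u \<in> S \<Longrightarrow> D u \<in> borel_measurable M"
  shows "(\<lambda>x. F (\<lambda>u. D u x)) \<in> borel_measurable M"
  using F
proof induction
  case (basic J c)
  have "(\<lambda>x. \<Sum>u\<in>J. c u * D u x) \<in> borel_measurable M"
    using basic D by (intro borel_measurable_sum borel_measurable_times) auto
  then show ?case by measurable
qed (auto intro: borel_measurable_add borel_measurable_times)

lemma trig_poly_integrable:
  assumes "prob_space M" "trig_poly S F" "\<And>u. u \<in> S \<Longrightarrow> D u \<in> borel_measurable M"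
  shows "integrable M (\<lambda>x. F (\<lambda>u. D u x))"
proof -
  interpret prob_space M by fact
  obtain B where "\<And>d. cmod (F d) \<le> B" using trig_poly_bounded[OF assms(2)] by auto
  then show ?thesis by (intro integrable_const_bound[of _ B] trig_poly_measurable[OF assms(2,3)]) auto
qed

text \<open>Convergence of finite-dimensional laws in terms of joint characteristic functions; the
  arbitrary coefficients \<open>c\<close> take the place of the dual variable, and no measure on a
  product space appears.\<close>

definition fdd_convergence ::
  "'i set \<Rightarrow> (nat \<Rightarrow> 'a measure) \<Rightarrow> (nat \<Rightarrow> 'i \<Rightarrow> 'a \<Rightarrow> real) \<Rightarrow> 'b measure \<Rightarrow> ('i \<Rightarrow> 'b \<Rightarrow> real) \<Rightarrow> bool" where
  "fdd_convergence S P D N Y \<longleftrightarrow>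
    (\<forall>J c. finite J \<longrightarrow> J \<subseteq> S \<longrightarrow>
      (\<lambda>n. \<integral>x. iexp (\<Sum>u\<in>J. c u * D n u x) \<partial>P n) \<longlonglongrightarrow> (\<integral>x. iexp (\<Sum>u\<in>J. c u * Y u x) \<partial>N))"

lemma fdd_convergence_trig_poly:
  assumes P: "\<And>n. prob_space (P n)" and N: "prob_space N"
    and D: "\<And>n u. u \<in> S \<Longrightarrow> D n u \<in> borel_measurable (P n)"
    and Y: "\<And>u. u \<in> S \<Longrightarrow> Y u \<in> borel_measurable N"
    and fdd: "fdd_convergence S P D N Y" and F: "trig_poly S F"
  shows "(\<lambda>n. \<integral>x. F (\<lambda>u. D n u x) \<partial>P n) \<longlonglongrightarrow> (\<integral>x. F (\<lambda>u. Y u x) \<partial>N)"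
  using F
proof induction
  case (basic J c)
  then show ?case using fdd by (simp add: fdd_convergence_def)
next
  case (add F G)
  have "(\<integral>x. F (\<lambda>u. D n u x) + G (\<lambda>u. D n u x) \<partial>P n) = (\<integral>x. F (\<lambda>u. D n u x) \<partial>P n) + (\<integral>x. G (\<lambda>u. D n u x) \<partial>P n)" for n
    by (rule Bochner_Integration.integral_add[OF trig_poly_integrable[OF P add.hyps(1) D] trig_poly_integrable[OF P add.hyps(2) D]])
  moreover have "(\<integral>x. F (\<lambda>u. Y u x) + G (\<lambda>u. Y u x) \<partial>N) = (\<integral>x. F (\<lambda>u. Y u x) \<partial>N) + (\<integral>x. G (\<lambda>u. Y u x) \<partial>N)"
    by (rule Bochner_Integration.integral_add[OF trig_poly_integrable[OF N add.hyps(1) Y] trig_poly_integrable[OF N add.hyps(2) Y]])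
  ultimately show ?case using tendsto_add[OF add.IH] by simp
next
  case (scale F a)
  then show ?case using tendsto_mult_left[OF scale.IH, of a] by simp
qed

text \<open>The approximating sequence and its limit may both depend on \<open>e\<close>. It serves
  three times: for a truncated exponential series, for a bounded substitute of |x|^r and for the
  truncated process.\<close>

lemma tendsto_approx:
  fixes a :: "nat \<Rightarrow> 'a::real_normed_vector"
  assumes "\<And>e. e > 0 \<Longrightarrow> \<exists>b l. b \<longlonglongrightarrow> l \<and> eventually (\<lambda>n. norm (a n - b n) \<le> e) sequentially \<and> norm (x - l) \<le> e"
  shows "a \<longlonglongrightarrow> x"
proof (rule tendstoI)
  fix e :: real assume e: "e > 0"
  obtain b l where b: "b \<longlonglongrightarrow> l" "eventually (\<lambda>n. norm (a n - b n) \<le> e/4) sequentially" "norm (x - l) \<le> e/4"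
    using assms[of "e/4"] e by auto
  have "eventually (\<lambda>n. dist (b n) l < e/4) sequentially" using b(1) e by (intro tendstoD) auto
  with b(2) show "eventually (\<lambda>n. dist (a n) x < e) sequentially"
  proof eventually_elim
    case (elim n)
    have "a n - x = (a n - b n) + (b n - l) + (l - x)" by simp
    then have "norm (a n - x) \<le> norm (a n - b n) + norm (b n - l) + norm (l - x)"
      by (metis norm_triangle_le norm_triangle_ineq add_mono_thms_linordered_semiring(3))
    also have "norm (l - x) = norm (x - l)" by (rule norm_minus_commute)
    finally show ?case using elim b(3) e by (auto simp: dist_norm)
  qed
qed

lemma iexp_lipschitz: "cmod (iexp x - iexp y) \<le> \<bar>x - y\<bar>"
proof -
  have "iexp x - iexp y = iexp y * (iexp (x - y) - 1)"
    by (simp add: algebra_simps exp_add[symmetric] of_real_diff)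
  moreover have "cmod (iexp (x - y) - 1) \<le> \<bar>x - y\<bar>" using iexp_approx1[of "x - y" 0] by simp
  ultimately show ?thesis by (simp add: norm_mult)
qed

lemma iexp_diff_le_2: "cmod (iexp x - iexp y) \<le> 2"
  using norm_triangle_ineq4[of "iexp x" "iexp y"] by simp

text \<open>\<open>\<nu>\<close> carries the index and \<open>M\<close> the randomness. Joint
  measurability allows Fubini, and boundedness of \<open>H\<close> makes the moments of
  \<open>T\<close> determine its characteristic function.\<close>

locale bounded_functional = idx: prob_space \<nu> + prob_space M
  for \<nu> :: "'i measure" and M :: "'a measure" +
  fixes D :: "'i \<Rightarrow> 'a \<Rightarrow> real" and H :: "real \<Rightarrow> real" and B :: real
  assumes D_meas: "(\<lambda>(u, x). D u x) \<in> borel_measurable (\<nu> \<Otimes>\<^sub>M M)"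
    and H_meas[measurable]: "H \<in> borel_measurable borel"
    and H_bound: "\<And>x. \<bar>H x\<bar> \<le> B"
begin

definition T :: "'a \<Rightarrow> real" where "T x = (\<integral>u. H (D u x) \<partial>\<nu>)"

sublocale pair: pair_sigma_finite \<nu> M ..

lemma D_meas'[measurable]: "case_prod D \<in> borel_measurable (\<nu> \<Otimes>\<^sub>M M)"
  using D_meas by simp

lemma D_meas_swap: "(\<lambda>(x, u). D u x) \<in> borel_measurable (M \<Otimes>\<^sub>M \<nu>)"
  by (subst measurable_pair_swap_iff) (use D_meas in \<open>simp add: case_prod_unfold\<close>)

lemma D_meas_u: "u \<in> space \<nu> \<Longrightarrow> D u \<in> borel_measurable M"
  using measurable_compose[OF measurable_Pair1' D_meas] by (auto simp: o_def)

lemma D_meas_x: "x \<in> space M \<Longrightarrow> (\<lambda>u. D u x) \<in> borel_measurable \<nu>"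
  using measurable_compose[OF measurable_Pair2' D_meas] by (auto simp: o_def)

lemma B_nonneg: "0 \<le> B" using H_bound[of 0] by simp

lemma T_meas[measurable]: "T \<in> borel_measurable M"
proof -
  have "(\<lambda>(x, u). H (D u x)) \<in> borel_measurable (M \<Otimes>\<^sub>M \<nu>)"
    using measurable_compose[OF D_meas_swap H_meas] by (simp add: case_prod_unfold)
  then show ?thesis unfolding T_def[abs_def] by (rule idx.borel_measurable_lebesgue_integral)
qed

lemma H_integrable: "x \<in> space M \<Longrightarrow> integrable \<nu> (\<lambda>u. H (D u x))"
  by (rule idx.integrable_const_bound[where B=B]) (use H_bound measurable_compose[OF D_meas_x H_meas] in auto)

lemma T_bound: assumes "x \<in> space M" shows "\<bar>T x\<bar> \<le> B"
proof -
  have "\<bar>T x\<bar> \<le> (\<integral>u. \<bar>H (D u x)\<bar> \<partial>\<nu>)" unfolding T_def by (rule integral_abs_bound)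
  also have "\<dots> \<le> (\<integral>u. B \<partial>\<nu>)"
    using assms H_bound by (intro integral_mono integrable_abs H_integrable) auto
  also have "\<dots> = B" by (simp add: idx.prob_space)
  finally show ?thesis .
qed

text \<open>One factor \<open>T x\<close> is written as an integral over the index, which Fubini
  moves outside. The extra factor \<open>F\<close> makes the identity iterable: the newly produced
  \<open>H (D u x)\<close> can be absorbed into it.\<close>

lemma moment_Suc:
  assumes F: "trig_poly (space \<nu>) F"
  shows "(\<integral>x. F (\<lambda>u. D u x) * complex_of_real (T x) ^ Suc k \<partial>M)
       = (\<integral>u. (\<integral>x. F (\<lambda>u. D u x) * complex_of_real (H (D u x)) * complex_of_real (T x) ^ k \<partial>M) \<partial>\<nu>)"
proof -
  obtain A where A: "0 \<le> A" "\<And>d. cmod (F d) \<le> A" using trig_poly_bounded[OF F] by auto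
  have Fm[measurable]: "(\<lambda>x. F (\<lambda>u. D u x)) \<in> borel_measurable M"
    by (rule trig_poly_measurable[OF F D_meas_u])
  let ?f = "\<lambda>u x. F (\<lambda>u. D u x) * complex_of_real (H (D u x)) * complex_of_real (T x) ^ k"
  have fm: "case_prod ?f \<in> borel_measurable (\<nu> \<Otimes>\<^sub>M M)"
  proof -
    have [measurable]: "(\<lambda>z. F (\<lambda>u. D u (snd z))) \<in> borel_measurable (\<nu> \<Otimes>\<^sub>M M)"
      by (rule measurable_compose[OF measurable_snd Fm])
    have [measurable]: "(\<lambda>z. H (D (fst z) (snd z))) \<in> borel_measurable (\<nu> \<Otimes>\<^sub>M M)"
      using measurable_compose[OF D_meas H_meas] by (simp add: case_prod_unfold)
    show ?thesis unfolding case_prod_unfold by measurable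
  qed
  have "integrable (\<nu> \<Otimes>\<^sub>M M) (case_prod ?f)"
  proof (rule finite_measure.integrable_const_bound[OF _ _ fm, where B="A * B * B ^ k"])
    interpret pp: pair_prob_space \<nu> M ..
    show "finite_measure (\<nu> \<Otimes>\<^sub>M M)" by (rule pp.finite_measure_axioms)
    show "AE z in \<nu> \<Otimes>\<^sub>M M. norm (case_prod ?f z) \<le> A * B * B ^ k"
    proof (rule AE_I2)
      fix z assume "z \<in> space (\<nu> \<Otimes>\<^sub>M M)"
      then have "snd z \<in> space M" by (auto simp: space_pair_measure)
      then show "norm (case_prod ?f z) \<le> A * B * B ^ k"
        using A H_bound T_bound B_nonneg
        by (auto simp: case_prod_unfold norm_mult norm_power intro!: mult_mono power_mono)
    qed
  qed
  from pair.Fubini_integral[OF this]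
  have "(\<integral>x. (\<integral>u. ?f u x \<partial>\<nu>) \<partial>M) = (\<integral>u. (\<integral>x. ?f u x \<partial>M) \<partial>\<nu>)" by simp
  moreover have "F (\<lambda>u. D u x) * complex_of_real (T x) ^ Suc k = (\<integral>u. ?f u x \<partial>\<nu>)" for x
  proof -
    have "(\<integral>u. ?f u x \<partial>\<nu>) = (\<integral>u. (F (\<lambda>u. D u x) * complex_of_real (T x) ^ k) * complex_of_real (H (D u x)) \<partial>\<nu>)"
      by (simp add: mult_ac)
    also have "\<dots> = (F (\<lambda>u. D u x) * complex_of_real (T x) ^ k) * (\<integral>u. complex_of_real (H (D u x)) \<partial>\<nu>)"
      by simp
    also have "(\<integral>u. complex_of_real (H (D u x)) \<partial>\<nu>) = complex_of_real (T x)"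
      unfolding T_def by (rule integral_complex_of_real)
    finally show ?thesis by (simp only: mult_ac power_Suc)
  qed
  ultimately show ?thesis by (simp only:)
qed

lemma moment_bound:
  assumes F: "trig_poly (space \<nu>) F" and A: "0 \<le> A" "\<And>d. cmod (F d) \<le> A" and u: "u \<in> space \<nu>"
  shows "cmod (\<integral>x. F (\<lambda>u. D u x) * complex_of_real (H (D u x)) * complex_of_real (T x) ^ k \<partial>M) \<le> A * B * B ^ k"
proof -
  have [measurable]: "(\<lambda>x. F (\<lambda>u. D u x)) \<in> borel_measurable M" "D u \<in> borel_measurable M"
    using trig_poly_measurable[OF F D_meas_u] D_meas_u[OF u] by auto
  let ?f = "\<lambda>x. F (\<lambda>u. D u x) * complex_of_real (H (D u x)) * complex_of_real (T x) ^ k"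
  have b: "norm (?f x) \<le> A * B * B ^ k" if "x \<in> space M" for x
    using A H_bound T_bound[OF that] B_nonneg by (auto simp: norm_mult norm_power intro!: mult_mono power_mono)
  have "integrable M ?f" by (rule integrable_const_bound[where B="A * B * B ^ k"]) (use b in auto)
  have "norm (\<integral>x. ?f x \<partial>M) \<le> (\<integral>x. norm (?f x) \<partial>M)" by (rule integral_norm_bound)
  also have "\<dots> \<le> (\<integral>x. A * B * B ^ k \<partial>M)"
    using b \<open>integrable M ?f\<close> by (intro integral_mono integrable_norm) auto
  also have "\<dots> = A * B * B ^ k" by (simp add: prob_space)
  finally show ?thesis .
qed

lemma moment_measurable:
  assumes F: "trig_poly (space \<nu>) F"
  shows "(\<lambda>u. \<integral>x. F (\<lambda>u. D u x) * complex_of_real (H (D u x)) * complex_of_real (T x) ^ k \<partial>M) \<in> borel_measurable \<nu>"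
proof (rule borel_measurable_lebesgue_integral)
  have [measurable]: "(\<lambda>z. F (\<lambda>u. D u (snd z))) \<in> borel_measurable (\<nu> \<Otimes>\<^sub>M M)"
    by (rule measurable_compose[OF measurable_snd trig_poly_measurable[OF F D_meas_u]])
  have [measurable]: "(\<lambda>z. H (D (fst z) (snd z))) \<in> borel_measurable (\<nu> \<Otimes>\<^sub>M M)"
    using measurable_compose[OF D_meas H_meas] by (simp add: case_prod_unfold)
  show "(\<lambda>(u, x). F (\<lambda>u. D u x) * complex_of_real (H (D u x)) * complex_of_real (T x) ^ k) \<in> borel_measurable (\<nu> \<Otimes>\<^sub>M M)"
    unfolding case_prod_unfold by measurable
qed

text \<open>The Taylor remainder of the exponential at \<open>\<theta> * T x\<close> is controlled
  through \<open>T_bound\<close>. The right-hand side involves only \<open>B\<close>, hence is the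
  same for all processes sharing that bound.\<close>

lemma char_moment_expansion:
  "cmod ((\<integral>x. iexp (\<theta> * T x) \<partial>M) - (\<Sum>k\<le>n. (\<i> * \<theta>) ^ k / fact k * (\<integral>x. complex_of_real (T x) ^ k \<partial>M)))
     \<le> (\<bar>\<theta>\<bar> * B) ^ Suc n / fact (Suc n)"
proof -
  have iT: "integrable M (\<lambda>x. complex_of_real (T x) ^ k)" for k
    by (rule integrable_const_bound[where B="B ^ k"]) (use T_bound in \<open>auto simp: norm_power intro!: power_mono\<close>)
  have iE: "integrable M (\<lambda>x. iexp (\<theta> * T x))"
    by (rule integrable_const_bound[where B=1]) auto
  have eqk: "(\<i> * (\<theta> * T x)) ^ k / fact k = (\<i> * \<theta>) ^ k / fact k * complex_of_real (T x) ^ k" for x k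
    by (simp add: power_mult_distrib mult_ac)
  have iS: "integrable M (\<lambda>x. \<Sum>k\<le>n. (\<i> * (\<theta> * T x)) ^ k / fact k)"
    unfolding eqk by (intro Bochner_Integration.integrable_sum integrable_mult_right iT)
  have "(\<Sum>k\<le>n. (\<i> * \<theta>) ^ k / fact k * (\<integral>x. complex_of_real (T x) ^ k \<partial>M))
     = (\<integral>x. (\<Sum>k\<le>n. (\<i> * \<theta>) ^ k / fact k * complex_of_real (T x) ^ k) \<partial>M)"
  proof -
    have "(\<integral>x. (\<Sum>k\<le>n. (\<i> * \<theta>) ^ k / fact k * complex_of_real (T x) ^ k) \<partial>M)
       = (\<Sum>k\<le>n. \<integral>x. (\<i> * \<theta>) ^ k / fact k * complex_of_real (T x) ^ k \<partial>M)"
      by (rule Bochner_Integration.integral_sum) (rule integrable_mult_right, rule iT)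
    then show ?thesis by (simp only: integral_mult_right_zero)
  qed
  also have "\<dots> = (\<integral>x. (\<Sum>k\<le>n. (\<i> * (\<theta> * T x)) ^ k / fact k) \<partial>M)"
    unfolding eqk ..
  finally have eq: "(\<integral>x. iexp (\<theta> * T x) \<partial>M) - (\<Sum>k\<le>n. (\<i> * \<theta>) ^ k / fact k * (\<integral>x. complex_of_real (T x) ^ k \<partial>M))
     = (\<integral>x. iexp (\<theta> * T x) - (\<Sum>k\<le>n. (\<i> * (\<theta> * T x)) ^ k / fact k) \<partial>M)"
    using Bochner_Integration.integral_diff[OF iE iS] by (simp only:)
  let ?g = "\<lambda>x. iexp (\<theta> * T x) - (\<Sum>k\<le>n. (\<i> * (\<theta> * T x)) ^ k / fact k)"
  have b: "cmod (?g x) \<le> (\<bar>\<theta>\<bar> * B) ^ Suc n / fact (Suc n)" if "x \<in> space M" for x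
  proof -
    have "cmod (?g x) \<le> \<bar>\<theta> * T x\<bar> ^ Suc n / fact (Suc n)" using iexp_approx1[of "\<theta> * T x" n] by simp
    also have "\<dots> \<le> (\<bar>\<theta>\<bar> * B) ^ Suc n / fact (Suc n)"
      using T_bound[OF that] by (intro divide_right_mono power_mono) (auto simp: abs_mult intro!: mult_left_mono)
    finally show ?thesis .
  qed
  have "integrable M ?g" by (rule integrable_const_bound[where B="(\<bar>\<theta>\<bar> * B) ^ Suc n / fact (Suc n)"]) (use b in auto)
  have "cmod (\<integral>x. ?g x \<partial>M) \<le> (\<integral>x. cmod (?g x) \<partial>M)" by (rule integral_norm_bound)
  also have "\<dots> \<le> (\<integral>x. (\<bar>\<theta>\<bar> * B) ^ Suc n / fact (Suc n) \<partial>M)"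
    using b \<open>integrable M ?g\<close> by (intro integral_mono integrable_norm) auto
  also have "\<dots> = (\<bar>\<theta>\<bar> * B) ^ Suc n / fact (Suc n)" by (simp add: prob_space)
  finally show ?thesis using eq by simp
qed

end

text \<open>Induction on \<open>k\<close> with \<open>F\<close> arbitrary: for fixed
  \<open>u\<close> the inner moment has one power of \<open>T\<close> less and the trigonometric
  polynomial \<open>F\<close> times \<open>H (d u)\<close>. The uniform bound on inner moments then
  lets the limit pass through the integral over \<open>u\<close>.\<close>

lemma bounded_functional_moments_converge:
  assumes D: "\<And>n. bounded_functional \<nu> (P n) (D n) H B" and Y: "bounded_functional \<nu> N Y H B"
    and fdd: "fdd_convergence (space \<nu>) P D N Y"
    and H: "\<And>u. u \<in> space \<nu> \<Longrightarrow> trig_poly (space \<nu>) (\<lambda>d. complex_of_real (H (d u)))"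
    and F: "trig_poly (space \<nu>) F"
  shows "(\<lambda>n. \<integral>x. F (\<lambda>u. D n u x) * complex_of_real (bounded_functional.T \<nu> (D n) H x) ^ k \<partial>P n)
     \<longlonglongrightarrow> (\<integral>x. F (\<lambda>u. Y u x) * complex_of_real (bounded_functional.T \<nu> Y H x) ^ k \<partial>N)"
  using F
proof (induction k arbitrary: F)
  case 0
  interpret D: bounded_functional \<nu> "P n" "D n" H B for n by (rule D)
  interpret Y: bounded_functional \<nu> N Y H B by (rule Y)
  have "(\<lambda>n. \<integral>x. F (\<lambda>u. D n u x) \<partial>P n) \<longlonglongrightarrow> (\<integral>x. F (\<lambda>u. Y u x) \<partial>N)"
    by (rule fdd_convergence_trig_poly[OF D.prob_space_axioms Y.prob_space_axioms D.D_meas_u Y.D_meas_u fdd 0])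
  then show ?case by simp
next
  case (Suc k)
  interpret D: bounded_functional \<nu> "P n" "D n" H B for n by (rule D)
  interpret Y: bounded_functional \<nu> N Y H B by (rule Y)
  obtain A where A: "0 \<le> A" "\<And>d. cmod (F d) \<le> A" using trig_poly_bounded[OF Suc.prems] by auto
  show ?case unfolding D.moment_Suc[OF Suc.prems] Y.moment_Suc[OF Suc.prems]
  proof (rule integral_dominated_convergence[where w="\<lambda>_. A * B * B ^ k"])
    show "AE u in \<nu>. (\<lambda>n. \<integral>x. F (\<lambda>u. D n u x) * complex_of_real (H (D n u x)) * complex_of_real (D.T n x) ^ k \<partial>P n)
       \<longlonglongrightarrow> (\<integral>x. F (\<lambda>u. Y u x) * complex_of_real (H (Y u x)) * complex_of_real (Y.T x) ^ k \<partial>N)"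
      by (rule AE_I2, rule Suc.IH, rule trig_poly_mult[OF Suc.prems H])
    show "AE u in \<nu>. norm (\<integral>x. F (\<lambda>u. D n u x) * complex_of_real (H (D n u x)) * complex_of_real (D.T n x) ^ k \<partial>P n) \<le> A * B * B ^ k" for n
      by (rule AE_I2, rule D.moment_bound[OF Suc.prems A])
  qed (auto intro: D.moment_measurable[OF Suc.prems] Y.moment_measurable[OF Suc.prems])
qed

lemma bounded_functional_char_converges:
  assumes D: "\<And>n. bounded_functional \<nu> (P n) (D n) H B" and Y: "bounded_functional \<nu> N Y H B"
    and fdd: "fdd_convergence (space \<nu>) P D N Y"
    and H: "\<And>u. u \<in> space \<nu> \<Longrightarrow> trig_poly (space \<nu>) (\<lambda>d. complex_of_real (H (d u)))"
  shows "(\<lambda>n. \<integral>x. iexp (\<theta> * bounded_functional.T \<nu> (D n) H x) \<partial>P n)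
     \<longlonglongrightarrow> (\<integral>x. iexp (\<theta> * bounded_functional.T \<nu> Y H x) \<partial>N)"
proof (rule tendsto_approx)
  interpret D: bounded_functional \<nu> "P n" "D n" H B for n by (rule D)
  interpret Y: bounded_functional \<nu> N Y H B by (rule Y)
  fix e :: real assume e: "e > 0"
  have "(\<lambda>n. (\<bar>\<theta>\<bar> * B) ^ n / fact n) \<longlonglongrightarrow> 0" 
    using summable_LIMSEQ_zero[OF summable_exp[of "\<bar>\<theta>\<bar> * B"]] by (simp add: field_simps)
  then have "eventually (\<lambda>n. (\<bar>\<theta>\<bar> * B) ^ n / fact n < e) sequentially" using e by (rule order_tendstoD)
  then obtain m0 where m0: "\<And>n. n \<ge> m0 \<Longrightarrow> (\<bar>\<theta>\<bar> * B) ^ n / fact n < e" by (auto simp: eventually_sequentially)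
  let ?b = "\<lambda>n. \<Sum>k\<le>m0. (\<i> * \<theta>) ^ k / fact k * (\<integral>x. complex_of_real (D.T n x) ^ k \<partial>P n)"
  let ?l = "\<Sum>k\<le>m0. (\<i> * \<theta>) ^ k / fact k * (\<integral>x. complex_of_real (Y.T x) ^ k \<partial>N)"
  have "(\<lambda>n. \<integral>x. complex_of_real (D.T n x) ^ k \<partial>P n) \<longlonglongrightarrow> (\<integral>x. complex_of_real (Y.T x) ^ k \<partial>N)" for k
    using bounded_functional_moments_converge[OF D Y fdd H trig_poly_const[of _ 1], of k] by simp
  then have "?b \<longlonglongrightarrow> ?l" by (intro tendsto_sum tendsto_mult_left)
  moreover have "cmod ((\<integral>x. iexp (\<theta> * D.T n x) \<partial>P n) - ?b n) \<le> e" for n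
    by (rule order_trans[OF D.char_moment_expansion[of n \<theta> m0] less_imp_le[OF m0]]) simp
  moreover have "cmod ((\<integral>x. iexp (\<theta> * Y.T x) \<partial>N) - ?l) \<le> e"
    by (rule order_trans[OF Y.char_moment_expansion[of \<theta> m0] less_imp_le[OF m0]]) simp
  ultimately show "\<exists>b l. b \<longlonglongrightarrow> l \<and>
     eventually (\<lambda>n. norm ((\<integral>x. iexp (\<theta> * D.T n x) \<partial>P n) - b n) \<le> e) sequentially \<and>
     norm ((\<integral>x. iexp (\<theta> * Y.T x) \<partial>N) - l) \<le> e"
    by (intro exI[of _ ?b] exI[of _ ?l]) auto
qed

text \<open>The even \<open>2K\<close>-periodic extension of $|x|^r$ is a continuous function of $\cos(\pi x/K)$.\<close>
lemma powr_abs_trig_approx: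
  assumes r: "0 < r" and K: "0 < K" and e: "0 < e"
  shows "\<exists>p. real_polynomial_function (p :: real \<Rightarrow> real) \<and>
    (\<forall>x. \<bar>\<bar>x\<bar> powr r - p (cos (pi / K * x))\<bar> \<le> e + 2 * (\<bar>x\<bar> powr r * indicator {K<..} \<bar>x\<bar>)) \<and>
    (\<forall>x. \<bar>p (cos (pi / K * x))\<bar> \<le> K powr r + e)"
proof -
  define G where "G y = (K / pi * arccos y) powr r" for y
  have G: "continuous_on {-1..1} G" unfolding G_def
    using K r by (intro continuous_on_powr' continuous_intros continuous_on_arccos) (auto intro!: divide_nonneg_nonneg mult_nonneg_nonneg arccos_lbound)
  obtain p where p: "real_polynomial_function p" "\<And>y. y \<in> {-1..1} \<Longrightarrow> \<bar>G y - p y\<bar> < e"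
    using Stone_Weierstrass_real_polynomial_function[OF compact_Icc G e] by metis
  have Gb: "0 \<le> G y" "G y \<le> K powr r" if "y \<in> {-1..1}" for y
  proof -
    show "0 \<le> G y" by (simp add: G_def)
    have "K / pi * arccos y \<le> K / pi * pi" using that K by (intro mult_left_mono arccos_ubound) auto
    then show "G y \<le> K powr r" unfolding G_def
      using K r that by (intro powr_mono2) (auto intro!: divide_nonneg_nonneg mult_nonneg_nonneg arccos_lbound)
  qed
  have Gx: "G (cos (pi / K * x)) = \<bar>x\<bar> powr r" if "\<bar>x\<bar> \<le> K" for x
  proof -
    have "pi / K * \<bar>x\<bar> \<le> pi / K * K" using that K by (intro mult_left_mono) auto
    then have "arccos (cos (pi / K * \<bar>x\<bar>)) = pi / K * \<bar>x\<bar>" using K by (intro arccos_cos) auto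
    moreover have "cos (pi / K * \<bar>x\<bar>) = cos (pi / K * x)" by (cases "x \<ge> 0") auto
    ultimately show ?thesis using K by (simp add: G_def)
  qed
  have "\<bar>\<bar>x\<bar> powr r - p (cos (pi / K * x))\<bar> \<le> e + 2 * (\<bar>x\<bar> powr r * indicator {K<..} \<bar>x\<bar>)" for x
  proof (cases "\<bar>x\<bar> \<le> K")
    case True
    then show ?thesis using Gx[OF True] p(2)[of "cos (pi / K * x)"] by (auto simp: indicator_def)
  next
    case False
    \<comment> \<open>Outside [-K,K] both |x|^r and the periodic extension lie between 0 and |x|^r,
      so their distance is charged to the tail term.\<close>
    have "K powr r \<le> \<bar>x\<bar> powr r" using False K r by (intro powr_mono2) auto
    then show ?thesis
      using False p(2)[of "cos (pi / K * x)"] Gb[of "cos (pi / K * x)"] by (auto simp: indicator_def abs_le_iff abs_less_iff)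
  qed
  moreover have "\<bar>p (cos (pi / K * x))\<bar> \<le> K powr r + e" for x
    using p(2)[of "cos (pi / K * x)"] Gb[of "cos (pi / K * x)"] by (auto simp: abs_le_iff abs_less_iff)
  ultimately show ?thesis using p(1) by blast
qed

section \<open>From bounded functionals to integrals of powers\<close>

context bounded_functional
begin

context
  fixes r K \<epsilon> :: real
  assumes approx: "\<And>x. \<bar>\<bar>x\<bar> powr r - H x\<bar> \<le> \<epsilon> + 2 * (\<bar>x\<bar> powr r * indicator {K<..} \<bar>x\<bar>)"
    and tail: "(\<integral>\<^sup>+u. \<integral>\<^sup>+x. ennreal (\<bar>D u x\<bar> powr r * indicator {K<..} \<bar>D u x\<bar>) \<partial>M \<partial>\<nu>) \<le> ennreal \<epsilon>"
    and \<epsilon>: "0 \<le> \<epsilon>"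
begin

text \<open>The uniform part of \<open>approx\<close> costs \<open>\<epsilon>\<close> and its tail
  part \<open>2 * \<epsilon>\<close>. Fubini reverses the order of integration to the one in which
  \<open>tail\<close> is stated.\<close>

lemma approx_error:
  "(\<integral>\<^sup>+x. \<integral>\<^sup>+u. ennreal \<bar>\<bar>D u x\<bar> powr r - H (D u x)\<bar> \<partial>\<nu> \<partial>M) \<le> ennreal (3 * \<epsilon>)"
proof -
  have "(\<integral>\<^sup>+x. \<integral>\<^sup>+u. ennreal \<bar>\<bar>D u x\<bar> powr r - H (D u x)\<bar> \<partial>\<nu> \<partial>M)
      = (\<integral>\<^sup>+u. \<integral>\<^sup>+x. ennreal \<bar>\<bar>D u x\<bar> powr r - H (D u x)\<bar> \<partial>M \<partial>\<nu>)"
  proof (rule pair.Fubini')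
    have [measurable]: "(\<lambda>z. D (fst z) (snd z)) \<in> borel_measurable (\<nu> \<Otimes>\<^sub>M M)"
      using D_meas by (simp add: case_prod_unfold)
    show "(\<lambda>(u, x). ennreal \<bar>\<bar>D u x\<bar> powr r - H (D u x)\<bar>) \<in> borel_measurable (\<nu> \<Otimes>\<^sub>M M)"
      unfolding case_prod_unfold by measurable
  qed
  also have "\<dots> \<le> (\<integral>\<^sup>+u. (ennreal \<epsilon> + 2 * (\<integral>\<^sup>+x. ennreal (\<bar>D u x\<bar> powr r * indicator {K<..} \<bar>D u x\<bar>) \<partial>M)) \<partial>\<nu>)"
  proof (rule nn_integral_mono)
    fix u assume u: "u \<in> space \<nu>"
    have [measurable]: "D u \<in> borel_measurable M" by (rule D_meas_u[OF u])
    have "(\<integral>\<^sup>+x. ennreal \<bar>\<bar>D u x\<bar> powr r - H (D u x)\<bar> \<partial>M)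
       \<le> (\<integral>\<^sup>+x. ennreal \<epsilon> + 2 * ennreal (\<bar>D u x\<bar> powr r * indicator {K<..} \<bar>D u x\<bar>) \<partial>M)"
    proof (rule nn_integral_mono)
      fix x
      have "ennreal \<bar>\<bar>D u x\<bar> powr r - H (D u x)\<bar> \<le> ennreal (\<epsilon> + 2 * (\<bar>D u x\<bar> powr r * indicator {K<..} \<bar>D u x\<bar>))"
        by (rule ennreal_leI[OF approx])
      also have "\<dots> = ennreal \<epsilon> + 2 * ennreal (\<bar>D u x\<bar> powr r * indicator {K<..} \<bar>D u x\<bar>)"
        using \<epsilon> by (simp add: ennreal_plus ennreal_mult)
      finally show "ennreal \<bar>\<bar>D u x\<bar> powr r - H (D u x)\<bar> \<le> \<dots>" .
    qed
    also have "\<dots> = ennreal \<epsilon> + 2 * (\<integral>\<^sup>+x. ennreal (\<bar>D u x\<bar> powr r * indicator {K<..} \<bar>D u x\<bar>) \<partial>M)"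
      by (subst nn_integral_add) (auto simp: nn_integral_cmult emeasure_space_1)
    finally show "(\<integral>\<^sup>+x. ennreal \<bar>\<bar>D u x\<bar> powr r - H (D u x)\<bar> \<partial>M) \<le> \<dots>" .
  qed
  also have "\<dots> = ennreal \<epsilon> + 2 * (\<integral>\<^sup>+u. \<integral>\<^sup>+x. ennreal (\<bar>D u x\<bar> powr r * indicator {K<..} \<bar>D u x\<bar>) \<partial>M \<partial>\<nu>)"
  proof -
    have [measurable]: "(\<lambda>z. D (fst z) (snd z)) \<in> borel_measurable (\<nu> \<Otimes>\<^sub>M M)"
      using D_meas by (simp add: case_prod_unfold)
    have "(\<lambda>u. \<integral>\<^sup>+x. ennreal (\<bar>D u x\<bar> powr r * indicator {K<..} \<bar>D u x\<bar>) \<partial>M) \<in> borel_measurable \<nu>"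
      by (rule borel_measurable_nn_integral) (unfold case_prod_unfold, measurable)
    then show ?thesis by (subst nn_integral_add) (auto simp: nn_integral_cmult idx.emeasure_space_1)
  qed
  also have "\<dots> \<le> ennreal \<epsilon> + 2 * ennreal \<epsilon>" using tail by (intro add_left_mono mult_left_mono) auto
  also have "\<dots> = ennreal (\<epsilon> + 2 * \<epsilon>)" using \<epsilon> by (subst ennreal_plus) (simp_all add: ennreal_mult)
  finally show ?thesis by simp
qed

lemma error_meas: "(\<lambda>x. \<integral>\<^sup>+u. ennreal \<bar>\<bar>D u x\<bar> powr r - H (D u x)\<bar> \<partial>\<nu>) \<in> borel_measurable M"
proof (rule idx.borel_measurable_nn_integral)
  have [measurable]: "(\<lambda>z. D (snd z) (fst z)) \<in> borel_measurable (M \<Otimes>\<^sub>M \<nu>)"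
    using D_meas_swap by (simp add: case_prod_unfold)
  show "(\<lambda>(x, u). ennreal \<bar>\<bar>D u x\<bar> powr r - H (D u x)\<bar>) \<in> borel_measurable (M \<Otimes>\<^sub>M \<nu>)"
    unfolding case_prod_unfold by measurable
qed

text \<open>A quantity of finite expectation is finite almost surely, and since \<open>H\<close> is
  bounded, an integrable error passes its integrability on to the power of
  \<open>D u x\<close>.\<close>

lemma AE_error_finite:
  "AE x in M. integrable \<nu> (\<lambda>u. \<bar>D u x\<bar> powr r) \<and>
     ennreal \<bar>(\<integral>u. \<bar>D u x\<bar> powr r \<partial>\<nu>) - T x\<bar> \<le> (\<integral>\<^sup>+u. ennreal \<bar>\<bar>D u x\<bar> powr r - H (D u x)\<bar> \<partial>\<nu>)"
proof -
  have "(\<integral>\<^sup>+x. \<integral>\<^sup>+u. ennreal \<bar>\<bar>D u x\<bar> powr r - H (D u x)\<bar> \<partial>\<nu> \<partial>M) \<noteq> \<infinity>"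
    using approx_error by (auto simp: top_unique)
  then have "AE x in M. (\<integral>\<^sup>+u. ennreal \<bar>\<bar>D u x\<bar> powr r - H (D u x)\<bar> \<partial>\<nu>) \<noteq> \<infinity>"
    by (rule nn_integral_PInf_AE[OF error_meas])
  then show ?thesis
  proof (rule AE_mp, intro AE_I2 impI)
    fix x assume x: "x \<in> space M" and fin: "(\<integral>\<^sup>+u. ennreal \<bar>\<bar>D u x\<bar> powr r - H (D u x)\<bar> \<partial>\<nu>) \<noteq> \<infinity>"
    have [measurable]: "(\<lambda>u. D u x) \<in> borel_measurable \<nu>" by (rule D_meas_x[OF x])
    have i1: "integrable \<nu> (\<lambda>u. \<bar>D u x\<bar> powr r - H (D u x))"
      by (rule integrableI_bounded) (use fin in \<open>auto simp: top.not_eq_extremum\<close>)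
    have "integrable \<nu> (\<lambda>u. (\<bar>D u x\<bar> powr r - H (D u x)) + H (D u x))"
      by (rule Bochner_Integration.integrable_add[OF i1 H_integrable[OF x]])
    then have i2: "integrable \<nu> (\<lambda>u. \<bar>D u x\<bar> powr r)" by simp
    have "(\<integral>u. \<bar>D u x\<bar> powr r \<partial>\<nu>) - T x = (\<integral>u. \<bar>D u x\<bar> powr r - H (D u x) \<partial>\<nu>)"
      unfolding T_def by (rule Bochner_Integration.integral_diff[OF i2 H_integrable[OF x], symmetric])
    then have "ennreal \<bar>(\<integral>u. \<bar>D u x\<bar> powr r \<partial>\<nu>) - T x\<bar> \<le> (\<integral>\<^sup>+u. ennreal \<bar>\<bar>D u x\<bar> powr r - H (D u x)\<bar> \<partial>\<nu>)"
      using integral_norm_bound_ennreal[OF i1] by simp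
    with i2 show "integrable \<nu> (\<lambda>u. \<bar>D u x\<bar> powr r) \<and>
     ennreal \<bar>(\<integral>u. \<bar>D u x\<bar> powr r \<partial>\<nu>) - T x\<bar> \<le> (\<integral>\<^sup>+u. ennreal \<bar>\<bar>D u x\<bar> powr r - H (D u x)\<bar> \<partial>\<nu>)" by simp
  qed
qed

lemma integral_powr_measurable: "(\<lambda>x. \<integral>u. \<bar>D u x\<bar> powr r \<partial>\<nu>) \<in> borel_measurable M"
proof (rule idx.borel_measurable_lebesgue_integral)
  have [measurable]: "(\<lambda>z. D (snd z) (fst z)) \<in> borel_measurable (M \<Otimes>\<^sub>M \<nu>)"
    using D_meas_swap by (simp add: case_prod_unfold)
  show "(\<lambda>(x, u). \<bar>D u x\<bar> powr r) \<in> borel_measurable (M \<Otimes>\<^sub>M \<nu>)"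
    unfolding case_prod_unfold by measurable
qed

text \<open>By the Lipschitz property of \<open>iexp\<close> the difference is at most |\<theta>|
  times the expected error. On the null set of paths with non-integrable power the integral has its
  default value 0, hence the estimate is made almost everywhere.\<close>

lemma char_approx_error:
  "cmod ((\<integral>x. iexp (\<theta> * (\<integral>u. \<bar>D u x\<bar> powr r \<partial>\<nu>)) \<partial>M) - (\<integral>x. iexp (\<theta> * T x) \<partial>M)) \<le> \<bar>\<theta>\<bar> * (3 * \<epsilon>)"
proof -
  define X where "X x = (\<integral>u. \<bar>D u x\<bar> powr r \<partial>\<nu>)" for x
  have [measurable]: "X \<in> borel_measurable M" unfolding X_def[abs_def] by (rule integral_powr_measurable)
  have i: "integrable M (\<lambda>x. iexp (\<theta> * X x))" "integrable M (\<lambda>x. iexp (\<theta> * T x))"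
    by (rule integrable_const_bound[where B=1]; auto)+
  have "ennreal (cmod ((\<integral>x. iexp (\<theta> * X x) \<partial>M) - (\<integral>x. iexp (\<theta> * T x) \<partial>M)))
     = ennreal (cmod (\<integral>x. iexp (\<theta> * X x) - iexp (\<theta> * T x) \<partial>M))"
    by (simp only: Bochner_Integration.integral_diff[OF i])
  also have "\<dots> \<le> (\<integral>\<^sup>+x. ennreal (cmod (iexp (\<theta> * X x) - iexp (\<theta> * T x))) \<partial>M)"
    by (rule integral_norm_bound_ennreal) (rule Bochner_Integration.integrable_diff[OF i])
  also have "\<dots> \<le> (\<integral>\<^sup>+x. ennreal \<bar>\<theta>\<bar> * (\<integral>\<^sup>+u. ennreal \<bar>\<bar>D u x\<bar> powr r - H (D u x)\<bar> \<partial>\<nu>) \<partial>M)"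
  proof (rule nn_integral_mono_AE)
    show "AE x in M. ennreal (cmod (iexp (\<theta> * X x) - iexp (\<theta> * T x)))
       \<le> ennreal \<bar>\<theta>\<bar> * (\<integral>\<^sup>+u. ennreal \<bar>\<bar>D u x\<bar> powr r - H (D u x)\<bar> \<partial>\<nu>)"
      using AE_error_finite
    proof eventually_elim
      case (elim x)
      have "cmod (iexp (\<theta> * X x) - iexp (\<theta> * T x)) \<le> \<bar>\<theta>\<bar> * \<bar>X x - T x\<bar>"
        using iexp_lipschitz[of "\<theta> * X x" "\<theta> * T x"] by (simp add: abs_mult[symmetric] algebra_simps)
      then have "ennreal (cmod (iexp (\<theta> * X x) - iexp (\<theta> * T x))) \<le> ennreal (\<bar>\<theta>\<bar> * \<bar>X x - T x\<bar>)"
        by (rule ennreal_leI)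
      also have "\<dots> = ennreal \<bar>\<theta>\<bar> * ennreal \<bar>X x - T x\<bar>" by (simp add: ennreal_mult)
      also have "\<dots> \<le> ennreal \<bar>\<theta>\<bar> * (\<integral>\<^sup>+u. ennreal \<bar>\<bar>D u x\<bar> powr r - H (D u x)\<bar> \<partial>\<nu>)"
        using elim by (intro mult_left_mono) (auto simp: X_def)
      finally show ?case .
    qed
  qed
  also have "\<dots> = ennreal \<bar>\<theta>\<bar> * (\<integral>\<^sup>+x. \<integral>\<^sup>+u. ennreal \<bar>\<bar>D u x\<bar> powr r - H (D u x)\<bar> \<partial>\<nu> \<partial>M)"
    by (rule nn_integral_cmult[OF error_meas])
  also have "\<dots> \<le> ennreal \<bar>\<theta>\<bar> * ennreal (3 * \<epsilon>)" by (intro mult_left_mono approx_error) simp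
  also have "\<dots> = ennreal (\<bar>\<theta>\<bar> * (3 * \<epsilon>))" using \<epsilon> by (simp add: ennreal_mult)
  finally show ?thesis using \<epsilon> by (simp add: X_def)
qed

end

end

text \<open>A convergence theorem in the spirit of Cremers and Kadelka: for integral functionals,
  convergence of the finite-dimensional laws and uniform integrability suffice, and no tightness
  in a function space is needed.\<close>
theorem integral_powr_functional_converges:
  fixes \<nu> :: "'i measure" and P :: "nat \<Rightarrow> 'a measure" and N :: "'b measure"
  assumes \<nu>: "prob_space \<nu>" and P: "\<And>n. prob_space (P n)" and N: "prob_space N"
    and D: "\<And>n. (\<lambda>(u, x). D n u x) \<in> borel_measurable (\<nu> \<Otimes>\<^sub>M P n)"
    and Y: "(\<lambda>(u, x). Y u x) \<in> borel_measurable (\<nu> \<Otimes>\<^sub>M N)"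
    and r: "0 < r"
    and fdd: "fdd_convergence (space \<nu>) P D N Y"
    and ui_D: "\<And>e. 0 < e \<Longrightarrow> \<exists>K. eventually (\<lambda>n.
        (\<integral>\<^sup>+u. \<integral>\<^sup>+x. ennreal (\<bar>D n u x\<bar> powr r * indicator {K<..} \<bar>D n u x\<bar>) \<partial>P n \<partial>\<nu>) \<le> ennreal e) sequentially"
    and ui_Y: "\<And>e. 0 < e \<Longrightarrow> \<exists>K.
        (\<integral>\<^sup>+u. \<integral>\<^sup>+x. ennreal (\<bar>Y u x\<bar> powr r * indicator {K<..} \<bar>Y u x\<bar>) \<partial>N \<partial>\<nu>) \<le> ennreal e"
  shows "AE x in N. integrable \<nu> (\<lambda>u. \<bar>Y u x\<bar> powr r)"
    and "(\<lambda>x. \<integral>u. \<bar>Y u x\<bar> powr r \<partial>\<nu>) \<in> borel_measurable N"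
    and "(\<lambda>n. \<integral>x. iexp (\<theta> * (\<integral>u. \<bar>D n u x\<bar> powr r \<partial>\<nu>)) \<partial>P n)
           \<longlonglongrightarrow> (\<integral>x. iexp (\<theta> * (\<integral>u. \<bar>Y u x\<bar> powr r \<partial>\<nu>)) \<partial>N)"
proof -
  have ex: "\<exists>H B K. eventually (\<lambda>n. (\<integral>\<^sup>+u. \<integral>\<^sup>+x. ennreal (\<bar>D n u x\<bar> powr r * indicator {K<..} \<bar>D n u x\<bar>) \<partial>P n \<partial>\<nu>) \<le> ennreal e) sequentially \<and>
      (\<integral>\<^sup>+u. \<integral>\<^sup>+x. ennreal (\<bar>Y u x\<bar> powr r * indicator {K<..} \<bar>Y u x\<bar>) \<partial>N \<partial>\<nu>) \<le> ennreal e \<and>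
      (\<forall>x. \<bar>\<bar>x\<bar> powr r - H x\<bar> \<le> e + 2 * (\<bar>x\<bar> powr r * indicator {K<..} \<bar>x\<bar>)) \<and>
      (\<forall>n. bounded_functional \<nu> (P n) (D n) H B) \<and> bounded_functional \<nu> N Y H B \<and>
      (\<forall>u\<in>space \<nu>. trig_poly (space \<nu>) (\<lambda>d. complex_of_real (H (d u))))" if e: "0 < e" for e :: real
  proof -
    obtain K1 where K1: "eventually (\<lambda>n.
        (\<integral>\<^sup>+u. \<integral>\<^sup>+x. ennreal (\<bar>D n u x\<bar> powr r * indicator {K1<..} \<bar>D n u x\<bar>) \<partial>P n \<partial>\<nu>) \<le> ennreal e) sequentially"
      using ui_D[OF e] by auto
    obtain K2 where K2: "(\<integral>\<^sup>+u. \<integral>\<^sup>+x. ennreal (\<bar>Y u x\<bar> powr r * indicator {K2<..} \<bar>Y u x\<bar>) \<partial>N \<partial>\<nu>) \<le> ennreal e"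
      using ui_Y[OF e] by auto
    \<comment> \<open>One cutoff for the processes and the limit, so that a single \<open>H\<close>
      serves for both; raising a cutoff only shrinks a tail.\<close>
    define K where "K = max 1 (max K1 K2)"
    have ind: "indicator {K<..} y \<le> (indicator {K1<..} y :: real)" "indicator {K<..} y \<le> (indicator {K2<..} y :: real)" for y
      by (auto simp: K_def indicator_def)
    have "eventually (\<lambda>n. (\<integral>\<^sup>+u. \<integral>\<^sup>+x. ennreal (\<bar>D n u x\<bar> powr r * indicator {K<..} \<bar>D n u x\<bar>) \<partial>P n \<partial>\<nu>) \<le> ennreal e) sequentially"
      using K1
    proof eventually_elim
      case (elim n)
      show ?case by (rule order_trans[OF _ elim]) (intro nn_integral_mono ennreal_leI mult_left_mono ind, simp)
    qed
    moreover have "(\<integral>\<^sup>+u. \<integral>\<^sup>+x. ennreal (\<bar>Y u x\<bar> powr r * indicator {K<..} \<bar>Y u x\<bar>) \<partial>N \<partial>\<nu>) \<le> ennreal e"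
      by (rule order_trans[OF _ K2]) (intro nn_integral_mono ennreal_leI mult_left_mono ind, simp)
    moreover have "0 < K" by (simp add: K_def)
    then obtain p where p: "real_polynomial_function p"
      "\<And>x. \<bar>\<bar>x\<bar> powr r - p (cos (pi / K * x))\<bar> \<le> e + 2 * (\<bar>x\<bar> powr r * indicator {K<..} \<bar>x\<bar>)"
      "\<And>x. \<bar>p (cos (pi / K * x))\<bar> \<le> K powr r + e"
      using powr_abs_trig_approx[OF r _ e] by metis
    define H where "H x = p (cos (pi / K * x))" for x
    have "continuous_on UNIV p" using p(1) by (rule continuous_on_polymonial_function[OF real_polynomial_function_eq[THEN iffD1]])
    then have [measurable]: "p \<in> borel_measurable borel" by (rule borel_measurable_continuous_onI)
    have Hm: "H \<in> borel_measurable borel" unfolding H_def[abs_def] by measurable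
    have "bounded_functional \<nu> (P n) (D n) H (K powr r + e)" for n
      using \<nu> P D Hm p(3) by (auto simp: bounded_functional_def bounded_functional_axioms_def H_def)
    moreover have "bounded_functional \<nu> N Y H (K powr r + e)"
      using \<nu> N Y Hm p(3) by (auto simp: bounded_functional_def bounded_functional_axioms_def H_def)
    moreover have "\<forall>u\<in>space \<nu>. trig_poly (space \<nu>) (\<lambda>d. complex_of_real (H (d u)))"
      unfolding H_def by (intro ballI trig_poly_polynomial_cos p)
    moreover have "\<forall>x. \<bar>\<bar>x\<bar> powr r - H x\<bar> \<le> e + 2 * (\<bar>x\<bar> powr r * indicator {K<..} \<bar>x\<bar>)"
      unfolding H_def by (intro allI p)
    ultimately show ?thesis by blast
  qed
  have Yfacts: "(AE x in N. integrable \<nu> (\<lambda>u. \<bar>Y u x\<bar> powr r)) \<and> (\<lambda>x. \<integral>u. \<bar>Y u x\<bar> powr r \<partial>\<nu>) \<in> borel_measurable N"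
  proof -
    obtain H B K where H: "\<And>x. \<bar>\<bar>x\<bar> powr r - H x\<bar> \<le> 1 + 2 * (\<bar>x\<bar> powr r * indicator {K<..} \<bar>x\<bar>)"
      and K: "(\<integral>\<^sup>+u. \<integral>\<^sup>+x. ennreal (\<bar>Y u x\<bar> powr r * indicator {K<..} \<bar>Y u x\<bar>) \<partial>N \<partial>\<nu>) \<le> ennreal 1"
      and b: "bounded_functional \<nu> N Y H B"
      using ex[of 1] by auto
    interpret bounded_functional \<nu> N Y H B by (rule b)
    show ?thesis using AE_error_finite[OF H K] integral_powr_measurable[OF H K] by (auto elim: eventually_mono)
  qed
  then show "AE x in N. integrable \<nu> (\<lambda>u. \<bar>Y u x\<bar> powr r)"
    and "(\<lambda>x. \<integral>u. \<bar>Y u x\<bar> powr r \<partial>\<nu>) \<in> borel_measurable N" by auto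
  show "(\<lambda>n. \<integral>x. iexp (\<theta> * (\<integral>u. \<bar>D n u x\<bar> powr r \<partial>\<nu>)) \<partial>P n)
           \<longlonglongrightarrow> (\<integral>x. iexp (\<theta> * (\<integral>u. \<bar>Y u x\<bar> powr r \<partial>\<nu>)) \<partial>N)"
  proof (rule tendsto_approx)
    fix e :: real assume e: "0 < e"
    \<comment> \<open>Adding 1 avoids a division by zero for \<open>\<theta> = 0\<close>.\<close>
    define a where "a = \<bar>\<theta>\<bar> + 1"
    define \<epsilon> where "\<epsilon> = e / (3 * a)"
    have a: "0 < a" by (simp add: a_def add_nonneg_pos)
    have \<epsilon>: "0 < \<epsilon>" using e a by (simp add: \<epsilon>_def)
    have le: "\<bar>\<theta>\<bar> * (3 * \<epsilon>) \<le> e"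
    proof -
      have "\<bar>\<theta>\<bar> * (3 * \<epsilon>) \<le> a * (3 * \<epsilon>)" using \<epsilon> by (intro mult_right_mono) (auto simp: a_def)
      also have "\<dots> = e" using a by (simp add: \<epsilon>_def)
      finally show ?thesis .
    qed
    obtain H B K where KD: "eventually (\<lambda>n. (\<integral>\<^sup>+u. \<integral>\<^sup>+x. ennreal (\<bar>D n u x\<bar> powr r * indicator {K<..} \<bar>D n u x\<bar>) \<partial>P n \<partial>\<nu>) \<le> ennreal \<epsilon>) sequentially"
      and KY: "(\<integral>\<^sup>+u. \<integral>\<^sup>+x. ennreal (\<bar>Y u x\<bar> powr r * indicator {K<..} \<bar>Y u x\<bar>) \<partial>N \<partial>\<nu>) \<le> ennreal \<epsilon>"
      and H: "\<And>x. \<bar>\<bar>x\<bar> powr r - H x\<bar> \<le> \<epsilon> + 2 * (\<bar>x\<bar> powr r * indicator {K<..} \<bar>x\<bar>)"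
      and bD: "\<And>n. bounded_functional \<nu> (P n) (D n) H B" and bY: "bounded_functional \<nu> N Y H B"
      and tr: "\<And>u. u \<in> space \<nu> \<Longrightarrow> trig_poly (space \<nu>) (\<lambda>d. complex_of_real (H (d u)))"
      using ex[OF \<epsilon>] by blast
    let ?b = "\<lambda>n. \<integral>x. iexp (\<theta> * bounded_functional.T \<nu> (D n) H x) \<partial>P n"
    let ?l = "\<integral>x. iexp (\<theta> * bounded_functional.T \<nu> Y H x) \<partial>N"
    have "?b \<longlonglongrightarrow> ?l" by (rule bounded_functional_char_converges[OF bD bY fdd tr])
    moreover have "eventually (\<lambda>n. norm ((\<integral>x. iexp (\<theta> * (\<integral>u. \<bar>D n u x\<bar> powr r \<partial>\<nu>)) \<partial>P n) - ?b n) \<le> e) sequentially"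
      using KD
    proof eventually_elim
      case (elim n)
      show ?case
        by (rule order_trans[OF bounded_functional.char_approx_error[OF bD H elim less_imp_le[OF \<epsilon>]] le])
    qed
    moreover have "norm ((\<integral>x. iexp (\<theta> * (\<integral>u. \<bar>Y u x\<bar> powr r \<partial>\<nu>)) \<partial>N) - ?l) \<le> e"
      by (rule order_trans[OF bounded_functional.char_approx_error[OF bY H KY less_imp_le[OF \<epsilon>]] le])
    ultimately show "\<exists>b l. b \<longlonglongrightarrow> l \<and> eventually (\<lambda>n. norm ((\<integral>x. iexp (\<theta> * (\<integral>u. \<bar>D n u x\<bar> powr r \<partial>\<nu>)) \<partial>P n) - b n) \<le> e) sequentially \<and>
       norm ((\<integral>x. iexp (\<theta> * (\<integral>u. \<bar>Y u x\<bar> powr r \<partial>\<nu>)) \<partial>N) - l) \<le> e"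
      by blast
  qed
qed

subsection \<open>Central moments of uniform order statistics\<close>

text \<open>The function \<open>x ^ Suc k * (1 - x) ^ Suc l * (x - \<mu>) ^ j\<close> vanishes at 0
  and 1, so its derivative integrates to 0. As \<open>\<mu>\<close> is the mean of the Beta law with
  parameters \<open>Suc k\<close> and \<open>Suc l\<close>, differentiating the weight produces
  exactly the factor \<open>- N * (x - \<mu>)\<close>.\<close>

lemma beta_moment_recursion:
  fixes k l :: nat and \<mu> :: real
  defines "N \<equiv> real (Suc k + Suc l)"
  assumes \<mu>: "\<mu> = real (Suc k) / N"
  defines "m \<equiv> \<lambda>j. \<integral>x. (x ^ k * (1 - x) ^ l * (x - \<mu>) ^ j) * indicator {0..1} x \<partial>lborel"
  shows "m 1 = 0"
    and "(N + real (Suc i)) * m (Suc (Suc i)) = real (Suc i) * (\<mu> * (1 - \<mu>) * m i + (1 - 2 * \<mu>) * m (Suc i))"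
proof -
  define W where "W x = x ^ k * (1 - x) ^ l" for x :: real
  have N0: "N > 0" by (simp add: N_def)
  have N\<mu>: "N * \<mu> = real (Suc k)" using N0 \<mu> by simp
  have int: "integrable lborel (\<lambda>x. (W x * (x - \<mu>) ^ j) * indicator {0..1} x)" for j
  proof -
    have "continuous_on {0..1} (\<lambda>x. W x * (x - \<mu>) ^ j)"
      unfolding W_def by (intro continuous_intros)
    then have "integrable lborel (\<lambda>x. indicator {0..1} x *\<^sub>R (W x * (x - \<mu>) ^ j))"
      by (intro borel_integrable_compact) auto
    then show ?thesis by (simp add: mult.commute)
  qed
  have m_eq: "m j = (\<integral>x. (W x * (x - \<mu>) ^ j) * indicator {0..1} x \<partial>lborel)" for j
    by (simp add: m_def W_def)
  have key: "- N * m (Suc j) + real j * (\<mu> * (1 - \<mu>) * m (j - 1) + (1 - 2 * \<mu>) * m j - m (Suc j)) = 0" for j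
  proof -
    define G where "G x = x ^ Suc k * (1 - x) ^ Suc l * (x - \<mu>) ^ j" for x :: real
    define g where "g x = - N * (W x * (x - \<mu>) ^ Suc j)
      + real j * (\<mu> * (1 - \<mu>) * (W x * (x - \<mu>) ^ (j - 1)) + (1 - 2 * \<mu>) * (W x * (x - \<mu>) ^ j) - W x * (x - \<mu>) ^ Suc j)" for x
    have d: "(G has_real_derivative g x) (at x)" for x
    proof -
      have "(G has_real_derivative
        ((real (Suc k) * x ^ k) * (1 - x) ^ Suc l + x ^ Suc k * (- (real (Suc l) * (1 - x) ^ l))) * (x - \<mu>) ^ j
         + x ^ Suc k * (1 - x) ^ Suc l * (real j * (x - \<mu>) ^ (j - 1))) (at x)"
        unfolding G_def by (auto intro!: derivative_eq_intros simp del: power_Suc simp: algebra_simps)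
      also have "((real (Suc k) * x ^ k) * (1 - x) ^ Suc l + x ^ Suc k * (- (real (Suc l) * (1 - x) ^ l))) * (x - \<mu>) ^ j
         = W x * (real (Suc k) * (1 - x) - real (Suc l) * x) * (x - \<mu>) ^ j"
        by (simp add: W_def algebra_simps)
      also have "real (Suc k) * (1 - x) - real (Suc l) * x = - N * (x - \<mu>)"
        using N\<mu> by (simp add: N_def algebra_simps)
      also have "x ^ Suc k * (1 - x) ^ Suc l * (real j * (x - \<mu>) ^ (j - 1))
         = real j * (W x * (x * (1 - x)) * (x - \<mu>) ^ (j - 1))"
        by (simp add: W_def algebra_simps)
      \<comment> \<open>Expanding about \<open>\<mu>\<close> expresses everything through central
        moments.\<close>
      also have "x * (1 - x) = \<mu> * (1 - \<mu>) + (1 - 2 * \<mu>) * (x - \<mu>) - (x - \<mu>) * (x - \<mu>)"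
        by (simp add: algebra_simps)
      also have "real j * (W x * (\<mu> * (1 - \<mu>) + (1 - 2 * \<mu>) * (x - \<mu>) - (x - \<mu>) * (x - \<mu>)) * (x - \<mu>) ^ (j - 1))
         = real j * (\<mu> * (1 - \<mu>) * (W x * (x - \<mu>) ^ (j - 1)) + (1 - 2 * \<mu>) * (W x * (x - \<mu>) ^ j) - W x * (x - \<mu>) ^ Suc j)"
        by (cases j) (simp_all add: algebra_simps)
      finally show ?thesis by (simp add: g_def mult_ac)
    qed
    have "(\<integral>x. g x * indicator {0..1} x \<partial>lborel) = G 1 - G 0"
    proof (rule integral_FTC_Icc_real)
      fix x :: real
      show "(G has_real_derivative g x) (at x)" by (rule d)
      show "isCont g x" unfolding g_def W_def by (intro continuous_intros)
    qed simp
    also have "\<dots> = 0" by (simp add: G_def)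
    finally have "0 = (\<integral>x. g x * indicator {0..1} x \<partial>lborel)" by simp
    also have "\<dots> = (\<integral>x. - N * ((W x * (x - \<mu>) ^ Suc j) * indicator {0..1} x)
      + real j * (\<mu> * (1 - \<mu>) * ((W x * (x - \<mu>) ^ (j - 1)) * indicator {0..1} x)
           + (1 - 2 * \<mu>) * ((W x * (x - \<mu>) ^ j) * indicator {0..1} x) - (W x * (x - \<mu>) ^ Suc j) * indicator {0..1} x) \<partial>lborel)"
      by (intro Bochner_Integration.integral_cong refl) (simp add: g_def algebra_simps)
    also have "\<dots> = - N * m (Suc j) + real j * (\<mu> * (1 - \<mu>) * m (j - 1) + (1 - 2 * \<mu>) * m j - m (Suc j))"
      unfolding m_eq
      by (subst Bochner_Integration.integral_add Bochner_Integration.integral_diff integral_mult_right_zero;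
          (intro Bochner_Integration.integrable_add Bochner_Integration.integrable_diff integrable_mult_right int)?)+ (rule refl)
    finally show ?thesis by simp
  qed
  show "m 1 = 0" using key[of 0] N0 by simp
  show "(N + real (Suc i)) * m (Suc (Suc i)) = real (Suc i) * (\<mu> * (1 - \<mu>) * m i + (1 - 2 * \<mu>) * m (Suc i))"
    using key[of "Suc i"] by (simp add: algebra_simps)
qed

text \<open>These numbers solve the moment recursion after division by powers of the standard
  deviation; the 2 comes from the condition \<open>1 \<le> 2 * (N * s)\<close> below.\<close>

fun moment_const :: "nat \<Rightarrow> real" where
  "moment_const 0 = 1"
| "moment_const (Suc 0) = 1"
| "moment_const (Suc (Suc i)) = real (Suc i) * (moment_const i + 2 * moment_const (Suc i))"

lemma moment_const_nonneg: "0 \<le> moment_const j"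
  by (induction j rule: moment_const.induct) auto

text \<open>Dividing the recursion by \<open>N\<close>, the first term gains \<open>s\<close>
  squared and the second gains \<open>1 / N\<close>, which is at most \<open>2 * s\<close>. So each
  step costs one power of \<open>s\<close> per order, as for a Gaussian variable.\<close>

lemma moment_recursion_bound:
  fixes m :: "nat \<Rightarrow> real"
  assumes m0: "m 0 = 1" and m1: "m 1 = 0" and N: "0 < N" and \<mu>: "0 \<le> \<mu>" "\<mu> \<le> 1"
    and rec: "\<And>i. (N + real (Suc i)) * m (Suc (Suc i)) = real (Suc i) * (\<mu> * (1 - \<mu>) * m i + (1 - 2 * \<mu>) * m (Suc i))"
    and s: "\<mu> * (1 - \<mu>) = N * s\<^sup>2" "1 \<le> 2 * (N * s)"
  shows "\<bar>m j\<bar> \<le> moment_const j * s ^ j"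
proof (induction j rule: moment_const.induct)
  case 2
  have "0 < N * s" using s(2) by simp
  then have "0 < s" using N by (simp add: zero_less_mult_iff)
  then show ?case using m1 by simp
next
  case (3 i)
  have "0 < N * s" using s(2) by simp
  then have "0 < s" using N by (simp add: zero_less_mult_iff)
  then have s0: "0 \<le> s" by simp
  \<comment> \<open>On the left only \<open>N\<close> is kept of the factor
    \<open>N + real (Suc i)\<close>.\<close>
  have "N * \<bar>m (Suc (Suc i))\<bar> \<le> \<bar>(N + real (Suc i)) * m (Suc (Suc i))\<bar>"
    using N by (simp add: abs_mult mult_right_mono)
  also have "\<dots> = real (Suc i) * \<bar>N * s\<^sup>2 * m i + (1 - 2 * \<mu>) * m (Suc i)\<bar>"
    unfolding rec s(1) by (simp add: abs_mult)
  also have "\<dots> \<le> real (Suc i) * (N * s\<^sup>2 * \<bar>m i\<bar> + 1 * \<bar>m (Suc i)\<bar>)"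
  proof (intro mult_left_mono order_trans[OF abs_triangle_ineq] add_mono)
    show "\<bar>N * s\<^sup>2 * m i\<bar> \<le> N * s\<^sup>2 * \<bar>m i\<bar>" using N by (simp add: abs_mult)
    show "\<bar>(1 - 2 * \<mu>) * m (Suc i)\<bar> \<le> 1 * \<bar>m (Suc i)\<bar>"
      unfolding abs_mult using \<mu> by (intro mult_right_mono) auto
  qed simp
  also have "\<dots> \<le> real (Suc i) * (N * s\<^sup>2 * (moment_const i * s ^ i) + (2 * (N * s)) * (moment_const (Suc i) * s ^ Suc i))"
    using 3 s N s0 moment_const_nonneg
    by (intro mult_left_mono add_mono mult_mono[of 1]) (auto intro!: mult_nonneg_nonneg)
  also have "\<dots> = N * (moment_const (Suc (Suc i)) * s ^ Suc (Suc i))"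
    by (simp add: algebra_simps power2_eq_square)
  finally show ?case using N by simp
qed (use m0 m1 in auto)

text \<open>After scaling by \<open>s\<close>, the inequality y^p <= 1 + y^(2m) reduces a real
  exponent to an even one, for which the absolute value disappears.\<close>

lemma (in prob_space) abs_powr_moment_bound:
  assumes int: "integrable M (\<lambda>x. X x ^ (2 * m))" and le: "expectation (\<lambda>x. X x ^ (2 * m)) \<le> C * s ^ (2 * m)"
    and s: "0 < s" and p: "0 \<le> p" "p \<le> real (2 * m)" and X: "X \<in> borel_measurable M" and C: "0 \<le> C"
  shows "(\<integral>\<^sup>+x. ennreal (\<bar>X x\<bar> powr p) \<partial>M) \<le> ennreal ((1 + C) * s powr p)"
proof -
  have ptw: "\<bar>X x\<bar> powr p \<le> s powr p * (1 + X x ^ (2 * m) / s ^ (2 * m))" for x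
  proof -
    define y where "y = \<bar>X x\<bar> / s"
    have y: "0 \<le> y" "\<bar>X x\<bar> = s * y" using s by (auto simp: y_def)
    have "y powr p \<le> 1 + y ^ (2 * m)"
    proof (cases "y \<le> 1")
      case True
      then have "y powr p \<le> 1 powr p" using y p by (intro powr_mono2) auto
      then show ?thesis using y by (simp add: add_increasing2)
    next
      case False
      then have "y powr p \<le> y powr real (2 * m)" using p by (intro powr_mono) auto
      also have "\<dots> = y ^ (2 * m)" using False by (intro powr_realpow) auto
      finally show ?thesis by simp
    qed
    moreover have "X x ^ (2 * m) / s ^ (2 * m) = y ^ (2 * m)"
      unfolding y_def power_divide by (simp add: power_even_abs)
    moreover have "\<bar>X x\<bar> powr p = s powr p * y powr p" using y s by (simp add: powr_mult)
    ultimately show ?thesis by (simp add: mult_left_mono)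
  qed
  have "(\<integral>\<^sup>+x. ennreal (\<bar>X x\<bar> powr p) \<partial>M) \<le> (\<integral>\<^sup>+x. ennreal (s powr p * (1 + X x ^ (2 * m) / s ^ (2 * m))) \<partial>M)"
    by (intro nn_integral_mono ennreal_leI ptw)
  also have "\<dots> = ennreal (expectation (\<lambda>x. s powr p * (1 + X x ^ (2 * m) / s ^ (2 * m))))"
    using s by (intro nn_integral_eq_integral integrable_mult_right Bochner_Integration.integrable_add integrable_divide int) auto
  also have "expectation (\<lambda>x. s powr p * (1 + X x ^ (2 * m) / s ^ (2 * m))) = s powr p * (1 + expectation (\<lambda>x. X x ^ (2 * m)) / s ^ (2 * m))"
    using int by (simp add: prob_space)
  also have "ennreal \<dots> \<le> ennreal (s powr p * (1 + C))"
    using le s by (intro ennreal_leI mult_left_mono add_left_mono) (auto simp: divide_le_eq)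
  finally show ?thesis by (simp add: mult.commute)
qed

text \<open>Values lie in the open interval at every point and not just almost surely, so that the
  quantile function is evaluated only where it is meaningful.\<close>

locale iid_uniform = prob_space M for M :: "'a measure" +
  fixes U :: "nat \<Rightarrow> 'a \<Rightarrow> real"
  assumes indep: "indep_vars (\<lambda>_. borel) U UNIV"
    and U_range: "\<And>i x. x \<in> space M \<Longrightarrow> U i x \<in> {0<..<1}"
    and U_cdf: "\<And>i t. 0 \<le> t \<Longrightarrow> t \<le> 1 \<Longrightarrow> prob {x\<in>space M. U i x \<le> t} = t"
begin

lemma U_meas[measurable]: "U i \<in> borel_measurable M"
  using indep by (auto simp: indep_vars_def)

definition uos :: "nat \<Rightarrow> nat \<Rightarrow> 'a \<Rightarrow> real" where
  "uos n k x = order_stat n (\<lambda>j. U j x) k"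

lemma uos_meas[measurable]: "1 \<le> k \<Longrightarrow> k \<le> n \<Longrightarrow> uos n k \<in> borel_measurable M"
  unfolding uos_def[abs_def] by (rule borel_measurable_order_stat) auto

lemma uos_range: "1 \<le> k \<Longrightarrow> k \<le> n \<Longrightarrow> x \<in> space M \<Longrightarrow> uos n k x \<in> {0<..<1}"
  using order_stat_in[of k n "\<lambda>j. U j x"] U_range by (auto simp: uos_def)

lemma prob_count_set:
  assumes t: "0 \<le> t" "t \<le> 1" and A: "A \<subseteq> {1..n}" and n: "1 \<le> n"
  shows "prob {x\<in>space M. {j\<in>{1..n}. U j x \<le> t} = A} = t ^ card A * (1 - t) ^ (n - card A)"
proof -
  define S where "S j = (if j \<in> A then {..t} else {t<..})" for j
  have "{x\<in>space M. {j\<in>{1..n}. U j x \<le> t} = A} = (\<Inter>j\<in>{1..n}. U j -` S j \<inter> space M)"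
  proof -
    have "{j\<in>{1..n}. U j x \<le> t} = A \<longleftrightarrow> (\<forall>j\<in>{1..n}. U j x \<in> S j)" for x
    proof -
      have "{j\<in>{1..n}. U j x \<le> t} = A \<longleftrightarrow> (\<forall>j\<in>{1..n}. U j x \<le> t \<longleftrightarrow> j \<in> A)" using A by blast
      also have "\<dots> \<longleftrightarrow> (\<forall>j\<in>{1..n}. U j x \<in> S j)" by (intro ball_cong refl) (auto simp: S_def)
      finally show ?thesis .
    qed
    then show ?thesis using n by auto
  qed
  also have "prob \<dots> = (\<Prod>j\<in>{1..n}. prob (U j -` S j \<inter> space M))"
    by (rule indep_varsD[OF indep]) (use n in \<open>auto simp: S_def\<close>)
  also have "\<dots> = (\<Prod>j\<in>{1..n}. if j \<in> A then t else 1 - t)"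
  proof (intro prod.cong refl)
    fix j
    have 1: "prob {x\<in>space M. U j x \<le> t} = t" by (rule U_cdf[OF t])
    have "prob (space M - {x\<in>space M. U j x \<le> t}) = 1 - t"
      by (subst prob_compl) (auto simp: 1)
    moreover have "space M - {x\<in>space M. U j x \<le> t} = U j -` {t<..} \<inter> space M" by auto
    moreover have "{x\<in>space M. U j x \<le> t} = U j -` {..t} \<inter> space M" by auto
    ultimately show "prob (U j -` S j \<inter> space M) = (if j \<in> A then t else 1 - t)"
      using 1 by (auto simp: S_def)
  qed
  also have "\<dots> = t ^ card A * (1 - t) ^ card ({1..n} - A)"
  proof -
    have "{1..n} \<inter> {x. x \<in> A} = A" "{1..n} \<inter> - {x. x \<in> A} = {1..n} - A" using A by auto
    then show ?thesis by (subst prod.If_cases) auto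
  qed
  also have "card ({1..n} - A) = n - card A" using A finite_subset[OF A] by (simp add: card_Diff_subset)
  finally show ?thesis .
qed

text \<open>By the duality with counts the event is that at least \<open>k\<close> observations are
  at most \<open>t\<close>. It is partitioned according to the set of their indices, and the sets of
  equal size are then collected.\<close>

lemma prob_uos_le:
  assumes t: "0 \<le> t" "t \<le> 1" and k: "1 \<le> k" "k \<le> n"
  shows "prob {x\<in>space M. uos n k x \<le> t} = (\<Sum>j=k..n. real (n choose j) * t ^ j * (1 - t) ^ (n - j))"
proof -
  define \<A> where "\<A> = {A. A \<subseteq> {1..n} \<and> k \<le> card A}"
  have fin: "finite \<A>" unfolding \<A>_def by (rule finite_subset[of _ "Pow {1..n}"]) auto
  define E where "E A = {x\<in>space M. {j\<in>{1..n}. U j x \<le> t} = A}" for A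
  have E: "E A \<in> sets M" if "A \<in> \<A>" for A
  proof -
    have "E A = {x\<in>space M. \<forall>j\<in>{1..n}. U j x \<le> t \<longleftrightarrow> j \<in> A}"
      using that by (auto simp: E_def \<A>_def)
    also have "\<dots> \<in> sets M" by measurable
    finally show ?thesis .
  qed
  have "{x\<in>space M. uos n k x \<le> t} = (\<Union>A\<in>\<A>. E A)"
    using order_stat_le_iff[OF k] by (auto simp: uos_def E_def \<A>_def)
  also have "prob \<dots> = (\<Sum>A\<in>\<A>. prob (E A))"
    by (rule finite_measure_finite_Union[OF fin]) (use E in \<open>auto simp: E_def disjoint_family_on_def\<close>)
  also have "\<dots> = (\<Sum>A\<in>\<A>. t ^ card A * (1 - t) ^ (n - card A))"
    unfolding E_def using k by (intro sum.cong refl prob_count_set[OF t]) (auto simp: \<A>_def)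
  also have "\<dots> = (\<Sum>j\<in>{k..n}. \<Sum>A\<in>{A\<in>\<A>. card A = j}. t ^ card A * (1 - t) ^ (n - card A))"
  proof (rule sum.group[symmetric, OF fin])
    show "card ` \<A> \<subseteq> {k..n}" using card_mono[of "{1..n}"] by (auto simp: \<A>_def)
  qed simp
  also have "\<dots> = (\<Sum>j\<in>{k..n}. real (n choose j) * t ^ j * (1 - t) ^ (n - j))"
  proof (intro sum.cong refl)
    fix j assume j: "j \<in> {k..n}"
    have "{A\<in>\<A>. card A = j} = {A. A \<subseteq> {1..n} \<and> card A = j}" using j by (auto simp: \<A>_def)
    then have "card {A\<in>\<A>. card A = j} = n choose j" by (simp add: n_subsets)
    moreover have "(\<Sum>A\<in>{A\<in>\<A>. card A = j}. t ^ card A * (1 - t) ^ (n - card A)) = (\<Sum>A\<in>{A\<in>\<A>. card A = j}. t ^ j * (1 - t) ^ (n - j))"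
      by (intro sum.cong) auto
    ultimately show "(\<Sum>A\<in>{A\<in>\<A>. card A = j}. t ^ card A * (1 - t) ^ (n - card A)) = real (n choose j) * t ^ j * (1 - t) ^ (n - j)"
      by simp
  qed
  finally show ?thesis .
qed

end

text \<open>The derivative of the \<open>j\<close>-th term is a difference of consecutive members of
  one sequence, so the sum telescopes and only the term at \<open>k\<close> survives.\<close>

lemma binomial_tail_deriv:
  assumes "1 \<le> k" "k \<le> n"
  shows "((\<lambda>t. \<Sum>j=k..n. real (n choose j) * t ^ j * (1 - t) ^ (n - j)) has_real_derivative
     real k * real (n choose k) * t ^ (k - 1) * (1 - t) ^ (n - k)) (at t)"
proof -
  define \<tau> where "\<tau> j = real j * real (n choose j) * t ^ (j - 1) * (1 - t) ^ (n - j)" for j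
  have d: "((\<lambda>t. real (n choose j) * t ^ j * (1 - t) ^ (n - j)) has_real_derivative \<tau> j - \<tau> (j + 1)) (at t)" for j
  proof -
    have "((\<lambda>t. real (n choose j) * t ^ j * (1 - t) ^ (n - j)) has_real_derivative
      real (n choose j) * (real j * t ^ (j - 1)) * (1 - t) ^ (n - j) - real (n choose j) * t ^ j * (real (n - j) * (1 - t) ^ (n - j - 1))) (at t)"
      by (auto intro!: derivative_eq_intros simp: algebra_simps)
    moreover
    \<comment> \<open>The absorption identity for binomial coefficients identifies the second
      summand of the product rule with the next member of the sequence.\<close>
    have eq: "real (n choose j) * real (n - j) = real (j + 1) * real (n choose (j + 1))"
    proof (cases n)
      case (Suc n')
      have "(n - j) * (n choose j) = n * ((n - 1) choose j)" by (rule binomial_absorb_comp)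
      also have "\<dots> = Suc j * (n choose Suc j)" using binomial_absorption[of j n] by simp
      finally show ?thesis by (metis Suc_eq_plus1 mult.commute of_nat_mult)
    qed simp
    have "real (n choose j) * (real j * t ^ (j - 1)) * (1 - t) ^ (n - j) - real (n choose j) * t ^ j * (real (n - j) * (1 - t) ^ (n - j - 1)) = \<tau> j - \<tau> (j + 1)"
    proof -
      have "real (n choose j) * t ^ j * (real (n - j) * (1 - t) ^ (n - j - 1)) = (real (n choose j) * real (n - j)) * (t ^ j * (1 - t) ^ (n - j - 1))"
        by (simp only: mult_ac)
      also have "\<dots> = \<tau> (j + 1)" unfolding eq by (simp add: \<tau>_def)
      finally show ?thesis by (simp add: \<tau>_def)
    qed
    ultimately show ?thesis by (rule DERIV_cong)
  qed
  have "((\<lambda>t. \<Sum>j=k..n. real (n choose j) * t ^ j * (1 - t) ^ (n - j)) has_real_derivative (\<Sum>j=k..n. \<tau> j - \<tau> (j + 1))) (at t)"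
    by (intro DERIV_sum d)
  also have "(\<Sum>j=k..n. \<tau> j - \<tau> (j + 1)) = \<tau> k - \<tau> (n + 1)"
    using assms by (subst sum_natinterval_diff) auto
  also have "\<tau> (n + 1) = 0" by (simp add: \<tau>_def)
  finally show ?thesis by (simp add: \<tau>_def)
qed

context iid_uniform
begin

text \<open>The Beta law with parameters \<open>k\<close> and \<open>n - k + 1\<close>; its density
  is the telescoped derivative of the binomial tail.\<close>

lemma uos_distributed:
  assumes k: "1 \<le> k" "k \<le> n"
  shows "distributed M lborel (uos n k)
    (\<lambda>x. real k * real (n choose k) * (x ^ (k - 1) * (1 - x) ^ (n - k)) * indicator {0..1} x)"
proof -
  define b where "b x = real k * real (n choose k) * x ^ (k - 1) * (1 - x) ^ (n - k)" for x :: real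
  define B where "B t = (\<Sum>j=k..n. real (n choose j) * t ^ j * (1 - t) ^ (n - j))" for t :: real
  have B0: "B 0 = 0" unfolding B_def using k by (intro sum.neutral) (auto simp: power_0_left)
  have Bp: "prob {x\<in>space M. uos n k x \<le> t} = B t" if "0 \<le> t" "t \<le> 1" for t
    unfolding B_def by (rule prob_uos_le[OF that k])
  have b0: "0 \<le> b x" if "0 \<le> x" "x \<le> 1" for x using that by (simp add: b_def)
  have bm: "b \<in> borel_measurable borel" unfolding b_def[abs_def] by measurable
  have I: "(\<integral>\<^sup>+x. ennreal (b x) * indicator {0..t} x \<partial>lborel) = ennreal (B t)" if "0 \<le> t" "t \<le> 1" for t
  proof -
    have "(\<integral>\<^sup>+x. ennreal (b x) * indicator {0..t} x \<partial>lborel) = ennreal (B t - B 0)"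
    proof (rule nn_integral_FTC_Icc[where F=B and a=0 and b=t, OF bm])
      fix x assume "x \<in> {0..t}"
      then show "0 \<le> b x" using b0 that by auto
      show "(B has_real_derivative b x) (at x)"
        unfolding B_def[abs_def] b_def by (rule binomial_tail_deriv[OF k])
    qed fact
    then show ?thesis by (simp add: B0)
  qed
  have "distributed M lborel (uos n k) (\<lambda>x. b x * indicator {0..1} x)"
  proof (rule distributedI_borel_atMost[where g="\<lambda>a. if a < 0 then 0 else B (min a 1)"])
    show "uos n k \<in> borel_measurable M" by (rule uos_meas[OF k])
    show "(\<lambda>x. b x * indicator {0..1} x) \<in> borel_measurable borel" using bm by measurable
    show "AE x in lborel. 0 \<le> b x * indicator {0..1} x" using b0 by (auto simp: indicator_def)
    fix a :: real
    show "(\<integral>\<^sup>+x. ennreal (b x * indicator {0..1} x * indicator {..a} x) \<partial>lborel) = ennreal (if a < 0 then 0 else B (min a 1))"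
    proof (cases "a < 0")
      case True
      then have "(\<integral>\<^sup>+x. ennreal (b x * indicator {0..1} x * indicator {..a} x) \<partial>lborel) = (\<integral>\<^sup>+x. 0 \<partial>(lborel :: real measure))"
        by (intro nn_integral_cong) (auto simp: indicator_def)
      then show ?thesis using True by simp
    next
      case False
      then have "(\<integral>\<^sup>+x. ennreal (b x * indicator {0..1} x * indicator {..a} x) \<partial>lborel) = (\<integral>\<^sup>+x. ennreal (b x) * indicator {0..min a 1} x \<partial>lborel)"
        by (intro nn_integral_cong) (auto simp: indicator_def)
      then show ?thesis using False I[of "min a 1"] by simp
    qed
    have rng: "0 < uos n k x" "uos n k x < 1" if "x \<in> space M" for x using uos_range[OF k that] by auto
    show "emeasure M {x\<in>space M. uos n k x \<le> a} = ennreal (if a < 0 then 0 else B (min a 1))"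
    proof (cases "a < 0")
      case True
      have "\<not> uos n k x \<le> a" if "x \<in> space M" for x using rng(1)[OF that] True by linarith
      then have eq: "{x\<in>space M. uos n k x \<le> a} = {}" by auto
      show ?thesis unfolding eq using True by simp
    next
      case False
      have "uos n k x \<le> a \<longleftrightarrow> uos n k x \<le> min a 1" if "x \<in> space M" for x using rng(2)[OF that] by auto
      then have "{x\<in>space M. uos n k x \<le> a} = {x\<in>space M. uos n k x \<le> min a 1}" by auto
      then show ?thesis using False Bp[of "min a 1"] by (simp add: emeasure_eq_measure)
    qed
  qed
  then show ?thesis by (simp add: b_def mult.assoc)
qed

text \<open>The standard deviation of \<open>uos n k\<close> has \<open>n + 2\<close> in place of the last \<open>n + 1\<close>.\<close>
definition sd :: "nat \<Rightarrow> nat \<Rightarrow> real" where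
  "sd n k = sqrt (real k / (real n + 1) * (1 - real k / (real n + 1)) / (real n + 1))"

lemma sd_pos: "1 \<le> k \<Longrightarrow> k \<le> n \<Longrightarrow> 0 < sd n k"
  unfolding sd_def by (intro real_sqrt_gt_zero divide_pos_pos mult_pos_pos) auto

lemma uos_central_moment:
  assumes k: "1 \<le> k" "k \<le> n"
  shows "integrable M (\<lambda>x. (uos n k x - real k / (real n + 1)) ^ j)"
    and "\<bar>expectation (\<lambda>x. (uos n k x - real k / (real n + 1)) ^ j)\<bar> \<le> moment_const j * sd n k ^ j"
proof -
  define N \<mu> where "N = real n + 1" and "\<mu> = real k / N"
  \<comment> \<open>With this shift the Beta parameters are \<open>Suc k'\<close> and
    \<open>Suc l\<close>, whose sum \<open>N\<close> is \<open>n + 1\<close>.\<close>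
  define k' l where "k' = k - 1" and "l = n - k"
  have N: "N = real (Suc k' + Suc l)" "\<mu> = real (Suc k') / real (Suc k' + Suc l)"
    using k by (auto simp: N_def k'_def l_def \<mu>_def)
  have \<mu>01: "0 < \<mu>" "\<mu> < 1" using k by (auto simp: \<mu>_def N_def)
  have [measurable]: "uos n k \<in> borel_measurable M" by (rule uos_meas[OF k])
  show int: "integrable M (\<lambda>x. (uos n k x - real k / (real n + 1)) ^ j)"
  proof (rule integrable_const_bound[where B=1])
    show "AE x in M. norm ((uos n k x - real k / (real n + 1)) ^ j) \<le> 1"
    proof (rule AE_I2)
      fix x assume "x \<in> space M"
      then have "\<bar>uos n k x - \<mu>\<bar> \<le> 1" using uos_range[OF k, of x] \<mu>01 by auto
      then show "norm ((uos n k x - real k / (real n + 1)) ^ j) \<le> 1"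
        by (simp add: power_abs power_le_one \<mu>_def N_def)
    qed
  qed measurable
  define c where "c = real k * real (n choose k)"
  define I where "I j = (\<integral>x. (x ^ k' * (1 - x) ^ l * (x - \<mu>) ^ j) * indicator {0..1} x \<partial>lborel)" for j
  define m where "m j = expectation (\<lambda>x. (uos n k x - \<mu>) ^ j)" for j
  have mI: "m j = c * I j" for j
  proof -
    have "m j = (\<integral>x. (real k * real (n choose k) * (x ^ (k - 1) * (1 - x) ^ (n - k)) * indicator {0..1} x) * (x - \<mu>) ^ j \<partial>lborel)"
      unfolding m_def by (rule distributed_integral[OF uos_distributed[OF k], symmetric]) (auto simp: indicator_def)
    also have "\<dots> = (\<integral>x. c * ((x ^ k' * (1 - x) ^ l * (x - \<mu>) ^ j) * indicator {0..1} x) \<partial>lborel)"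
      by (intro Bochner_Integration.integral_cong refl) (simp add: c_def k'_def l_def mult_ac)
    finally show ?thesis by (simp add: I_def)
  qed
  have "\<bar>m j\<bar> \<le> moment_const j * sd n k ^ j"
  proof (rule moment_recursion_bound[where N=N and \<mu>=\<mu>])
    show "m 0 = 1" by (simp add: m_def prob_space)
    show "m 1 = 0" using beta_moment_recursion(1)[OF N(2)] by (simp add: mI I_def)
    show "(N + real (Suc i)) * m (Suc (Suc i)) = real (Suc i) * (\<mu> * (1 - \<mu>) * m i + (1 - 2 * \<mu>) * m (Suc i))" for i
      using arg_cong[OF beta_moment_recursion(2)[OF N(2), of i], of "\<lambda>z. c * z"]
      unfolding mI N(1)[symmetric] I_def[symmetric] by (simp add: algebra_simps)
    show "0 < N" "0 \<le> \<mu>" "\<mu> \<le> 1" using \<mu>01 by (auto simp: N_def)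
    have sd2: "(sd n k)\<^sup>2 = \<mu> * (1 - \<mu>) / N"
    proof -
      have "sd n k = sqrt (\<mu> * (1 - \<mu>) / N)" by (simp add: sd_def \<mu>_def N_def)
      moreover have "0 \<le> \<mu> * (1 - \<mu>) / N" using \<mu>01 by (simp add: N_def)
      ultimately show ?thesis by simp
    qed
    then show "\<mu> * (1 - \<mu>) = N * (sd n k)\<^sup>2" by (simp add: N_def)
    have "(2 * (N * sd n k))\<^sup>2 = 4 * ((N * \<mu>) * (1 - \<mu>))"
      unfolding power_mult_distrib sd2 using \<open>0 < N\<close> by (simp add: power2_eq_square)
    also have "\<dots> = 4 * (real k * (1 - \<mu>))" by (simp add: \<mu>_def N_def)
    also have "\<dots> = 4 * real k * (N - real k) / N" by (simp add: \<mu>_def N_def field_simps)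
    finally have eq: "(2 * (N * sd n k))\<^sup>2 = 4 * real k * (N - real k) / N" .
    \<comment> \<open>Expanded, this says that k(n + 1 - k) is at least n. So \<open>sd n k\<close>
      is never below half the grid spacing \<open>1 / N\<close>, as the recursion bound
      requires.\<close>
    have "0 \<le> (real k - 1) * (real n - real k)" using k by (intro mult_nonneg_nonneg) auto
    then have "N \<le> 4 * real k * (N - real k)" using k by (simp add: N_def algebra_simps)
    then have "1 \<le> (2 * (N * sd n k))\<^sup>2" unfolding eq using \<open>0 < N\<close> by simp
    moreover have "0 \<le> 2 * (N * sd n k)" using sd_pos[OF k] by (simp add: N_def)
    ultimately show "1 \<le> 2 * (N * sd n k)" by (metis one_power2 power2_le_imp_le)
  qed
  then show "\<bar>expectation (\<lambda>x. (uos n k x - real k / (real n + 1)) ^ j)\<bar> \<le> moment_const j * sd n k ^ j"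
    by (simp add: m_def \<mu>_def N_def)
qed

lemma uos_abs_moment:
  assumes k: "1 \<le> k" "k \<le> n" and p: "0 \<le> p" "p \<le> real (2 * m)"
  shows "(\<integral>\<^sup>+x. ennreal (\<bar>uos n k x - real k / (real n + 1)\<bar> powr p) \<partial>M) \<le> ennreal ((1 + moment_const (2 * m)) * sd n k powr p)"
proof (rule abs_powr_moment_bound[OF _ _ sd_pos[OF k] p])
  show "(\<lambda>x. uos n k x - real k / (real n + 1)) \<in> borel_measurable M"
    using uos_meas[OF k] by measurable
qed (use uos_central_moment[OF k, of "2 * m"] moment_const_nonneg in auto)

end

subsection \<open>Uniform closeness of order statistics to their means\<close>

text \<open>Each term is at most 2/k - 2/(k+1), which telescopes.\<close>

lemma sum_inverse_square_bound:
  assumes K: "1 \<le> K"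
  shows "(\<Sum>k=K..n. 1 / (real k)\<^sup>2) \<le> 2 / real K"
proof (cases "K \<le> n")
  case True
  have "(\<Sum>k=K..n. 1 / (real k)\<^sup>2) \<le> (\<Sum>k=K..n. 2 / real k - 2 / real (k + 1))"
  proof (rule sum_mono)
    fix k assume "k \<in> {K..n}"
    then have k: "1 \<le> real k" using K by auto
    have "2 / real k - 2 / real (k + 1) = 2 / (real k * (real k + 1))" using k by (simp add: field_simps)
    moreover have "2 / (2 * (real k)\<^sup>2) \<le> 2 / (real k * (real k + 1))"
    proof (rule frac_le)
      show "0 < real k * (real k + 1)" using k by (intro mult_pos_pos) auto
      show "real k * (real k + 1) \<le> 2 * (real k)\<^sup>2" using k by (simp add: power2_eq_square algebra_simps)
    qed auto
    ultimately show "1 / (real k)\<^sup>2 \<le> 2 / real k - 2 / real (k + 1)" by simp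
  qed
  also have "\<dots> = 2 / real K - 2 / real (n + 1)" using True by (subst sum_natinterval_diff) auto
  also have "\<dots> \<le> 2 / real K" by simp
  finally show ?thesis .
qed auto

context iid_uniform
begin

text \<open>Markov's inequality with the fourth power: relative deviations at index \<open>k\<close>
  then have probability of order 1/k^2, which is summable, whereas the variance would give only
  1/k.\<close>

lemma prob_uos_deviation:
  assumes k: "1 \<le> k" "k \<le> n" and d: "0 < d"
  shows "prob {x\<in>space M. d \<le> \<bar>uos n k x - real k / (real n + 1)\<bar>} \<le> moment_const 4 * sd n k ^ 4 / d ^ 4"
proof -
  let ?X = "\<lambda>x. uos n k x - real k / (real n + 1)"
  have eq: "{x\<in>space M. d \<le> \<bar>?X x\<bar>} = {x\<in>space M. ?X x ^ 4 \<ge> d ^ 4}"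
  proof -
    have "d \<le> \<bar>y\<bar> \<longleftrightarrow> d ^ 4 \<le> y ^ 4" for y :: real
    proof -
      have "d ^ 4 \<le> \<bar>y\<bar> ^ 4 \<longleftrightarrow> d \<le> \<bar>y\<bar>" using d by (intro power_mono_iff) auto
      then show ?thesis by (simp add: power_even_abs)
    qed
    then show ?thesis by simp
  qed
  have "prob {x\<in>space M. ?X x ^ 4 \<ge> d ^ 4} \<le> expectation (\<lambda>x. ?X x ^ 4) / d ^ 4"
    by (rule integral_Markov_inequality_measure[where A="{}"]) (use uos_central_moment(1)[OF k, of 4] d in auto)
  also have "\<dots> \<le> moment_const 4 * sd n k ^ 4 / d ^ 4"
    using uos_central_moment(2)[OF k, of 4] d by (intro divide_right_mono) auto
  finally show ?thesis unfolding eq .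
qed

lemma sd_power4: "1 \<le> k \<Longrightarrow> k \<le> n \<Longrightarrow> sd n k ^ 4 = (real k / (real n + 1) * (1 - real k / (real n + 1)) / (real n + 1))\<^sup>2"
proof -
  assume k: "1 \<le> k" "k \<le> n"
  have "0 \<le> real k / (real n + 1) * (1 - real k / (real n + 1)) / (real n + 1)"
    using k by (intro divide_nonneg_nonneg mult_nonneg_nonneg) auto
  then have "(sd n k)\<^sup>2 = real k / (real n + 1) * (1 - real k / (real n + 1)) / (real n + 1)"
    unfolding sd_def by (rule real_sqrt_pow2)
  then show ?thesis by (metis (no_types) power2_eq_square power4_eq_xxxx mult.assoc)
qed

lemma prob_uos_relative_deviation:
  assumes k: "1 \<le> k" "k \<le> n" and c: "0 < c"
  shows "prob {x\<in>space M. c * (real k / (real n + 1)) \<le> \<bar>uos n k x - real k / (real n + 1)\<bar>}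
           \<le> moment_const 4 / c ^ 4 * (1 / (real k)\<^sup>2)" (is "?A \<le> _")
    and "prob {x\<in>space M. c * (1 - real k / (real n + 1)) \<le> \<bar>uos n k x - real k / (real n + 1)\<bar>}
           \<le> moment_const 4 / c ^ 4 * (1 / (real (n + 1 - k))\<^sup>2)" (is "?B \<le> _")
proof -
  define N u where "N = real n + 1" and "u = real k / N"
  have N: "0 < N" by (simp add: N_def)
  have u: "0 < u" "u < 1" "N * u = real k" "N * (1 - u) = real (n + 1 - k)" using k by (auto simp: u_def N_def field_simps)
  have s4: "sd n k ^ 4 = (u * (1 - u) / N)\<^sup>2" using sd_power4[OF k] by (simp add: u_def N_def)
  have "?A \<le> moment_const 4 * sd n k ^ 4 / (c * u) ^ 4"
    using prob_uos_deviation[OF k mult_pos_pos[OF c u(1)]] by (simp only: u_def N_def)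
  also have "\<dots> = moment_const 4 / c ^ 4 * ((1 - u)\<^sup>2 * (1 / (N * u)\<^sup>2))"
    unfolding s4 using c u(1) N by (simp add: power_mult_distrib power_divide power4_eq_xxxx power2_eq_square)
  also have "\<dots> \<le> moment_const 4 / c ^ 4 * (1 * (1 / (N * u)\<^sup>2))"
    using u c moment_const_nonneg by (intro mult_left_mono mult_right_mono) (auto intro: power_le_one)
  finally show "?A \<le> moment_const 4 / c ^ 4 * (1 / (real k)\<^sup>2)" using u by simp
  have "0 < c * (1 - u)" using c u by simp
  then have "?B \<le> moment_const 4 * sd n k ^ 4 / (c * (1 - u)) ^ 4"
    using prob_uos_deviation[OF k, of "c * (1 - u)"] by (simp only: u_def N_def)
  also have "\<dots> = moment_const 4 / c ^ 4 * (u\<^sup>2 * (1 / (N * (1 - u))\<^sup>2))"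
    unfolding s4 using c u(2) N by (simp add: power_mult_distrib power_divide power4_eq_xxxx power2_eq_square)
  also have "\<dots> \<le> moment_const 4 / c ^ 4 * (1 * (1 / (N * (1 - u))\<^sup>2))"
    using u c moment_const_nonneg by (intro mult_left_mono mult_right_mono) (auto intro: power_le_one)
  finally show "?B \<le> moment_const 4 / c ^ 4 * (1 / (real (n + 1 - k))\<^sup>2)" using u by simp
qed

lemma prob_Ex_U_le:
  assumes "0 \<le> t"
  shows "prob {x\<in>space M. \<exists>j\<in>{1..n}. U j x \<le> t} \<le> real n * t"
proof (cases "t \<le> 1")
  case True
  have "prob (\<Union>j\<in>{1..n}. {x\<in>space M. U j x \<le> t}) \<le> (\<Sum>j\<in>{1..n}. prob {x\<in>space M. U j x \<le> t})"
    by (rule finite_measure_subadditive_finite) auto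
  also have "\<dots> = real n * t" using U_cdf[OF assms True] by simp
  also have "(\<Union>j\<in>{1..n}. {x\<in>space M. U j x \<le> t}) = {x\<in>space M. \<exists>j\<in>{1..n}. U j x \<le> t}" by auto
  finally show ?thesis .
next
  case False
  show ?thesis
  proof (cases "n = 0")
    case f: False
    have "1 * 1 \<le> real n * t" using f False by (intro mult_mono) auto
    then show ?thesis using order_trans[OF prob_le_1] by simp
  qed simp
qed

lemma prob_Ex_U_gt:
  assumes "0 \<le> t"
  shows "prob {x\<in>space M. \<exists>j\<in>{1..n}. 1 - t < U j x} \<le> real n * t"
proof (cases "t \<le> 1")
  case True
  have "prob (\<Union>j\<in>{1..n}. {x\<in>space M. 1 - t < U j x}) \<le> (\<Sum>j\<in>{1..n}. prob {x\<in>space M. 1 - t < U j x})"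
    by (rule finite_measure_subadditive_finite) auto
  also have "\<dots> = (\<Sum>j\<in>{1..n}. t)"
  proof (intro sum.cong refl)
    fix j
    have "{x\<in>space M. 1 - t < U j x} = space M - {x\<in>space M. U j x \<le> 1 - t}" by auto
    then show "prob {x\<in>space M. 1 - t < U j x} = t"
      using prob_compl[of "{x\<in>space M. U j x \<le> 1 - t}"] U_cdf[of "1 - t" j] assms True by simp
  qed
  also have "\<dots> = real n * t" by simp
  also have "(\<Union>j\<in>{1..n}. {x\<in>space M. 1 - t < U j x}) = {x\<in>space M. \<exists>j\<in>{1..n}. 1 - t < U j x}" by auto
  finally show ?thesis .
next
  case False
  show ?thesis
  proof (cases "n = 0")
    case f: False
    have "1 * 1 \<le> real n * t" using f False by (intro mult_mono) auto
    then show ?thesis using order_trans[OF prob_le_1] by simp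
  qed simp
qed

text \<open>The exceptional event: off it every order statistic of the sample is close to its mean,
  so the truncation below changes nothing.\<close>

definition far_event :: "real \<Rightarrow> nat \<Rightarrow> 'a set" where
  "far_event L n = {x\<in>space M. \<exists>k\<in>{1..n}. \<not> close_ratio L (real k / (real n + 1)) (uos n k x)}"

lemma far_event_sets[measurable]: "far_event L n \<in> sets M"
proof -
  have "{x\<in>space M. \<not> close_ratio L (real k / (real n + 1)) (uos n k x)} \<in> sets M" if "k \<in> {1..n}" for k
  proof -
    have [measurable]: "uos n k \<in> borel_measurable M" using that by (intro uos_meas) auto
    show ?thesis unfolding close_ratio_def by measurable
  qed
  then have "(\<Union>k\<in>{1..n}. {x\<in>space M. \<not> close_ratio L (real k / (real n + 1)) (uos n k x)}) \<in> sets M" by auto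
  also have "(\<Union>k\<in>{1..n}. {x\<in>space M. \<not> close_ratio L (real k / (real n + 1)) (uos n k x)}) = far_event L n"
    by (auto simp: far_event_def)
  finally show ?thesis .
qed

text \<open>Being too far from an endpoint is a deviation of at least \<open>L - 1\<close> times the
  mean distance, so Markov bounds sum to O((L - 1)^-4). Being too close is a deviation of at most
  the mean distance, however large \<open>L\<close> is: there Markov is used from the
  \<open>K\<close>-th index on, and the extreme indices are handled by the chance that any
  observation at all falls near the endpoint.\<close>

lemma prob_far_event_bound:
  assumes L: "2 \<le> L" and K: "1 \<le> K"
  shows "prob (far_event L n) \<le> 4 * moment_const 4 / (L - 1) ^ 4 + 64 * moment_const 4 / real K + 2 * real K / L"
proof -
  define u where "u k = real k / (real n + 1)" for k
  define A where "A c k = {x\<in>space M. c * u k \<le> \<bar>uos n k x - u k\<bar>}" for c k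
  define B where "B c k = {x\<in>space M. c * (1 - u k) \<le> \<bar>uos n k x - u k\<bar>}" for c k
  \<comment> \<open>An order statistic of index below \<open>K\<close> that is \<open>L\<close>
    times smaller than its mean lies below this level.\<close>
  define t where "t = real K / (L * (real n + 1))"
  define E1 where "E1 = {x\<in>space M. \<exists>j\<in>{1..n}. U j x \<le> t}"
  define E2 where "E2 = {x\<in>space M. \<exists>j\<in>{1..n}. 1 - t < U j x}"
  have u: "0 < u k" "u k < 1" if "k \<in> {1..n}" for k using that by (auto simp: u_def)
  have um: "uos n k \<in> borel_measurable M" if "k \<in> {1..n}" for k using that by (intro uos_meas) auto
  have AB: "A c k \<in> sets M" "B c k \<in> sets M" if "k \<in> {1..n}" for c k
    unfolding A_def B_def using um[OF that] by measurable
  have pA: "prob (A c k) \<le> moment_const 4 / c ^ 4 * (1 / (real k)\<^sup>2)" if "k \<in> {1..n}" "0 < c" for c k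
    using prob_uos_relative_deviation(1)[of k n c] that by (auto simp: A_def u_def)
  have pB: "prob (B c k) \<le> moment_const 4 / c ^ 4 * (1 / (real (n + 1 - k))\<^sup>2)" if "k \<in> {1..n}" "0 < c" for c k
    using prob_uos_relative_deviation(2)[of k n c] that by (auto simp: B_def u_def)
  have E12: "E1 \<in> sets M" "E2 \<in> sets M" unfolding E1_def E2_def by measurable
  have sub: "far_event L n \<subseteq> (\<Union>k\<in>{1..n}. A (L - 1) k) \<union> (\<Union>k\<in>{1..n}. B (L - 1) k)
      \<union> (\<Union>k\<in>{K..n}. A (1/2) k) \<union> (\<Union>k\<in>{1..n+1-K}. B (1/2) k) \<union> E1 \<union> E2"
  proof
    fix x assume "x \<in> far_event L n"
    then obtain k where x: "x \<in> space M" and k: "k \<in> {1..n}" and nc: "\<not> close_ratio L (u k) (uos n k x)"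
      by (auto simp: far_event_def u_def)
    define \<theta> where "\<theta> = uos n k x"
    obtain j where j: "j \<in> {1..n}" "\<theta> = U j x"
      using order_stat_in[of k n "\<lambda>j. U j x"] k by (auto simp: \<theta>_def uos_def)
    consider "L * u k < \<theta>" | "L * (1 - u k) < 1 - \<theta>" | "L * \<theta> < u k" | "L * (1 - \<theta>) < 1 - u k"
      using nc by (auto simp: close_ratio_def \<theta>_def not_le)
    then show "x \<in> (\<Union>k\<in>{1..n}. A (L - 1) k) \<union> (\<Union>k\<in>{1..n}. B (L - 1) k)
      \<union> (\<Union>k\<in>{K..n}. A (1/2) k) \<union> (\<Union>k\<in>{1..n+1-K}. B (1/2) k) \<union> E1 \<union> E2"
    proof cases
      case 1
      then have "x \<in> A (L - 1) k" using x by (simp add: A_def \<theta>_def algebra_simps)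
      then show ?thesis using k by blast
    next
      case 2
      then have "x \<in> B (L - 1) k" using x by (simp add: B_def \<theta>_def algebra_simps)
      then show ?thesis using k by blast
    next
      case 3
      have "0 < \<theta>" using uos_range[of k n x] k x by (auto simp: \<theta>_def)
      show ?thesis
      \<comment> \<open>Beyond \<open>K\<close> it is enough that \<theta> is below half its mean;
        before \<open>K\<close> the observation itself is below \<open>t\<close>.\<close>
      proof (cases "K \<le> k")
        case True
        have "2 * \<theta> \<le> L * \<theta>" using L \<open>0 < \<theta>\<close> by (intro mult_right_mono) auto
        then have "2 * \<theta> < u k" using 3 by linarith
        then have "u k \<le> 2 * \<bar>\<theta> - u k\<bar>" using \<open>0 < \<theta>\<close> by (simp add: abs_if)
        then have "x \<in> A (1/2) k" using x by (simp add: A_def \<theta>_def)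
        then show ?thesis using k True by auto
      next
        case False
        have "u k < real K / (real n + 1)" using False by (simp add: u_def divide_strict_right_mono)
        then have "L * \<theta> < real K / (real n + 1)" using 3 by linarith
        then have "\<theta> \<le> real K / (real n + 1) / L" using L by (subst pos_le_divide_eq) (auto simp: mult.commute)
        then have "\<theta> \<le> t" by (simp add: t_def mult.commute)
        then have "x \<in> E1" using x j by (auto simp: E1_def)
        then show ?thesis by blast
      qed
    next
      case 4
      have "\<theta> < 1" using uos_range[of k n x] k x by (auto simp: \<theta>_def)
      show ?thesis
      proof (cases "k \<le> n + 1 - K")
        case True
        have "2 * (1 - \<theta>) \<le> L * (1 - \<theta>)" using L \<open>\<theta> < 1\<close> by (intro mult_right_mono) auto
        then have "2 * (1 - \<theta>) < 1 - u k" using 4 by linarith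
        then have "1 - u k \<le> 2 * \<bar>\<theta> - u k\<bar>" using \<open>\<theta> < 1\<close> by (simp add: abs_if)
        then have "x \<in> B (1/2) k" using x by (simp add: B_def \<theta>_def)
        then show ?thesis using k True by auto
      next
        case False
        have "1 - u k < real K / (real n + 1)"
        proof -
          have "1 - u k = (real n + 1 - real k) / (real n + 1)" by (simp add: u_def field_simps)
          also have "\<dots> < real K / (real n + 1)" using False k by (intro divide_strict_right_mono) auto
          finally show ?thesis .
        qed
        then have "L * (1 - \<theta>) < real K / (real n + 1)" using 4 by linarith
        then have "1 - \<theta> < real K / (real n + 1) / L" using L by (subst pos_less_divide_eq) (simp, simp only: mult.commute)
        then have "1 - \<theta> < t" by (simp add: t_def mult.commute)
        then have "1 - t < U j x" using j(2) by linarith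
        then have "x \<in> E2" using x j(1) by (auto simp: E2_def)
        then show ?thesis by blast
      qed
    qed
  qed
  have m4: "0 \<le> moment_const 4 / c ^ 4" if "0 < c" for c using that moment_const_nonneg[of 4] by simp
  have sA: "prob (\<Union>k\<in>{K'..n}. A c k) \<le> moment_const 4 / c ^ 4 * (2 / real K')" if "0 < c" "1 \<le> K'" for c K'
  proof -
    have "prob (\<Union>k\<in>{K'..n}. A c k) \<le> (\<Sum>k\<in>{K'..n}. prob (A c k))"
      by (rule finite_measure_subadditive_finite) (use AB that in auto)
    also have "\<dots> \<le> (\<Sum>k\<in>{K'..n}. moment_const 4 / c ^ 4 * (1 / (real k)\<^sup>2))"
      by (rule sum_mono, rule pA) (use that in auto)
    also have "\<dots> = moment_const 4 / c ^ 4 * (\<Sum>k=K'..n. 1 / (real k)\<^sup>2)" by (simp add: sum_distrib_left)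
    also have "\<dots> \<le> moment_const 4 / c ^ 4 * (2 / real K')"
      by (intro mult_left_mono sum_inverse_square_bound m4 that)
    finally show ?thesis .
  qed
  have sB: "prob (\<Union>k\<in>{1..n+1-K'}. B c k) \<le> moment_const 4 / c ^ 4 * (2 / real K')" if "0 < c" "1 \<le> K'" for c K'
  proof -
    have "prob (\<Union>k\<in>{1..n+1-K'}. B c k) \<le> (\<Sum>k\<in>{1..n+1-K'}. prob (B c k))"
      by (rule finite_measure_subadditive_finite) (use AB that in auto)
    also have "\<dots> \<le> (\<Sum>k\<in>{1..n+1-K'}. moment_const 4 / c ^ 4 * (1 / (real (n + 1 - k))\<^sup>2))"
      by (rule sum_mono, rule pB) (use that in auto)
    also have "\<dots> = (\<Sum>k\<in>{K'..n}. moment_const 4 / c ^ 4 * (1 / (real k)\<^sup>2))"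
      by (rule sum.reindex_bij_witness[where i="\<lambda>k. n + 1 - k" and j="\<lambda>k. n + 1 - k"]) (use that in auto)
    also have "\<dots> = moment_const 4 / c ^ 4 * (\<Sum>k=K'..n. 1 / (real k)\<^sup>2)" by (simp add: sum_distrib_left)
    also have "\<dots> \<le> moment_const 4 / c ^ 4 * (2 / real K')"
      by (intro mult_left_mono sum_inverse_square_bound m4 that)
    finally show ?thesis .
  qed
  have nt: "real n * t \<le> real K / L"
  proof -
    have "real n * t = real K / L * (real n / (real n + 1))" by (simp add: t_def)
    also have "\<dots> \<le> real K / L * 1" using L by (intro mult_left_mono) auto
    finally show ?thesis by simp
  qed
  have t0: "0 \<le> t" using L by (simp add: t_def)
  have Us: "(\<Union>k\<in>{1..n}. A (L - 1) k) \<in> sets M" "(\<Union>k\<in>{1..n}. B (L - 1) k) \<in> sets M"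
     "(\<Union>k\<in>{K..n}. A (1/2) k) \<in> sets M" "(\<Union>k\<in>{1..n+1-K}. B (1/2) k) \<in> sets M"
    by (intro sets.finite_UN AB; use K in auto)+
  have "prob (far_event L n) \<le> prob ((\<Union>k\<in>{1..n}. A (L - 1) k) \<union> (\<Union>k\<in>{1..n}. B (L - 1) k)
      \<union> (\<Union>k\<in>{K..n}. A (1/2) k) \<union> (\<Union>k\<in>{1..n+1-K}. B (1/2) k) \<union> E1 \<union> E2)"
    by (rule finite_measure_mono[OF sub]) (use Us E12 in auto)
  also have "\<dots> \<le> prob (\<Union>k\<in>{1..n}. A (L - 1) k) + prob (\<Union>k\<in>{1..n}. B (L - 1) k)
      + prob (\<Union>k\<in>{K..n}. A (1/2) k) + prob (\<Union>k\<in>{1..n+1-K}. B (1/2) k) + prob E1 + prob E2"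
    by (intro order_trans[OF measure_Un_le] add_mono order_refl sets.Un Us E12)
  also have "\<dots> \<le> moment_const 4 / (L - 1) ^ 4 * (2 / real 1) + moment_const 4 / (L - 1) ^ 4 * (2 / real 1)
      + moment_const 4 / (1/2) ^ 4 * (2 / real K) + moment_const 4 / (1/2) ^ 4 * (2 / real K) + real K / L + real K / L"
    using sA[of "L - 1" 1] sB[of "L - 1" 1] sA[of "1/2" K] sB[of "1/2" K] L K
      order_trans[OF prob_Ex_U_le[OF t0, of n] nt] order_trans[OF prob_Ex_U_gt[OF t0, of n] nt]
    unfolding E1_def E2_def by (intro add_mono) auto
  also have "\<dots> = 4 * moment_const 4 / (L - 1) ^ 4 + 64 * moment_const 4 / real K + 2 * real K / L"
    by (simp add: power_divide field_simps)
  finally show ?thesis .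
qed

text \<open>\<open>K\<close> is chosen before \<open>L\<close>, since the last term of the bound
  asks for \<open>L\<close> large compared with \<open>K\<close>.\<close>

lemma prob_far_event_small:
  assumes e: "0 < e"
  shows "\<exists>L\<ge>2. \<forall>n. prob (far_event L n) \<le> e"
proof -
  define C where "C = moment_const 4"
  have C: "0 \<le> C" by (simp add: C_def moment_const_nonneg)
  have "(\<lambda>K::nat. 64 * C / real K) \<longlonglongrightarrow> 0" by real_asymp
  then have "eventually (\<lambda>K::nat. 64 * C / real K < e / 3) sequentially"
    using e by (intro order_tendstoD) auto
  moreover have "eventually (\<lambda>K::nat. 1 \<le> K) sequentially" by (rule eventually_ge_at_top)
  ultimately have "eventually (\<lambda>K::nat. 64 * C / real K < e / 3 \<and> 1 \<le> K) sequentially" by eventually_elim auto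
  then obtain K :: nat where K: "64 * C / real K < e / 3" "1 \<le> K"
    using eventually_happens'[OF sequentially_bot] by blast
  have "((\<lambda>L::real. 4 * C / (L - 1) ^ 4) \<longlongrightarrow> 0) at_top" by real_asymp
  then have "eventually (\<lambda>L. 4 * C / (L - 1) ^ 4 < e / 3) at_top" using e by (intro order_tendstoD) auto
  moreover have "((\<lambda>L::real. 2 * real K / L) \<longlongrightarrow> 0) at_top" by real_asymp
  then have "eventually (\<lambda>L. 2 * real K / L < e / 3) at_top" using e by (intro order_tendstoD) auto
  moreover have "eventually (\<lambda>L::real. 2 \<le> L) at_top" by (rule eventually_ge_at_top)
  ultimately have "eventually (\<lambda>L. 4 * C / (L - 1) ^ 4 < e / 3 \<and> 2 * real K / L < e / 3 \<and> 2 \<le> L) at_top"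
    by eventually_elim auto
  then obtain L :: real where L: "4 * C / (L - 1) ^ 4 < e / 3" "2 * real K / L < e / 3" "2 \<le> L"
    using eventually_happens'[OF trivial_limit_at_top_linorder] by blast
  have "prob (far_event L n) \<le> e" for n
    using prob_far_event_bound[OF L(3) K(2), of n] K L unfolding C_def by linarith
  then show ?thesis using L by blast
qed

end

subsection \<open>The Bahadur representation\<close>

context iid_uniform
begin

lemma U_expectation_indicator:
  assumes "0 \<le> t" "t \<le> 1"
  shows "expectation (\<lambda>x. indicator {..t} (U j x)) = t"
proof -
  have "expectation (\<lambda>x. indicator {..t} (U j x)) = expectation (indicator {x\<in>space M. U j x \<le> t})"
    by (intro Bochner_Integration.integral_cong refl) (auto simp: indicator_def)
  also have "\<dots> = prob {x\<in>space M. U j x \<le> t}" by simp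
  finally show ?thesis using U_cdf[OF assms] by simp
qed

definition xi :: "nat \<Rightarrow> real \<Rightarrow> 'a \<Rightarrow> real" where
  "xi j t x = t - indicator {..t} (U j x)"

lemma xi_meas[measurable]: "xi j t \<in> borel_measurable M"
  unfolding xi_def[abs_def] by measurable

lemma xi_bound: "0 \<le> t \<Longrightarrow> t \<le> 1 \<Longrightarrow> \<bar>xi j t x\<bar> \<le> 1"
  by (auto simp: xi_def indicator_def)

lemma xi_mean: "0 \<le> t \<Longrightarrow> t \<le> 1 \<Longrightarrow> expectation (xi j t) = 0"
proof -
  assume t: "0 \<le> t" "t \<le> 1"
  have "integrable M (\<lambda>x. indicator {..t} (U j x) :: real)"
    by (rule integrable_const_bound[where B=1]) (auto simp: indicator_def)
  then show ?thesis unfolding xi_def[abs_def]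
    by (subst Bochner_Integration.integral_diff) (auto simp: U_expectation_indicator[OF t] prob_space)
qed

text \<open>The product of two indicators of half-lines is the indicator of the smaller one. The
  outcome is the covariance of the Brownian bridge.\<close>

lemma xi_covariance:
  assumes "0 \<le> s" "s \<le> 1" "0 \<le> t" "t \<le> 1"
  shows "expectation (\<lambda>x. xi j s x * xi j t x) = min s t - s * t"
proof -
  have i: "integrable M (\<lambda>x. indicator {..r} (U j x) :: real)" for r
    by (rule integrable_const_bound[where B=1]) (auto simp: indicator_def)
  have "expectation (\<lambda>x. xi j s x * xi j t x)
     = expectation (\<lambda>x. s * t - s * indicator {..t} (U j x) - t * indicator {..s} (U j x) + indicator {..min s t} (U j x))"
    by (intro Bochner_Integration.integral_cong refl) (auto simp: xi_def indicator_def algebra_simps)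
  also have "\<dots> = s * t - s * expectation (\<lambda>x. indicator {..t} (U j x)) - t * expectation (\<lambda>x. indicator {..s} (U j x))
      + expectation (\<lambda>x. indicator {..min s t} (U j x))"
    using i by (simp add: prob_space)
  also have "\<dots> = min s t - s * t"
    using assms by (simp add: U_expectation_indicator)
  finally show ?thesis .
qed

lemma sum_second_moment:
  fixes g :: "real \<Rightarrow> real"
  assumes g: "g \<in> borel_measurable borel" and b: "\<And>y. \<bar>g y\<bar> \<le> B"
    and mean: "\<And>j. expectation (\<lambda>x. g (U j x)) = 0" and J: "finite J"
  shows "expectation (\<lambda>x. (\<Sum>j\<in>J. g (U j x))\<^sup>2) = (\<Sum>j\<in>J. expectation (\<lambda>x. (g (U j x))\<^sup>2))"
proof -
  have B: "0 \<le> B" using b[of 0] by simp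
  have m[measurable]: "(\<lambda>x. g (U j x)) \<in> borel_measurable M" for j using measurable_compose[OF U_meas g] .
  have i1: "integrable M (\<lambda>x. g (U j x))" for j
    by (rule integrable_const_bound[where B=B]) (use b in auto)
  have i2: "integrable M (\<lambda>x. g (U i x) * g (U j x))" for i j
    by (rule integrable_const_bound[where B="B * B"]) (use b B in \<open>auto simp: abs_mult intro!: mult_mono\<close>)
  have cross: "expectation (\<lambda>x. g (U i x) * g (U j x)) = (if i = j then expectation (\<lambda>x. (g (U i x))\<^sup>2) else 0)" for i j
  proof (cases "i = j")
    case False
    have ind: "indep_vars (\<lambda>_. borel) (\<lambda>k x. g (U k x)) {i, j}"
      by (rule indep_vars_compose2[OF indep_vars_subset[OF indep]]) (use g in auto)
    have "expectation (\<lambda>x. \<Prod>k\<in>{i, j}. g (U k x)) = (\<Prod>k\<in>{i, j}. expectation (\<lambda>x. g (U k x)))"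
      by (rule indep_vars_lebesgue_integral[OF _ ind i1]) simp
    then show ?thesis using False by (simp add: mean)
  qed (simp add: power2_eq_square)
  have "expectation (\<lambda>x. (\<Sum>j\<in>J. g (U j x))\<^sup>2) = expectation (\<lambda>x. \<Sum>i\<in>J. \<Sum>j\<in>J. g (U i x) * g (U j x))"
    by (simp add: power2_eq_square sum_product)
  also have "\<dots> = (\<Sum>i\<in>J. \<Sum>j\<in>J. expectation (\<lambda>x. g (U i x) * g (U j x)))"
    using i2 by (simp add: Bochner_Integration.integral_sum Bochner_Integration.integrable_sum)
  also have "\<dots> = (\<Sum>j\<in>J. expectation (\<lambda>x. (g (U j x))\<^sup>2))"
    unfolding cross using J by simp
  finally show ?thesis .
qed

text \<open>The sign is opposite to that of the usual uniform empirical process, so that \<open>W n t\<close>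
  approximates the normalised order statistic.\<close>
definition W :: "nat \<Rightarrow> real \<Rightarrow> 'a \<Rightarrow> real" where
  "W n t x = (\<Sum>j\<in>{1..n}. xi j t x) / sqrt (real n)"

lemma W_meas[measurable]: "W n t \<in> borel_measurable M"
  unfolding W_def[abs_def] by measurable

lemma W_alt: "1 \<le> n \<Longrightarrow> W n t x = sqrt (real n) * t - real (card {j\<in>{1..n}. U j x \<le> t}) / sqrt (real n)"
proof -
  assume n: "1 \<le> n"
  have "(\<Sum>j\<in>{1..n}. xi j t x) = real n * t - (\<Sum>j\<in>{1..n}. if U j x \<le> t then 1 else 0)"
    by (simp add: xi_def sum_subtractf indicator_def of_bool_def)
  also have "(\<Sum>j\<in>{1..n}. if U j x \<le> t then 1 else 0 :: real) = real (card {j\<in>{1..n}. U j x \<le> t})"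
    by (subst sum.inter_filter[symmetric]) auto
  finally have eq: "(\<Sum>j\<in>{1..n}. xi j t x) = real n * t - real (card {j\<in>{1..n}. U j x \<le> t})" .
  have "real n * t / sqrt (real n) = sqrt (real n) * t"
    by (metis times_divide_eq_left real_div_sqrt of_nat_0_le_iff)
  then show ?thesis unfolding W_def eq by (simp only: diff_divide_distrib)
qed

text \<open>By independence the second moment is that of a single summand, which equals |s - t| - (s
  - t)^2. Increments over distances of order 1/sqrt n are therefore negligible.\<close>

lemma W_increment_second_moment:
  assumes "0 \<le> s" "s \<le> 1" "0 \<le> t" "t \<le> 1" "1 \<le> n"
  shows "integrable M (\<lambda>x. (W n s x - W n t x)\<^sup>2)" and "expectation (\<lambda>x. (W n s x - W n t x)\<^sup>2) \<le> \<bar>s - t\<bar>"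
proof -
  define g where "g y = (s - indicator {..s} y) - (t - indicator {..t} y)" for y :: real
  have g: "g \<in> borel_measurable borel" unfolding g_def[abs_def] by measurable
  have b: "\<bar>g y\<bar> \<le> 2" for y using assms by (auto simp: g_def indicator_def)
  have gx: "g (U j x) = xi j s x - xi j t x" for j x by (simp add: g_def xi_def)
  have ix: "integrable M (xi j r)" if "0 \<le> r" "r \<le> 1" for j r
    by (rule integrable_const_bound[where B=1]) (use xi_bound that in auto)
  have ixx: "integrable M (\<lambda>x. xi j r x * xi j q x)" if "0 \<le> r" "r \<le> 1" "0 \<le> q" "q \<le> 1" for j r q
    by (rule integrable_const_bound[where B=1]) (use xi_bound that in \<open>auto simp: abs_mult intro!: mult_le_one\<close>)
  have mean: "expectation (\<lambda>x. g (U j x)) = 0" for j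
    unfolding gx using assms by (subst Bochner_Integration.integral_diff) (auto intro: ix simp: xi_mean)
  have var: "expectation (\<lambda>x. (g (U j x))\<^sup>2) \<le> \<bar>s - t\<bar>" for j
  proof -
    have "expectation (\<lambda>x. (g (U j x))\<^sup>2) = expectation (\<lambda>x. xi j s x * xi j s x - 2 * (xi j s x * xi j t x) + xi j t x * xi j t x)"
      unfolding gx by (intro Bochner_Integration.integral_cong refl) (simp add: power2_eq_square algebra_simps)
    also have "\<dots> = (min s s - s * s) - 2 * (min s t - s * t) + (min t t - t * t)"
      using assms ixx by (simp add: xi_covariance)
    also have "\<dots> = \<bar>s - t\<bar> - (s - t)\<^sup>2" by (auto simp: power2_eq_square algebra_simps min_def abs_if)
    also have "\<dots> \<le> \<bar>s - t\<bar>" by simp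
    finally show ?thesis .
  qed
  have W_eq: "(W n s x - W n t x)\<^sup>2 = (\<Sum>j\<in>{1..n}. g (U j x))\<^sup>2 / real n" for x
    by (simp add: W_def gx sum_subtractf diff_divide_distrib[symmetric] power_divide)
  have m[measurable]: "(\<lambda>x. g (U j x)) \<in> borel_measurable M" for j using measurable_compose[OF U_meas g] .
  show "integrable M (\<lambda>x. (W n s x - W n t x)\<^sup>2)"
  proof (rule integrable_const_bound[where B="(2 * real n)\<^sup>2 / real n"])
    have "\<bar>\<Sum>j\<in>{1..n}. g (U j x)\<bar> \<le> (\<Sum>j\<in>{1..n}. 2)" for x
      by (rule order_trans[OF sum_abs]) (intro sum_mono b)
    then have "\<bar>\<Sum>j\<in>{1..n}. g (U j x)\<bar> \<le> \<bar>2 * real n\<bar>" for x by (simp add: mult.commute)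
    then have "(\<Sum>j\<in>{1..n}. g (U j x))\<^sup>2 \<le> (2 * real n)\<^sup>2" for x by (simp only: abs_le_square_iff)
    then show "AE x in M. norm ((W n s x - W n t x)\<^sup>2) \<le> (2 * real n)\<^sup>2 / real n"
      unfolding W_eq by (intro AE_I2) (simp add: divide_right_mono)
  qed measurable
  have "expectation (\<lambda>x. (W n s x - W n t x)\<^sup>2) = expectation (\<lambda>x. (\<Sum>j\<in>{1..n}. g (U j x))\<^sup>2) / real n"
    unfolding W_eq by simp
  also have "\<dots> = (\<Sum>j\<in>{1..n}. expectation (\<lambda>x. (g (U j x))\<^sup>2)) / real n"
    by (subst sum_second_moment[OF g b mean]) auto
  also have "\<dots> \<le> (\<Sum>j\<in>{1..n}. \<bar>s - t\<bar>) / real n" by (intro divide_right_mono sum_mono var) simp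
  also have "\<dots> = \<bar>s - t\<bar>" using assms by simp
  finally show "expectation (\<lambda>x. (W n s x - W n t x)\<^sup>2) \<le> \<bar>s - t\<bar>" .
qed

text \<open>If the increments of \<open>W\<close> over a grid of mesh $e/\sqrt n$ around \<open>t\<close> are at most \<open>e\<close>, then
  comparing the counts at the two grid points next to the order statistic locates it up to
  $O(e/\sqrt n)$.\<close>
lemma bahadur_pointwise:
  assumes n: "1 \<le> n" and k: "1 \<le> k" "k \<le> n" and e: "0 < e" and x: "x \<in> space M"
    and grid: "\<And>i. i \<in> {- I..I} \<Longrightarrow> \<bar>W n (t + of_int i * (e / sqrt (real n))) x - W n t x\<bar> \<le> e"
    and I: "\<bar>sqrt (real n) * (uos n k x - t)\<bar> + e \<le> of_int I * e"
  shows "\<bar>sqrt (real n) * (uos n k x - real k / (real n + 1)) - W n t x\<bar> \<le> 2 * e + 1 / sqrt (real n)"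
proof -
  define \<theta> where "\<theta> = uos n k x"
  define h where "h = e / sqrt (real n)"
  \<comment> \<open>The grid cell containing \<theta> is open on the left and closed on the right,
    which matches the two count inequalities obtained from the duality.\<close>
  define i where "i = \<lceil>(\<theta> - t) / h\<rceil> - 1"
  have sn: "0 < sqrt (real n)" using n by simp
  have h: "0 < h" "sqrt (real n) * h = e" using e sn by (auto simp: h_def)
  have i1: "t + of_int i * h < \<theta>" "\<theta> \<le> t + of_int (i + 1) * h"
  proof -
    have "of_int i < (\<theta> - t) / h" "(\<theta> - t) / h \<le> of_int (i + 1)"
      unfolding i_def by linarith+
    then show "t + of_int i * h < \<theta>" "\<theta> \<le> t + of_int (i + 1) * h"
      using h by (auto simp: field_simps)
  qed
  have "\<bar>(\<theta> - t) / h\<bar> + 1 \<le> of_int I"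
  proof -
    have "(\<theta> - t) / h = sqrt (real n) * (\<theta> - t) / e" by (simp add: h_def)
    then have "\<bar>(\<theta> - t) / h\<bar> = \<bar>sqrt (real n) * (\<theta> - t)\<bar> / e" using e by simp
    then have "(\<bar>(\<theta> - t) / h\<bar> + 1) * e = \<bar>sqrt (real n) * (uos n k x - t)\<bar> + e"
      unfolding \<theta>_def using e by (simp add: distrib_right)
    then show ?thesis using I e by (metis mult_le_cancel_right_pos)
  qed
  then have iI: "i \<in> {- I..I}" "i + 1 \<in> {- I..I}"
    unfolding i_def by (simp_all, linarith+)
  have cnt1: "real (card {j\<in>{1..n}. U j x \<le> t + of_int i * h}) \<le> real k"
    using order_stat_le_iff[OF k, of "\<lambda>j. U j x" "t + of_int i * h"] i1(1) by (auto simp: \<theta>_def uos_def)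
  have cnt2: "real k \<le> real (card {j\<in>{1..n}. U j x \<le> t + of_int (i + 1) * h})"
    using order_stat_le_iff[OF k, of "\<lambda>j. U j x" "t + of_int (i + 1) * h"] i1(2) by (auto simp: \<theta>_def uos_def)
  have g1: "\<bar>W n (t + of_int i * h) x - W n t x\<bar> \<le> e" "\<bar>W n (t + of_int (i + 1) * h) x - W n t x\<bar> \<le> e"
    using grid[OF iI(1)] grid[OF iI(2)] by (simp_all add: h_def)
  have Wi: "sqrt (real n) * (t + of_int i * h) - real k / sqrt (real n) \<le> W n (t + of_int i * h) x"
    unfolding W_alt[OF n] using cnt1 sn by (intro diff_left_mono divide_right_mono) auto
  have Wi1: "W n (t + of_int (i + 1) * h) x \<le> sqrt (real n) * (t + of_int (i + 1) * h) - real k / sqrt (real n)"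
    unfolding W_alt[OF n] using cnt2 sn by (intro diff_left_mono divide_right_mono) auto
  have s1: "sqrt (real n) * \<theta> - e \<le> sqrt (real n) * (t + of_int i * h)"
  proof -
    have "sqrt (real n) * \<theta> \<le> sqrt (real n) * (t + of_int (i + 1) * h)" using i1(2) sn by (intro mult_left_mono) auto
    also have "\<dots> = sqrt (real n) * (t + of_int i * h) + e" using h(2) by (simp add: algebra_simps)
    finally show ?thesis by simp
  qed
  have s2: "sqrt (real n) * (t + of_int (i + 1) * h) \<le> sqrt (real n) * \<theta> + e"
  proof -
    have "sqrt (real n) * (t + of_int (i + 1) * h) = sqrt (real n) * (t + of_int i * h) + e" using h(2) by (simp add: algebra_simps)
    also have "sqrt (real n) * (t + of_int i * h) \<le> sqrt (real n) * \<theta>" using i1(1) sn by (intro mult_left_mono) auto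
    finally show ?thesis by simp
  qed
  \<comment> \<open>The empirical process compares with k/n, the statistic with k/(n + 1); the
    discrepancy costs at most 1/sqrt n.\<close>
  have c: "sqrt (real n) * (\<theta> - real k / (real n + 1)) = sqrt (real n) * \<theta> - real k / sqrt (real n) + real k / (sqrt (real n) * (real n + 1))"
  proof -
    have "sqrt (real n) * (real k / (real n + 1)) = real k / sqrt (real n) - real k / (sqrt (real n) * (real n + 1))"
    proof -
      have "sqrt (real n) * (sqrt (real n) * (real k / (real n + 1))) = real n * (real k / (real n + 1))"
        by (simp add: mult.assoc[symmetric])
      also have "\<dots> = real k - real k / (real n + 1)" by (simp add: field_simps)
      finally have "sqrt (real n) * (real k / (real n + 1)) = (real k - real k / (real n + 1)) / sqrt (real n)"
        using sn by (metis less_irrefl nonzero_mult_div_cancel_left)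
      then show ?thesis by (simp add: diff_divide_distrib mult.commute)
    qed
    then show ?thesis by (simp add: algebra_simps)
  qed
  have "real k / (sqrt (real n) * (real n + 1)) \<le> (real n + 1) / (sqrt (real n) * (real n + 1))"
    using k sn by (intro divide_right_mono) auto
  also have "\<dots> = 1 / sqrt (real n)" by (rule nonzero_divide_mult_cancel_right) simp
  finally have d: "real k / (sqrt (real n) * (real n + 1)) \<le> 1 / sqrt (real n)" .
  have d': "0 \<le> real k / (sqrt (real n) * (real n + 1))" using sn by simp
  show ?thesis using g1 Wi Wi1 s1 s2 d d' unfolding c[unfolded \<theta>_def] \<theta>_def by (simp only: abs_le_iff) linarith
qed

end

text \<open>Convergence to 0 in probability, measured by the expectation of min(1,|X|). This
  quantity is subadditive and bounds differences of characteristic functions directly.\<close>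

definition prob_null :: "'a measure \<Rightarrow> (nat \<Rightarrow> 'a \<Rightarrow> real) \<Rightarrow> bool" where
  "prob_null M X \<longleftrightarrow> (\<forall>n. X n \<in> borel_measurable M) \<and> (\<lambda>n. \<integral>x. min 1 \<bar>X n x\<bar> \<partial>M) \<longlonglongrightarrow> 0"

context prob_space
begin

lemma integrable_min_1: "X \<in> borel_measurable M \<Longrightarrow> integrable M (\<lambda>x. min 1 \<bar>X x\<bar> :: real)"
  by (rule integrable_const_bound[where B=1]) auto

lemma expectation_min_1_nonneg: "0 \<le> expectation (\<lambda>x. min 1 \<bar>X x\<bar> :: real)"
  by (rule Bochner_Integration.integral_nonneg) simp

lemma prob_nullI:
  assumes X: "\<And>n. X n \<in> borel_measurable M"
    and e: "\<And>e. 0 < e \<Longrightarrow> eventually (\<lambda>n. expectation (\<lambda>x. min 1 \<bar>X n x\<bar>) \<le> e) sequentially"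
  shows "prob_null M X"
  unfolding prob_null_def
proof (intro conjI allI X tendstoI)
  fix r :: real assume "0 < r"
  then have "eventually (\<lambda>n. expectation (\<lambda>x. min 1 \<bar>X n x\<bar>) \<le> r / 2) sequentially" by (intro e) simp
  then show "eventually (\<lambda>n. dist (expectation (\<lambda>x. min 1 \<bar>X n x\<bar>)) 0 < r) sequentially"
  proof eventually_elim
    case (elim n)
    then show ?case using \<open>0 < r\<close> expectation_min_1_nonneg[of "X n"] by (simp add: dist_real_def)
  qed
qed

lemma expectation_min_1_le:
  assumes X: "X \<in> borel_measurable M" and A: "A \<in> sets M" and c: "0 \<le> c"
    and le: "\<And>x. x \<in> space M \<Longrightarrow> x \<notin> A \<Longrightarrow> \<bar>X x\<bar> \<le> c"
  shows "expectation (\<lambda>x. min 1 \<bar>X x\<bar> :: real) \<le> c + prob A"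
proof -
  have "expectation (\<lambda>x. min 1 \<bar>X x\<bar>) \<le> expectation (\<lambda>x. c + indicator A x)"
  proof (rule integral_mono)
    show "integrable M (\<lambda>x. c + indicator A x :: real)" using A by (intro Bochner_Integration.integrable_add integrable_real_indicator) (auto simp: emeasure_eq_measure)
    fix x assume "x \<in> space M"
    then show "min 1 \<bar>X x\<bar> \<le> c + indicator A x" using le[of x] c by (cases "x \<in> A") auto
  qed (rule integrable_min_1[OF X])
  also have "\<dots> = c + prob A" using A by (subst Bochner_Integration.integral_add) (auto simp: prob_space emeasure_eq_measure)
  finally show ?thesis .
qed

lemma prob_null_sum:
  assumes "finite J" "\<And>u. u \<in> J \<Longrightarrow> prob_null M (\<lambda>n. X n u)"
  shows "prob_null M (\<lambda>n x. \<Sum>u\<in>J. c u * X n u x)"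
proof -
  have Xm: "\<And>u n. u \<in> J \<Longrightarrow> X n u \<in> borel_measurable M"
    and lim: "\<And>u. u \<in> J \<Longrightarrow> (\<lambda>n. expectation (\<lambda>x. min 1 \<bar>X n u x\<bar>)) \<longlonglongrightarrow> 0"
    using assms(2) by (auto simp: prob_null_def)
  have m: "(\<lambda>x. \<Sum>u\<in>J. c u * X n u x) \<in> borel_measurable M" for n
    by (intro borel_measurable_sum borel_measurable_times borel_measurable_const Xm)
  \<comment> \<open>The factor is \<open>1 + \<bar>c u\<bar>\<close> and not
    \<open>\<bar>c u\<bar>\<close>: when |X| exceeds 1 and the coefficient is small, the left side
    is still only known to be at most 1.\<close>
  have le: "min 1 \<bar>\<Sum>u\<in>J. c u * X n u x\<bar> \<le> (\<Sum>u\<in>J. (1 + \<bar>c u\<bar>) * min 1 \<bar>X n u x\<bar>)" for n x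
    using assms(1)
  proof (induction J rule: finite_induct)
    case (insert u J)
    have "min 1 \<bar>c u * X n u x\<bar> \<le> (1 + \<bar>c u\<bar>) * min 1 \<bar>X n u x\<bar>"
    proof (cases "\<bar>X n u x\<bar> \<le> 1")
      case True
      have "\<bar>c u * X n u x\<bar> \<le> (1 + \<bar>c u\<bar>) * \<bar>X n u x\<bar>" unfolding abs_mult by (intro mult_right_mono) auto
      then show ?thesis using True by simp
    qed simp
    then show ?case using insert by simp linarith
  qed simp
  have int: "integrable M (\<lambda>x. \<Sum>u\<in>J. (1 + \<bar>c u\<bar>) * min 1 \<bar>X n u x\<bar>)" for n
    by (intro Bochner_Integration.integrable_sum integrable_mult_right integrable_min_1 Xm)
  have "(\<lambda>n. \<Sum>u\<in>J. (1 + \<bar>c u\<bar>) * expectation (\<lambda>x. min 1 \<bar>X n u x\<bar>)) \<longlonglongrightarrow> (\<Sum>u\<in>J. (1 + \<bar>c u\<bar>) * 0)"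
    by (intro tendsto_sum tendsto_mult_left lim)
  then have up: "(\<lambda>n. \<Sum>u\<in>J. (1 + \<bar>c u\<bar>) * expectation (\<lambda>x. min 1 \<bar>X n u x\<bar>)) \<longlonglongrightarrow> 0" by simp
  have "expectation (\<lambda>x. min 1 \<bar>\<Sum>u\<in>J. c u * X n u x\<bar>) \<le> (\<Sum>u\<in>J. (1 + \<bar>c u\<bar>) * expectation (\<lambda>x. min 1 \<bar>X n u x\<bar>))" for n
  proof -
    have "expectation (\<lambda>x. min 1 \<bar>\<Sum>u\<in>J. c u * X n u x\<bar>) \<le> expectation (\<lambda>x. \<Sum>u\<in>J. (1 + \<bar>c u\<bar>) * min 1 \<bar>X n u x\<bar>)"
      by (intro integral_mono integrable_min_1 m int le)
    also have "\<dots> = (\<Sum>u\<in>J. (1 + \<bar>c u\<bar>) * expectation (\<lambda>x. min 1 \<bar>X n u x\<bar>))"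
      by (subst Bochner_Integration.integral_sum) (intro integrable_mult_right integrable_min_1 Xm, simp_all)
    finally show ?thesis .
  qed
  then have "(\<lambda>n. expectation (\<lambda>x. min 1 \<bar>\<Sum>u\<in>J. c u * X n u x\<bar>)) \<longlonglongrightarrow> 0"
    by (intro tendsto_sandwich[OF _ _ tendsto_const up]) (auto intro: expectation_min_1_nonneg)
  then show ?thesis using m by (simp add: prob_null_def)
qed

text \<open>The Lipschitz bound serves for small differences and the trivial bound 2 for large
  ones.\<close>

lemma iexp_expectation_diff:
  assumes X: "X \<in> borel_measurable M" and Y: "Y \<in> borel_measurable M"
  shows "cmod (expectation (\<lambda>x. iexp (X x)) - expectation (\<lambda>x. iexp (Y x))) \<le> 2 * expectation (\<lambda>x. min 1 \<bar>X x - Y x\<bar>)"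
proof -
  have i: "integrable M (\<lambda>x. iexp (X x))" "integrable M (\<lambda>x. iexp (Y x))"
    using X Y by (auto intro!: integrable_const_bound[where B=1])
  have XY: "(\<lambda>x. X x - Y x) \<in> borel_measurable M" using X Y by measurable
  have "expectation (\<lambda>x. iexp (X x)) - expectation (\<lambda>x. iexp (Y x)) = expectation (\<lambda>x. iexp (X x) - iexp (Y x))"
    by (rule Bochner_Integration.integral_diff[OF i, symmetric])
  also have "cmod \<dots> \<le> expectation (\<lambda>x. cmod (iexp (X x) - iexp (Y x)))" by (rule integral_norm_bound)
  also have "\<dots> \<le> expectation (\<lambda>x. 2 * min 1 \<bar>X x - Y x\<bar>)"
  proof (rule integral_mono)
    show "integrable M (\<lambda>x. cmod (iexp (X x) - iexp (Y x)))" by (intro integrable_norm Bochner_Integration.integrable_diff i)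
    show "integrable M (\<lambda>x. 2 * min 1 \<bar>X x - Y x\<bar>)" by (intro integrable_mult_right integrable_min_1 XY)
    fix x
    show "cmod (iexp (X x) - iexp (Y x)) \<le> 2 * min 1 \<bar>X x - Y x\<bar>"
    proof (cases "1 \<le> \<bar>X x - Y x\<bar>")
      case True
      then show ?thesis using iexp_diff_le_2[of "X x" "Y x"] by simp
    next
      case False
      have "\<bar>X x - Y x\<bar> \<le> 2 * \<bar>X x - Y x\<bar>" by simp
      then show ?thesis using order_trans[OF iexp_lipschitz[of "X x" "Y x"]] False by (simp add: min_def)
    qed
  qed
  finally show ?thesis by simp
qed

lemma prob_null_iexp:
  assumes null: "prob_null M (\<lambda>n x. X n x - Y n x)" and X: "\<And>n. X n \<in> borel_measurable M" and Y: "\<And>n. Y n \<in> borel_measurable M"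
    and lim: "(\<lambda>n. expectation (\<lambda>x. iexp (Y n x))) \<longlonglongrightarrow> l"
  shows "(\<lambda>n. expectation (\<lambda>x. iexp (X n x))) \<longlonglongrightarrow> l"
proof -
  have "(\<lambda>n. 2 * expectation (\<lambda>x. min 1 \<bar>X n x - Y n x\<bar>)) \<longlonglongrightarrow> 2 * 0"
    using null unfolding prob_null_def by (intro tendsto_mult_left) auto
  then have lim0: "(\<lambda>n. 2 * expectation (\<lambda>x. min 1 \<bar>X n x - Y n x\<bar>)) \<longlonglongrightarrow> 0" by simp
  have "(\<lambda>n. expectation (\<lambda>x. iexp (X n x)) - expectation (\<lambda>x. iexp (Y n x))) \<longlonglongrightarrow> 0"
    by (rule Lim_null_comparison[OF always_eventually lim0]) (rule allI, rule iexp_expectation_diff[OF X Y])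
  from tendsto_add[OF this lim] show ?thesis by (simp only: diff_add_cancel add_0)
qed

end

lemma ex_second_moment_cutoff:
  fixes C e :: real
  assumes "0 \<le> C" "0 < e"
  shows "\<exists>R>0. C / R\<^sup>2 \<le> e"
proof (intro exI conjI)
  \<comment> \<open>The summand 1 in the witness keeps it positive when
    \<open>C = 0\<close>.\<close>
  show "0 < sqrt (C / e) + 1" using assms by (intro add_nonneg_pos) auto
  have "C / e = (sqrt (C / e))\<^sup>2" using assms by simp
  also have "\<dots> \<le> (sqrt (C / e) + 1)\<^sup>2" using assms by (intro power_mono) auto
  finally have "C \<le> e * (sqrt (C / e) + 1)\<^sup>2" using assms by (simp add: pos_divide_le_eq mult.commute)
  then show "C / (sqrt (C / e) + 1)\<^sup>2 \<le> e" using \<open>0 < sqrt (C / e) + 1\<close> by (simp add: pos_divide_le_eq)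
qed

section \<open>Normalised order statistics indexed by the unit interval\<close>

definition cell :: "nat \<Rightarrow> real \<Rightarrow> nat" where
  "cell n u = nat \<lceil>real n * u\<rceil>"

lemma cell_bounds:
  assumes "1 \<le> n" "0 < u" "u < 1"
  shows "1 \<le> cell n u" "cell n u \<le> n" "\<bar>real (cell n u) / (real n + 1) - u\<bar> \<le> 1 / (real n + 1)"
proof -
  have p: "0 < real n * u" "real n * u < real n" using assms by auto
  show "1 \<le> cell n u" using p(1) unfolding cell_def by linarith
  show "cell n u \<le> n" using p(2) unfolding cell_def by linarith
  have c: "real n * u \<le> real (cell n u)" "real (cell n u) < real n * u + 1"
    using p(1) unfolding cell_def by linarith+
  have "real (cell n u) / (real n + 1) - u = (real (cell n u) - (real n + 1) * u) / (real n + 1)" by (simp add: field_simps)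
  moreover have "\<bar>real (cell n u) - (real n + 1) * u\<bar> \<le> 1" using c assms by (auto simp: algebra_simps abs_le_iff)
  ultimately show "\<bar>real (cell n u) / (real n + 1) - u\<bar> \<le> 1 / (real n + 1)" by (simp add: divide_right_mono)
qed

context iid_uniform
begin

text \<open>The value 0 outside 1..n makes \<open>V n k\<close> measurable for all \<open>n\<close>
  and \<open>k\<close>, also when \<open>cell n u\<close> is substituted for
  \<open>n = 0\<close>.\<close>

definition V :: "nat \<Rightarrow> nat \<Rightarrow> 'a \<Rightarrow> real" where
  "V n k x = (if 1 \<le> k \<and> k \<le> n then sqrt (real n) * (uos n k x - real k / (real n + 1)) else 0)"

lemma V_meas[measurable]: "V n k \<in> borel_measurable M"
proof (cases "1 \<le> k \<and> k \<le> n")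
  case True
  then have [measurable]: "uos n k \<in> borel_measurable M" by (intro uos_meas) auto
  show ?thesis unfolding V_def[abs_def] using True by simp
next
  case False
  then have eq: "V n k = (\<lambda>_. 0)" by (auto simp: V_def fun_eq_iff)
  show ?thesis unfolding eq by simp
qed

lemma V_second_moment:
  assumes "1 \<le> n"
  shows "integrable M (\<lambda>x. (V n k x)\<^sup>2)" "expectation (\<lambda>x. (V n k x)\<^sup>2) \<le> moment_const 2"
proof -
  have "integrable M (\<lambda>x. (V n k x)\<^sup>2) \<and> expectation (\<lambda>x. (V n k x)\<^sup>2) \<le> moment_const 2"
  proof (cases "1 \<le> k \<and> k \<le> n")
    case True
    then have k: "1 \<le> k" "k \<le> n" by auto
    have eq: "(V n k x)\<^sup>2 = real n * (uos n k x - real k / (real n + 1))\<^sup>2" for x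
      using True by (simp add: V_def power_mult_distrib)
    have "expectation (\<lambda>x. (V n k x)\<^sup>2) \<le> real n * (moment_const 2 * (sd n k)\<^sup>2)"
      unfolding eq using uos_central_moment[OF k, of 2] by (simp add: mult_left_mono)
    also have "\<dots> = moment_const 2 * (real n * (sd n k)\<^sup>2)" by simp
    also have "\<dots> \<le> moment_const 2 * 1"
    proof (rule mult_left_mono[OF _ moment_const_nonneg])
      have u: "0 \<le> real k / (real n + 1)" "real k / (real n + 1) \<le> 1" using k by auto
      then have "(sd n k)\<^sup>2 = real k / (real n + 1) * (1 - real k / (real n + 1)) / (real n + 1)"
        unfolding sd_def by (intro real_sqrt_pow2 divide_nonneg_nonneg mult_nonneg_nonneg) auto
      also have "\<dots> \<le> 1 / (real n + 1)" using u by (intro divide_right_mono mult_le_one) auto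
      finally have "real n * (sd n k)\<^sup>2 \<le> real n * (1 / (real n + 1))" by (intro mult_left_mono) auto
      also have "\<dots> \<le> 1" by simp
      finally show "real n * (sd n k)\<^sup>2 \<le> 1" .
    qed
    finally show ?thesis using uos_central_moment(1)[OF k, of 2] unfolding eq by simp
  qed (auto simp: V_def moment_const_nonneg)
  then show "integrable M (\<lambda>x. (V n k x)\<^sup>2)" "expectation (\<lambda>x. (V n k x)\<^sup>2) \<le> moment_const 2" by auto
qed

text \<open>The pointwise comparison applies off two events: \<open>B\<close>, where the normalised
  order statistic is large, and \<open>A\<close>, where \<open>W\<close> moves by more than
  \<open>e\<close> at some grid point. The number of grid points does not depend on \<open>n\<close>
  while their distances to \<open>t\<close> shrink, so Chebyshev's inequality makes \<open>A\<close>
  negligible.\<close>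

lemma bahadur:
  assumes t: "0 < t" "t < 1"
  shows "prob_null M (\<lambda>n x. V n (cell n t) x - W n t x)"
proof (rule prob_nullI)
  show "(\<lambda>x. V n (cell n t) x - W n t x) \<in> borel_measurable M" for n by measurable
  fix e0 :: real assume "0 < e0"
  \<comment> \<open>Three parts for the pointwise bound, whose term 1/sqrt n is absorbed, and one
    for each exceptional event.\<close>
  define e where "e = e0 / 5"
  have e: "0 < e" using \<open>0 < e0\<close> by (simp add: e_def)
  obtain R where R: "0 < R" "moment_const 2 / R\<^sup>2 \<le> e"
    using ex_second_moment_cutoff[OF moment_const_nonneg e] by blast
  \<comment> \<open>Enough grid steps to cover a deviation \<open>R\<close>, plus 1 for replacing
    k/(n + 1) by \<open>t\<close>, plus one spare step.\<close>
  define I where "I = \<lceil>(R + 1 + e) / e\<rceil>"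
  have I: "R + 1 + e \<le> of_int I * e"
  proof -
    have "(R + 1 + e) / e \<le> of_int I" by (simp add: I_def)
    then show ?thesis using e by (simp add: pos_divide_le_eq)
  qed
  define s where "s n i = t + of_int i * (e / sqrt (real n))" for n and i :: int
  have s_lim: "(\<lambda>n. s n i) \<longlonglongrightarrow> t" for i
  proof -
    have "(\<lambda>n. t + of_int i * (e / sqrt (real n))) \<longlonglongrightarrow> t + of_int i * 0"
      by (intro tendsto_add tendsto_mult tendsto_const) real_asymp
    then show ?thesis by (simp add: s_def)
  qed
  have "eventually (\<lambda>n. \<forall>i\<in>{- I..I}. 0 < s n i \<and> s n i < 1 ) sequentially"
  proof (intro eventually_ball_finite ballI eventually_conj)
    fix i show "eventually (\<lambda>n. 0 < s n i) sequentially" using s_lim t by (intro order_tendstoD) auto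
    show "eventually (\<lambda>n. s n i < 1) sequentially" using s_lim t by (intro order_tendstoD) auto
  qed simp
  moreover have "eventually (\<lambda>n. (\<Sum>i\<in>{- I..I}. \<bar>s n i - t\<bar> / e\<^sup>2) < e) sequentially"
  proof -
    have "(\<lambda>n. \<Sum>i\<in>{- I..I}. \<bar>s n i - t\<bar> / e\<^sup>2) \<longlonglongrightarrow> (\<Sum>i\<in>{- I..I}. \<bar>t - t\<bar> / e\<^sup>2)"
      using e by (intro tendsto_sum tendsto_divide tendsto_rabs tendsto_diff s_lim tendsto_const) auto
    then show ?thesis using e by (intro order_tendstoD) auto
  qed
  moreover have "eventually (\<lambda>n. 1 / sqrt (real n) < e) sequentially"
  proof -
    have "(\<lambda>n. 1 / sqrt (real n)) \<longlonglongrightarrow> 0" by real_asymp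
    then show ?thesis using e by (rule order_tendstoD)
  qed
  moreover have "eventually (\<lambda>n::nat. 1 \<le> n) sequentially" by (rule eventually_ge_at_top)
  ultimately show "eventually (\<lambda>n. expectation (\<lambda>x. min 1 \<bar>V n (cell n t) x - W n t x\<bar>) \<le> e0) sequentially"
  proof eventually_elim
    case (elim n)
    define k where "k = cell n t"
    have k: "1 \<le> k" "k \<le> n" "\<bar>real k / (real n + 1) - t\<bar> \<le> 1 / (real n + 1)"
      using cell_bounds[OF elim(4) t] by (auto simp: k_def)
    define A where "A = (\<Union>i\<in>{- I..I}. {x\<in>space M. e \<le> \<bar>W n (s n i) x - W n t x\<bar>})"
    define B where "B = {x\<in>space M. R \<le> \<bar>V n k x\<bar>}"
    have A: "A \<in> sets M" unfolding A_def by (intro sets.finite_UN) auto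
    have B: "B \<in> sets M" unfolding B_def by measurable
    have "prob A \<le> (\<Sum>i\<in>{- I..I}. prob {x\<in>space M. e \<le> \<bar>W n (s n i) x - W n t x\<bar>})"
      unfolding A_def by (rule finite_measure_subadditive_finite) auto
    also have "\<dots> \<le> (\<Sum>i\<in>{- I..I}. \<bar>s n i - t\<bar> / e\<^sup>2)"
    proof (rule sum_mono)
      fix i assume i: "i \<in> {- I..I}"
      then have si: "0 \<le> s n i" "s n i \<le> 1" using elim(1) by (auto intro: less_imp_le)
      have t': "0 \<le> t" "t \<le> 1" using t by auto
      have "prob {x\<in>space M. e \<le> \<bar>W n (s n i) x - W n t x\<bar>} \<le> expectation (\<lambda>x. (W n (s n i) x - W n t x)\<^sup>2) / e\<^sup>2"
        by (rule second_moment_method[OF _ W_increment_second_moment(1)[OF si t' elim(4)] e]) measurable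
      also have "\<dots> \<le> \<bar>s n i - t\<bar> / e\<^sup>2"
        by (intro divide_right_mono W_increment_second_moment(2)[OF si t' elim(4)]) simp
      finally show "prob {x\<in>space M. e \<le> \<bar>W n (s n i) x - W n t x\<bar>} \<le> \<bar>s n i - t\<bar> / e\<^sup>2" .
    qed
    finally have pA: "prob A \<le> e" using elim(2) by simp
    have "prob B \<le> expectation (\<lambda>x. (V n k x)\<^sup>2) / R\<^sup>2"
      unfolding B_def by (rule second_moment_method[OF _ V_second_moment(1)[OF elim(4)] R(1)]) measurable
    also have "\<dots> \<le> moment_const 2 / R\<^sup>2" by (intro divide_right_mono V_second_moment(2)[OF elim(4)]) simp
    also note R(2)
    finally have pB: "prob B \<le> e" .
    have "expectation (\<lambda>x. min 1 \<bar>V n (cell n t) x - W n t x\<bar>) \<le> 3 * e + prob (A \<union> B)"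
    proof (rule expectation_min_1_le)
      fix x assume x: "x \<in> space M" "x \<notin> A \<union> B"
      have Vx: "\<bar>V n k x\<bar> \<le> R" using x by (auto simp: B_def)
      have grid: "\<bar>W n (t + of_int i * (e / sqrt (real n))) x - W n t x\<bar> \<le> e" if "i \<in> {- I..I}" for i
        using x that by (auto simp: A_def s_def not_le intro: less_imp_le)
      have "\<bar>sqrt (real n) * (uos n k x - t)\<bar> \<le> R + 1"
      proof -
        have "sqrt (real n) * (uos n k x - t) = V n k x + sqrt (real n) * (real k / (real n + 1) - t)"
          using k by (simp add: V_def algebra_simps)
        moreover have "\<bar>sqrt (real n) * (real k / (real n + 1) - t)\<bar> \<le> 1"
        proof -
          have "sqrt (real n) \<le> sqrt ((real n + 1)\<^sup>2)" by (intro real_sqrt_le_mono) (simp add: power2_eq_square algebra_simps)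
          then have "sqrt (real n) \<le> real n + 1" by simp
          have "\<bar>sqrt (real n) * (real k / (real n + 1) - t)\<bar> \<le> (real n + 1) * (1 / (real n + 1))"
            unfolding abs_mult using k(3) \<open>sqrt (real n) \<le> real n + 1\<close> by (intro mult_mono) auto
          then show ?thesis by simp
        qed
        ultimately show ?thesis using Vx by linarith
      qed
      then have "\<bar>sqrt (real n) * (uos n k x - real k / (real n + 1)) - W n t x\<bar> \<le> 2 * e + 1 / sqrt (real n)"
        using I by (intro bahadur_pointwise[OF elim(4) k(1,2) e x(1) grid]) auto
      then show "\<bar>V n (cell n t) x - W n t x\<bar> \<le> 3 * e" using elim(3) k by (simp add: V_def k_def[symmetric])
    qed (use A B e in auto)
    also have "prob (A \<union> B) \<le> prob A + prob B" by (rule measure_Un_le[OF A B])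
    finally show ?case using pA pB by (simp add: e_def)
  qed
qed

end

subsection \<open>The central limit theorem and the Brownian bridge\<close>

definition bridge_var :: "real set \<Rightarrow> (real \<Rightarrow> real) \<Rightarrow> real" where
  "bridge_var J c = (\<Sum>s\<in>J. \<Sum>t\<in>J. c s * c t * (min s t - s * t))"

context iid_uniform
begin

lemma U_distr_eq: "distr M borel (U i) = distr M borel (U j)"
proof (rule cdf_unique)
  show "cdf (distr M borel (U i)) = cdf (distr M borel (U j))"
  proof
    fix t :: real
    have eq: "cdf (distr M borel (U i)) t = prob {x\<in>space M. U i x \<le> t}" for i
    proof -
      have "U i -` {..t} \<inter> space M = {x\<in>space M. U i x \<le> t}" by auto
      then show ?thesis by (simp add: cdf_def measure_distr)
    qed
    have "prob {x\<in>space M. U i x \<le> t} = max 0 (min 1 t)" for i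
    proof -
      have r: "0 < U i x" "U i x < 1" if "x \<in> space M" for x using U_range[OF that, of i] by auto
      consider "t < 0" | "0 \<le> t" "t \<le> 1" | "1 < t" by linarith
      then show ?thesis
      proof cases
        case 1
        have "\<not> U i x \<le> t" if "x \<in> space M" for x using r(1)[OF that] 1 by linarith
        then have eq: "{x\<in>space M. U i x \<le> t} = {}" by auto
        show ?thesis unfolding eq using 1 by simp
      next
        case 2
        then show ?thesis using U_cdf[OF 2] by simp
      next
        case 3
        have "U i x \<le> t" if "x \<in> space M" for x using r(2)[OF that] 3 by linarith
        then have eq: "{x\<in>space M. U i x \<le> t} = space M" by auto
        show ?thesis unfolding eq using 3 by (simp add: prob_space)
      qed
    qed
    then show "cdf (distr M borel (U i)) t = cdf (distr M borel (U j)) t" by (simp add: eq)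
  qed
qed auto

text \<open>A linear combination of values of \<open>W\<close> is itself a normalised sum of i.i.d.
  bounded centred variables \<open>g (U j x)\<close>, so the one-dimensional central limit theorem
  suffices.\<close>

lemma W_combination_char:
  assumes J: "finite J" "J \<subseteq> {0..1}"
  shows "(\<lambda>n. expectation (\<lambda>x. iexp (\<Sum>t\<in>J. c t * W n t x))) \<longlonglongrightarrow> exp (- bridge_var J c / 2)"
proof -
  define g where "g y = (\<Sum>t\<in>J. c t * (t - indicator {..t} y))" for y :: real
  have g[measurable]: "g \<in> borel_measurable borel" unfolding g_def[abs_def] by measurable
  define B where "B = (\<Sum>t\<in>J. \<bar>c t\<bar>)"
  have b: "\<bar>g y\<bar> \<le> B" for y
    unfolding g_def B_def
  proof (rule order_trans[OF sum_abs sum_mono])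
    fix t assume "t \<in> J"
    then have "\<bar>t - indicator {..t} y\<bar> \<le> 1" using J by (auto simp: indicator_def)
    then show "\<bar>c t * (t - indicator {..t} y)\<bar> \<le> \<bar>c t\<bar>" by (simp add: abs_mult mult_left_le)
  qed
  have gx: "g (U j x) = (\<Sum>t\<in>J. c t * xi j t x)" for j x by (simp add: g_def xi_def)
  have J01: "0 \<le> t" "t \<le> 1" if "t \<in> J" for t using that J by auto
  have ix: "integrable M (xi j t)" if "t \<in> J" for j t
    by (rule integrable_const_bound[where B=1]) (use xi_bound J01[OF that] in auto)
  have ixx: "integrable M (\<lambda>x. xi j s x * xi j t x)" if "s \<in> J" "t \<in> J" for j s t
    by (rule integrable_const_bound[where B=1]) (use xi_bound J01[OF that(1)] J01[OF that(2)] in \<open>auto simp: abs_mult intro!: mult_le_one\<close>)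
  have mean: "expectation (\<lambda>x. g (U j x)) = 0" for j
    unfolding gx using J01 by (subst Bochner_Integration.integral_sum) (auto intro!: integrable_mult_right ix simp: xi_mean)
  have var: "expectation (\<lambda>x. (g (U j x))\<^sup>2) = bridge_var J c" for j
  proof -
    have "expectation (\<lambda>x. (g (U j x))\<^sup>2) = expectation (\<lambda>x. \<Sum>s\<in>J. \<Sum>t\<in>J. c s * c t * (xi j s x * xi j t x))"
      unfolding gx by (intro Bochner_Integration.integral_cong refl) (simp add: power2_eq_square sum_product mult_ac)
    also have "\<dots> = (\<Sum>s\<in>J. expectation (\<lambda>x. \<Sum>t\<in>J. c s * c t * (xi j s x * xi j t x)))"
      by (rule Bochner_Integration.integral_sum) (intro Bochner_Integration.integrable_sum integrable_mult_right ixx)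
    also have "\<dots> = (\<Sum>s\<in>J. \<Sum>t\<in>J. expectation (\<lambda>x. c s * c t * (xi j s x * xi j t x)))"
      by (intro sum.cong refl Bochner_Integration.integral_sum) (intro integrable_mult_right ixx)
    also have "\<dots> = bridge_var J c"
      unfolding bridge_var_def using J01 by (intro sum.cong refl) (simp add: xi_covariance)
    finally show ?thesis .
  qed
  have m[measurable]: "(\<lambda>x. g (U j x)) \<in> borel_measurable M" for j by (rule measurable_compose[OF U_meas g])
  \<comment> \<open>The central limit theorem is applied to indices below \<open>n\<close>, while
    \<open>W\<close> sums over 1..n. The two sums differ by two bounded terms, negligible after
    division by sqrt n.\<close>
  define S where "S n x = (\<Sum>j<n. g (U j x)) / sqrt (real n)" for n x
  have S_meas[measurable]: "S n \<in> borel_measurable M" for n unfolding S_def[abs_def] by measurable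
  have S_lim: "(\<lambda>n. expectation (\<lambda>x. iexp (S n x))) \<longlonglongrightarrow> exp (- bridge_var J c / 2)"
  proof (cases "bridge_var J c > 0")
    case True
    define \<sigma> where "\<sigma> = sqrt (bridge_var J c)"
    have \<sigma>: "0 < \<sigma>" "\<sigma>\<^sup>2 = bridge_var J c" using True by (auto simp: \<sigma>_def)
    have "weak_conv_m (\<lambda>n. distr M borel (\<lambda>x. (\<Sum>i<n. g (U i x)) / sqrt (real n * \<sigma>\<^sup>2))) std_normal_distribution"
    proof (rule central_limit_theorem_zero_mean[where X="\<lambda>i x. g (U i x)" and \<mu>="distr (distr M borel (U 0)) borel g"])
      show "indep_vars (\<lambda>i. borel) (\<lambda>i x. g (U i x)) UNIV" by (rule indep_vars_compose2[OF indep]) (rule g)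
      show "expectation (\<lambda>x. g (U n x)) = 0" for n by (rule mean)
      show "integrable M (\<lambda>x. (g (U n x))\<^sup>2)" for n
      proof (rule integrable_const_bound[where B="B\<^sup>2"])
        have "0 \<le> B" using b[of 0] by simp
        then show "AE x in M. norm ((g (U n x))\<^sup>2) \<le> B\<^sup>2" using b by (simp add: abs_le_square_iff[symmetric])
      qed measurable
      show "variance (\<lambda>x. g (U n x)) = \<sigma>\<^sup>2" for n using var[of n] by (simp add: mean \<sigma>)
      show "distr M borel (\<lambda>x. g (U n x)) = distr (distr M borel (U 0)) borel g" for n
        by (subst U_distr_eq[of 0 n]) (simp add: distr_distr o_def)
    qed (rule \<sigma>)
    then have "(\<lambda>n. char (distr M borel (\<lambda>x. (\<Sum>i<n. g (U i x)) / sqrt (real n * \<sigma>\<^sup>2))) \<sigma>) \<longlonglongrightarrow> char std_normal_distribution \<sigma>"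
      by (intro levy_continuity1 real_distribution_distr real_dist_normal_dist) auto
    moreover have "char (distr M borel (\<lambda>x. (\<Sum>i<n. g (U i x)) / sqrt (real n * \<sigma>\<^sup>2))) \<sigma> = expectation (\<lambda>x. iexp (S n x))" for n
    proof -
      have "\<sigma> * ((\<Sum>i<n. g (U i x)) / sqrt (real n * \<sigma>\<^sup>2)) = S n x" for x
        using \<sigma>(1) by (simp add: S_def real_sqrt_mult)
      then have "iexp (\<sigma> * ((\<Sum>i<n. g (U i x)) / sqrt (real n * \<sigma>\<^sup>2))) = iexp (S n x)" for x by (simp only:)
      then show ?thesis unfolding char_def by (subst integral_distr) (auto simp del: of_real_divide of_real_mult)
    qed
    ultimately show ?thesis by (simp add: char_std_normal_distribution \<sigma>(2))
  next
    case False
    \<comment> \<open>Degenerate combinations are treated apart because normalising by \<sigma>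
      needs positive variance; here the summands vanish almost surely.\<close>
    have "0 \<le> bridge_var J c" unfolding var[of 0, symmetric] by (rule Bochner_Integration.integral_nonneg) simp
    then have v0: "bridge_var J c = 0" using False by simp
    have "expectation (\<lambda>x. iexp (S n x)) = 1" for n
    proof -
      have int: "integrable M (\<lambda>x. (g (U j x))\<^sup>2)" for j
      proof (rule integrable_const_bound[where B="B\<^sup>2"])
        have "0 \<le> B" using b[of 0] by simp
        then show "AE x in M. norm ((g (U j x))\<^sup>2) \<le> B\<^sup>2" using b by (simp add: abs_le_square_iff[symmetric])
      qed measurable
      have "AE x in M. (g (U j x))\<^sup>2 = 0" for j
        using integral_nonneg_eq_0_iff_AE[OF int[of j]] var[of j] v0 by simp
      then have "AE x in M. \<forall>j. (g (U j x))\<^sup>2 = 0" by (simp add: AE_all_countable)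
      then have "AE x in M. iexp (S n x) = 1" by eventually_elim (simp add: S_def)
      then have "expectation (\<lambda>x. iexp (S n x)) = expectation (\<lambda>x. 1)" by (intro integral_cong_AE) auto
      then show ?thesis by (simp add: prob_space)
    qed
    then show ?thesis by (simp add: v0)
  qed
  show ?thesis
  proof (rule prob_null_iexp[OF _ _ S_meas S_lim])
    show Wm: "(\<lambda>x. \<Sum>t\<in>J. c t * W n t x) \<in> borel_measurable M" for n by measurable
    show "prob_null M (\<lambda>n x. (\<Sum>t\<in>J. c t * W n t x) - S n x)"
    proof (rule prob_nullI)
      show "(\<lambda>x. (\<Sum>t\<in>J. c t * W n t x) - S n x) \<in> borel_measurable M" for n
        by (intro borel_measurable_diff Wm S_meas)
      have "(\<lambda>n. 2 * B / sqrt (real n)) \<longlonglongrightarrow> 0" by real_asymp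
      fix e :: real assume "0 < e"
      have "eventually (\<lambda>n. 2 * B / sqrt (real n) < e) sequentially"
        using \<open>_ \<longlonglongrightarrow> 0\<close> \<open>0 < e\<close> by (rule order_tendstoD)
      then show "eventually (\<lambda>n. expectation (\<lambda>x. min 1 \<bar>(\<Sum>t\<in>J. c t * W n t x) - S n x\<bar>) \<le> e) sequentially"
      proof eventually_elim
        case (elim n)
        have "\<bar>(\<Sum>t\<in>J. c t * W n t x) - S n x\<bar> \<le> 2 * B / sqrt (real n)" for x
        proof -
          have "(\<Sum>t\<in>J. c t * W n t x) = (\<Sum>t\<in>J. \<Sum>j\<in>{1..n}. c t * xi j t x) / sqrt (real n)"
            by (simp add: W_def sum_divide_distrib sum_distrib_left)
          also have "(\<Sum>t\<in>J. \<Sum>j\<in>{1..n}. c t * xi j t x) = (\<Sum>j\<in>{1..n}. g (U j x))"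
            unfolding gx by (rule sum.swap)
          also have "(\<Sum>j\<in>{1..n}. g (U j x)) = (\<Sum>j<n. g (U j x)) + g (U n x) - g (U 0 x)"
            by (induction n) (auto simp: sum.atLeast_Suc_atMost atLeastAtMostSuc_conv)
          finally have "(\<Sum>t\<in>J. c t * W n t x) - S n x = (g (U n x) - g (U 0 x)) / sqrt (real n)"
            by (simp add: S_def diff_divide_distrib add_divide_distrib)
          moreover have "\<bar>g (U n x) - g (U 0 x)\<bar> \<le> 2 * B" using b[of "U n x"] b[of "U 0 x"] by linarith
          ultimately show ?thesis by (simp add: divide_right_mono)
        qed
        then have "expectation (\<lambda>x. min 1 \<bar>(\<Sum>t\<in>J. c t * W n t x) - S n x\<bar>) \<le> e + prob {}"
          using elim \<open>0 < e\<close> by (intro expectation_min_1_le borel_measurable_diff Wm S_meas) (auto intro: order_trans less_imp_le)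
        then show ?case by simp
      qed
    qed
  qed
qed

end

section \<open>Gaussian laws and moments of the Brownian bridge\<close>

lemma gaussian_law_moments:
  assumes \<mu>: "gaussian_law \<mu>"
  shows "integrable \<mu> (\<lambda>x. x)" "integrable \<mu> (\<lambda>x. x ^ 2)"
proof -
  have "integrable \<mu> (\<lambda>x. x) \<and> integrable \<mu> (\<lambda>x. x ^ 2)"
    using \<mu> unfolding gaussian_law_def
  proof (elim disjE exE conjE)
    fix m assume "\<mu> = return borel m"
    then show ?thesis by (auto intro!: integrableI_bounded simp: nn_integral_return)
  next
    fix m \<sigma> :: real assume s: "0 < \<sigma>" and eq: "\<mu> = density lborel (\<lambda>x. ennreal (normal_density m \<sigma> x))"
    have i1: "integrable lborel (\<lambda>x. normal_density m \<sigma> x * x)"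
      by (rule integrable_normal_moment_nz_1[OF s])
    have i2: "integrable lborel (\<lambda>x. normal_density m \<sigma> x * (x - m) ^ 2)"
      using integrable_normal_moment[OF s, of m 2] .
    have i0: "integrable lborel (normal_density m \<sigma>)" using integrable_normal_density[OF s] .
    have "integrable lborel (\<lambda>x. normal_density m \<sigma> x * (x - m) ^ 2 + 2 * m * (normal_density m \<sigma> x * x) - m\<^sup>2 * normal_density m \<sigma> x)"
      by (intro Bochner_Integration.integrable_add Bochner_Integration.integrable_diff integrable_mult_right i0 i1 i2)
    also have "(\<lambda>x. normal_density m \<sigma> x * (x - m) ^ 2 + 2 * m * (normal_density m \<sigma> x * x) - m\<^sup>2 * normal_density m \<sigma> x)
       = (\<lambda>x. normal_density m \<sigma> x * x ^ 2)"
      by (auto simp: fun_eq_iff power2_eq_square algebra_simps)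
    finally show ?thesis using i1 unfolding eq by (subst (1 2) integrable_density) auto
  qed
  then show "integrable \<mu> (\<lambda>x. x)" "integrable \<mu> (\<lambda>x. x ^ 2)" by auto
qed

lemma centred_gaussian_law_cases:
  assumes \<mu>: "gaussian_law \<mu>" and mean: "(\<integral>x. x \<partial>\<mu>) = 0"
  obtains "\<mu> = return borel 0" "(\<integral>x. x ^ 2 \<partial>\<mu>) = 0"
  | \<sigma> where "0 < \<sigma>" "\<mu> = density lborel (\<lambda>x. ennreal (normal_density 0 \<sigma> x))" "(\<integral>x. x ^ 2 \<partial>\<mu>) = \<sigma>\<^sup>2"
  using \<mu> unfolding gaussian_law_def
proof (elim disjE exE conjE)
  fix m assume eq: "\<mu> = return borel m"
  then have "m = 0" using mean by (simp add: integral_return)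
  then show ?thesis using eq by (intro that(1)) (auto simp: integral_return)
next
  fix m \<sigma> :: real assume s: "0 < \<sigma>" and eq: "\<mu> = density lborel (\<lambda>x. ennreal (normal_density m \<sigma> x))"
  have "(\<integral>x. x \<partial>\<mu>) = m" unfolding eq
    by (subst integral_density) (auto simp: integral_normal_moment_nz_1[OF s])
  then have m: "m = 0" using mean by simp
  have "(\<integral>x. x ^ 2 \<partial>\<mu>) = \<sigma>\<^sup>2" unfolding eq m
    using integral_normal_moment_even[OF s, of 0 1] by (subst integral_density) (auto simp: power2_eq_square field_simps)
  then show ?thesis using s eq unfolding m by (intro that(2)) auto
qed

lemma centred_gaussian_char:
  assumes \<mu>: "gaussian_law \<mu>" and mean: "(\<integral>x. x \<partial>\<mu>) = 0"
  shows "(\<integral>x. iexp x \<partial>\<mu>) = exp (- (\<integral>x. x ^ 2 \<partial>\<mu>) / 2)"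
  using \<mu> mean
proof (cases rule: centred_gaussian_law_cases)
  case 1
  then show ?thesis by (simp add: integral_return)
next
  case (2 \<sigma>)
  interpret \<mu>: prob_space \<mu> unfolding 2(2) by (rule prob_space_normal_density[OF 2(1)])
  have "distributed \<mu> lborel (\<lambda>x. x) (normal_density 0 \<sigma>)"
    by (simp add: distributed_def 2(2) distr_id2)
  then have "distributed \<mu> lborel (\<lambda>x. x / \<sigma>) std_normal_density"
    using \<mu>.normal_standard_normal_convert[OF 2(1), of "\<lambda>x. x" 0] by simp
  then have d: "distr \<mu> lborel (\<lambda>x. x / \<sigma>) = std_normal_distribution" and
    m: "(\<lambda>x. x / \<sigma>) \<in> measurable \<mu> lborel"
    by (auto simp: distributed_def)
  have "char std_normal_distribution \<sigma> = (\<integral>x. iexp (\<sigma> * (x / \<sigma>)) \<partial>\<mu>)"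
    unfolding char_def d[symmetric] by (subst integral_distr[OF m]) auto
  also have "\<dots> = (\<integral>x. iexp x \<partial>\<mu>)" using 2(1) by simp
  finally show ?thesis by (simp add: char_std_normal_distribution 2(3))
qed

lemma centred_gaussian_even_moment:
  assumes \<mu>: "gaussian_law \<mu>" and mean: "(\<integral>x. x \<partial>\<mu>) = 0" and var: "(\<integral>x. x ^ 2 \<partial>\<mu>) = s\<^sup>2" and s: "0 < s"
  shows "integrable \<mu> (\<lambda>x. x ^ (2 * m))" "(\<integral>x. x ^ (2 * m) \<partial>\<mu>) = fact (2 * m) / (2 ^ m * fact m) * s ^ (2 * m)"
proof -
  have "integrable \<mu> (\<lambda>x. x ^ (2 * m)) \<and> (\<integral>x. x ^ (2 * m) \<partial>\<mu>) = fact (2 * m) / (2 ^ m * fact m) * s ^ (2 * m)"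
    using \<mu> mean
  proof (cases rule: centred_gaussian_law_cases)
    case 1
    then show ?thesis using var s by simp
  next
    case (2 \<sigma>)
    then have \<sigma>: "\<sigma> = s" using var s by (simp add: power2_eq_iff_nonneg)
    have h: "has_bochner_integral lborel (\<lambda>x. normal_density 0 \<sigma> x * (x - 0) ^ (2 * m)) (fact (2 * m) / ((2 / \<sigma>\<^sup>2) ^ m * fact m))"
      by (rule normal_moment_even[OF 2(1)])
    have i: "integrable lborel (\<lambda>x. normal_density 0 \<sigma> x * x ^ (2 * m))"
      and v: "(\<integral>x. normal_density 0 \<sigma> x * x ^ (2 * m) \<partial>lborel) = fact (2 * m) / ((2 / \<sigma>\<^sup>2) ^ m * fact m)"
      using h by (auto simp: has_bochner_integral_iff)
    have e: "fact (2 * m) / ((2 / \<sigma>\<^sup>2) ^ m * fact m) = fact (2 * m) / (2 ^ m * fact m) * \<sigma> ^ (2 * m)"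
      by (simp add: power_divide power_mult)
    have "integrable \<mu> (\<lambda>x. x ^ (2 * m))" unfolding 2(2) by (subst integrable_density) (use i in auto)
    moreover have "(\<integral>x. x ^ (2 * m) \<partial>\<mu>) = fact (2 * m) / ((2 / \<sigma>\<^sup>2) ^ m * fact m)"
      unfolding 2(2) by (subst integral_density) (use v in auto)
    ultimately show ?thesis using e \<sigma> by simp
  qed
  then show "integrable \<mu> (\<lambda>x. x ^ (2 * m))" "(\<integral>x. x ^ (2 * m) \<partial>\<mu>) = fact (2 * m) / (2 ^ m * fact m) * s ^ (2 * m)" by auto
qed

context
  fixes N :: "'b measure" and \<beta> :: "real \<Rightarrow> 'b \<Rightarrow> real"
  assumes bridge: "standard_brownian_bridge N \<beta>"
begin

lemma bridge_prob_space: "prob_space N"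
  using bridge by (simp add: standard_brownian_bridge_def)

lemma bridge_meas: "t \<in> {0..1} \<Longrightarrow> \<beta> t \<in> borel_measurable N"
  using bridge by (simp add: standard_brownian_bridge_def)

lemma bridge_gaussian: "finite J \<Longrightarrow> J \<subseteq> {0..1} \<Longrightarrow> gaussian_law (distr N borel (\<lambda>x. \<Sum>t\<in>J. c t * \<beta> t x))"
  using bridge by (simp add: standard_brownian_bridge_def)

lemma bridge_gaussian1: "t \<in> {0..1} \<Longrightarrow> gaussian_law (distr N borel (\<beta> t))"
  using bridge_gaussian[of "{t}" "\<lambda>_. 1"] by simp

lemma bridge_mean: "t \<in> {0..1} \<Longrightarrow> (\<integral>x. \<beta> t x \<partial>N) = 0"
  using bridge by (simp add: standard_brownian_bridge_def)

lemma bridge_cov: "s \<in> {0..1} \<Longrightarrow> t \<in> {0..1} \<Longrightarrow> (\<integral>x. \<beta> s x * \<beta> t x \<partial>N) = min s t - s * t"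
  using bridge by (simp add: standard_brownian_bridge_def)

text \<open>The definition of the bridge prescribes values of integrals, and a value alone does not
  give integrability because of the default value 0. Integrability comes from the Gaussian
  marginals.\<close>

lemma bridge_integrable:
  assumes "t \<in> {0..1}"
  shows "integrable N (\<beta> t)" "integrable N (\<lambda>x. (\<beta> t x)\<^sup>2)"
  using gaussian_law_moments[OF bridge_gaussian1[OF assms]] bridge_meas[OF assms]
  by (auto simp: integrable_distr_eq)

lemma bridge_integrable_mult:
  assumes s: "s \<in> {0..1}" and t: "t \<in> {0..1}"
  shows "integrable N (\<lambda>x. \<beta> s x * \<beta> t x)"
proof (rule Bochner_Integration.integrable_bound)
  show "integrable N (\<lambda>x. (\<beta> s x)\<^sup>2 + (\<beta> t x)\<^sup>2)"
    by (intro Bochner_Integration.integrable_add bridge_integrable s t)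
  show "(\<lambda>x. \<beta> s x * \<beta> t x) \<in> borel_measurable N" using bridge_meas[OF s] bridge_meas[OF t] by measurable
  have "\<bar>a * b\<bar> \<le> a\<^sup>2 + b\<^sup>2" for a b :: real
  proof -
    have "2 * abs a * abs b \<le> (abs a)\<^sup>2 + (abs b)\<^sup>2" by (rule sum_squares_bound)
    moreover have "0 \<le> abs a * abs b" by simp
    ultimately show ?thesis unfolding abs_mult power2_abs by linarith
  qed
  then show "AE x in N. norm (\<beta> s x * \<beta> t x) \<le> norm ((\<beta> s x)\<^sup>2 + (\<beta> t x)\<^sup>2)" by simp
qed

text \<open>A centred Gaussian law is determined by its variance, and the covariance of the bridge
  gives the same variance \<open>bridge_var J c\<close> as the central limit theorem for
  \<open>W\<close>.\<close>

lemma bridge_combination_char: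
  assumes J: "finite J" "J \<subseteq> {0..1}"
  shows "(\<integral>x. iexp (\<Sum>t\<in>J. c t * \<beta> t x) \<partial>N) = exp (- bridge_var J c / 2)"
proof -
  have t01: "t \<in> {0..1}" if "t \<in> J" for t using J that by auto
  define X where "X x = (\<Sum>t\<in>J. c t * \<beta> t x)" for x
  have X: "X \<in> borel_measurable N" unfolding X_def[abs_def]
    by (intro borel_measurable_sum borel_measurable_times borel_measurable_const bridge_meas t01)
  have gl: "gaussian_law (distr N borel X)" unfolding X_def[abs_def] by (rule bridge_gaussian[OF J])
  have "(\<integral>x. X x \<partial>N) = (\<Sum>t\<in>J. \<integral>x. c t * \<beta> t x \<partial>N)"
    unfolding X_def by (rule Bochner_Integration.integral_sum) (intro integrable_mult_right bridge_integrable t01)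
  also have "\<dots> = 0" using t01 by (intro sum.neutral) (simp add: bridge_mean)
  finally have mean: "(\<integral>x. x \<partial>distr N borel X) = 0" using X by (simp add: integral_distr)
  have "(\<integral>x. (X x)\<^sup>2 \<partial>N) = (\<integral>x. (\<Sum>s\<in>J. \<Sum>t\<in>J. c s * c t * (\<beta> s x * \<beta> t x)) \<partial>N)"
    unfolding X_def by (intro Bochner_Integration.integral_cong refl) (simp add: power2_eq_square sum_product mult_ac)
  also have "\<dots> = (\<Sum>s\<in>J. \<integral>x. (\<Sum>t\<in>J. c s * c t * (\<beta> s x * \<beta> t x)) \<partial>N)"
    by (rule Bochner_Integration.integral_sum) (intro Bochner_Integration.integrable_sum integrable_mult_right bridge_integrable_mult t01)
  also have "\<dots> = (\<Sum>s\<in>J. \<Sum>t\<in>J. \<integral>x. c s * c t * (\<beta> s x * \<beta> t x) \<partial>N)"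
    by (intro sum.cong refl Bochner_Integration.integral_sum) (intro integrable_mult_right bridge_integrable_mult t01)
  also have "\<dots> = bridge_var J c"
    unfolding bridge_var_def by (intro sum.cong refl) (simp only: integral_mult_right_zero bridge_cov t01)
  finally have var: "(\<integral>x. x ^ 2 \<partial>distr N borel X) = bridge_var J c" using X by (simp add: integral_distr)
  have "(\<integral>x. iexp (X x) \<partial>N) = (\<integral>x. iexp x \<partial>distr N borel X)" using X by (subst integral_distr) auto
  also have "\<dots> = exp (- bridge_var J c / 2)" using centred_gaussian_char[OF gl mean] by (simp add: var)
  finally show ?thesis by (simp add: X_def)
qed

lemma bridge_abs_moment:
  assumes t: "0 < t" "t < 1" and p: "0 \<le> p" "p \<le> real (2 * m)"
  shows "(\<integral>\<^sup>+x. ennreal (\<bar>\<beta> t x\<bar> powr p) \<partial>N) \<le> ennreal ((1 + fact (2 * m) / (2 ^ m * fact m)) * sqrt (t * (1 - t)) powr p)"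
proof -
  interpret prob_space N by (rule bridge_prob_space)
  have t': "t \<in> {0..1}" using t by auto
  have m: "\<beta> t \<in> borel_measurable N" by (rule bridge_meas[OF t'])
  define s where "s = sqrt (t * (1 - t))"
  have s: "0 < s" "s\<^sup>2 = t * (1 - t)" using t by (auto simp: s_def)
  have mean: "(\<integral>x. x \<partial>distr N borel (\<beta> t)) = 0" using m bridge_mean[OF t'] by (simp add: integral_distr)
  have var: "(\<integral>x. x ^ 2 \<partial>distr N borel (\<beta> t)) = s\<^sup>2"
    using m bridge_cov[OF t' t'] s by (simp add: integral_distr power2_eq_square algebra_simps)
  note mom = centred_gaussian_even_moment[OF bridge_gaussian1[OF t'] mean var s(1), of m]
  have "integrable N (\<lambda>x. \<beta> t x ^ (2 * m))" using mom(1) m by (simp add: integrable_distr_eq)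
  moreover have "(\<integral>x. \<beta> t x ^ (2 * m) \<partial>N) \<le> fact (2 * m) / (2 ^ m * fact m) * s ^ (2 * m)"
    using mom(2) m by (simp add: integral_distr)
  ultimately show ?thesis unfolding s_def[symmetric]
    by (rule abs_powr_moment_bound[OF _ _ s(1) p m]) simp
qed

end

subsection \<open>Processes on the unit interval\<close>

text \<open>It plays two roles: the index measure of the integral functionals and the law of the
  uniform variables.\<close>

definition unif01 :: "real measure" where
  "unif01 = restrict_space lborel {0<..<1}"

lemma space_unif01[simp]: "space unif01 = {0<..<1}"
  by (simp add: unif01_def space_restrict_space)

lemma prob_space_unif01: "prob_space unif01"
  by (auto simp add: unif01_def emeasure_restrict_space space_restrict_space intro!: prob_spaceI)

lemma measurable_unif01_borel: "f \<in> borel_measurable borel \<Longrightarrow> f \<in> borel_measurable unif01"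
  unfolding unif01_def by (rule measurable_restrict_space1) simp

lemma cell_measurable[measurable]: "cell n \<in> measurable unif01 (count_space UNIV)"
proof -
  have "cell n \<in> measurable borel (count_space UNIV)" unfolding cell_def[abs_def] by measurable
  then have "cell n \<in> measurable lborel (count_space UNIV)" by simp
  then show ?thesis unfolding unif01_def by (rule measurable_restrict_space1)
qed

section \<open>Step functions on the cells\<close>

definition cell_set :: "nat \<Rightarrow> nat \<Rightarrow> real set" where
  "cell_set n k = {u\<in>{0<..<1}. cell n u = k}"

lemma emeasure_cell:
  assumes k: "1 \<le> k" "k \<le> n"
  shows "emeasure unif01 (cell_set n k) = ennreal (1 / real n)"
proof -
  have n: "0 < real n" using k by simp
  have iff: "cell n u = k \<longleftrightarrow> (real k - 1) / real n < u \<and> u \<le> real k / real n" if "0 < u" for u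
  proof -
    have "0 < real n * u" using n that by simp
    then have "cell n u = k \<longleftrightarrow> real k - 1 < real n * u \<and> real n * u \<le> real k"
      unfolding cell_def using k by linarith
    also have "\<dots> \<longleftrightarrow> (real k - 1) / real n < u \<and> u \<le> real k / real n"
      using n by (simp add: divide_less_eq le_divide_eq mult.commute)
    finally show ?thesis .
  qed
  have p: "0 \<le> (real k - 1) / real n" using k by simp
  have "emeasure unif01 {u\<in>{0<..<1}. cell n u = k} = emeasure lborel {u\<in>{0<..<1}. cell n u = k}"
    unfolding unif01_def by (rule emeasure_restrict_space) auto
  also have "\<dots> = ennreal (1 / real n)"
  \<comment> \<open>The last cell lacks its right end 1, since the index interval is open.\<close>
  proof (cases "k = n")
    case True
    have "{u\<in>{0<..<1}. cell n u = k} = {(real k - 1) / real n <..< 1}"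
    proof (intro set_eqI iffI)
      fix u assume "u \<in> {(real k - 1) / real n <..< 1}"
      then have u: "(real k - 1) / real n < u" "u < 1" by auto
      then have "0 < u" using p by linarith
      moreover have "u \<le> real k / real n" using u True n by simp
      ultimately show "u \<in> {u\<in>{0<..<1}. cell n u = k}" using u iff[of u] by simp
    next
      fix u assume "u \<in> {u\<in>{0<..<1}. cell n u = k}"
      then show "u \<in> {(real k - 1) / real n <..< 1}" using iff[of u] by simp
    qed
    moreover have "(real k - 1) / real n \<le> 1" "1 - (real k - 1) / real n = 1 / real n" using True n by (auto simp: field_simps)
    ultimately show ?thesis by simp
  next
    case False
    then have "real k / real n < 1" using k n by simp
    have "{u\<in>{0<..<1}. cell n u = k} = {(real k - 1) / real n <.. real k / real n}"
    proof (intro set_eqI iffI)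
      fix u assume "u \<in> {(real k - 1) / real n <.. real k / real n}"
      then have u: "(real k - 1) / real n < u" "u \<le> real k / real n" by auto
      then have "0 < u" "u < 1" using p \<open>real k / real n < 1\<close> by linarith+
      then show "u \<in> {u\<in>{0<..<1}. cell n u = k}" using u iff[of u] by simp
    next
      fix u assume "u \<in> {u\<in>{0<..<1}. cell n u = k}"
      then show "u \<in> {(real k - 1) / real n <.. real k / real n}" using iff[of u] by simp
    qed
    moreover have "(real k - 1) / real n \<le> real k / real n" "real k / real n - (real k - 1) / real n = 1 / real n"
      using n by (auto simp: diff_divide_distrib divide_right_mono)
    ultimately show ?thesis by simp
  qed
  finally show ?thesis unfolding cell_set_def .
qed

lemma cell_set_measurable[measurable]: "cell_set n k \<in> sets unif01"
proof -
  have "{u\<in>space unif01. cell n u = k} \<in> sets unif01" by measurable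
  then show ?thesis by (simp add: cell_set_def)
qed

lemma cell_sum:
  fixes \<phi> :: "nat \<Rightarrow> 'c::semiring_1"
  assumes "1 \<le> n" "u \<in> {0<..<1}"
  shows "\<phi> (cell n u) = (\<Sum>k=1..n. \<phi> k * indicator (cell_set n k) u)"
proof -
  have c: "cell n u \<in> {1..n}" using cell_bounds[of n u] assms by auto
  have "(\<Sum>k=1..n. \<phi> k * indicator (cell_set n k) u) = (\<Sum>k\<in>{cell n u}. \<phi> k * indicator (cell_set n k) u)"
    using c by (intro sum.mono_neutral_right) (auto simp: cell_set_def)
  also have "\<dots> = \<phi> (cell n u)" using assms by (simp add: cell_set_def)
  finally show ?thesis by (rule sym)
qed

lemma nn_integral_cell:
  assumes "1 \<le> n"
  shows "(\<integral>\<^sup>+u. ennreal (\<phi> (cell n u)) \<partial>unif01) = (\<Sum>k=1..n. ennreal (\<phi> k) * ennreal (1 / real n))"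
proof -
  have "(\<integral>\<^sup>+u. ennreal (\<phi> (cell n u)) \<partial>unif01) = (\<integral>\<^sup>+u. (\<Sum>k=1..n. ennreal (\<phi> k) * indicator (cell_set n k) u) \<partial>unif01)"
    using cell_sum[OF assms, of _ "\<lambda>k. ennreal (\<phi> k)"] by (intro nn_integral_cong) (simp only: space_unif01)
  also have "\<dots> = (\<Sum>k=1..n. \<integral>\<^sup>+u. ennreal (\<phi> k) * indicator (cell_set n k) u \<partial>unif01)"
    using cell_set_measurable by (intro nn_integral_sum) auto
  also have "\<dots> = (\<Sum>k=1..n. ennreal (\<phi> k) * ennreal (1 / real n))"
    by (intro sum.cong refl) (simp add: nn_integral_cmult_indicator cell_set_measurable emeasure_cell)
  finally show ?thesis .
qed

lemma integral_cell:
  fixes \<phi> :: "nat \<Rightarrow> real"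
  assumes "1 \<le> n"
  shows "(\<integral>u. \<phi> (cell n u) \<partial>unif01) = (\<Sum>k=1..n. \<phi> k) / real n"
proof -
  have i: "integrable unif01 (\<lambda>u. \<phi> k * indicator (cell_set n k) u)" if "k \<in> {1..n}" for k
    by (intro integrable_mult_right integrable_real_indicator cell_set_measurable) (use that in \<open>auto simp: emeasure_cell\<close>)
  have Int: "cell_set n k \<inter> {0<..<1} = cell_set n k" for k by (auto simp: cell_set_def)
  have "(\<integral>u. \<phi> (cell n u) \<partial>unif01) = (\<integral>u. (\<Sum>k=1..n. \<phi> k * indicator (cell_set n k) u) \<partial>unif01)"
    using cell_sum[OF assms, of _ \<phi>] by (intro Bochner_Integration.integral_cong refl) (simp only: space_unif01)
  also have "\<dots> = (\<Sum>k=1..n. \<integral>u. \<phi> k * indicator (cell_set n k) u \<partial>unif01)"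
    by (rule Bochner_Integration.integral_sum) (rule i)
  also have "\<dots> = (\<Sum>k=1..n. \<phi> k * (1 / real n))"
    by (intro sum.cong refl) (auto simp: cell_set_measurable measure_def emeasure_cell Int)
  finally show ?thesis by (simp add: sum_divide_distrib)
qed

lemma cell_joint_measurable:
  assumes "\<And>k. D k \<in> borel_measurable M"
  shows "(\<lambda>(u, x). D (cell n u) x) \<in> borel_measurable (unif01 \<Otimes>\<^sub>M M)"
  unfolding case_prod_unfold
proof (rule measurable_compose_countable)
  show "(\<lambda>z. D k (snd z)) \<in> borel_measurable (unif01 \<Otimes>\<^sub>M M)" for k
    by (rule measurable_compose[OF measurable_snd assms])
  show "(\<lambda>z. cell n (fst z)) \<in> measurable (unif01 \<Otimes>\<^sub>M M) (count_space UNIV)"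
    by (rule measurable_compose[OF measurable_fst cell_measurable])
qed

text \<open>By continuity of paths the process is the pointwise limit of step processes, which
  depend on \<open>u\<close> through countably many cells and are therefore jointly
  measurable.\<close>

lemma continuous_paths_joint_measurable:
  fixes \<beta> :: "real \<Rightarrow> 'b \<Rightarrow> real"
  assumes m: "\<And>t. t \<in> {0..1} \<Longrightarrow> \<beta> t \<in> borel_measurable N"
    and c: "\<And>x. x \<in> space N \<Longrightarrow> continuous_on {0..1} (\<lambda>t. \<beta> t x)"
  shows "(\<lambda>(u, x). \<beta> u x) \<in> borel_measurable (unif01 \<Otimes>\<^sub>M N)"
proof (rule borel_measurable_LIMSEQ_real)
  define q where "q i k = real k / (real (Suc i) + 1)" for i k
  show "(\<lambda>(u, x). (if q i (cell (Suc i) u) \<in> {0..1} then \<beta> (q i (cell (Suc i) u)) x else 0)) \<in> borel_measurable (unif01 \<Otimes>\<^sub>M N)" for i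
  proof (rule cell_joint_measurable)
    show "(\<lambda>x. if q i k \<in> {0..1} then \<beta> (q i k) x else 0) \<in> borel_measurable N" for k
      using m[of "q i k"] by (cases "q i k \<in> {0..1}") auto
  qed
  fix z assume "z \<in> space (unif01 \<Otimes>\<^sub>M N)"
  then obtain u x where z: "z = (u, x)" "u \<in> {0<..<1}" "x \<in> space N"
    by (cases z) (auto simp: space_pair_measure)
  have b: "\<bar>q i (cell (Suc i) u) - u\<bar> \<le> 1 / (real (Suc i) + 1)" "q i (cell (Suc i) u) \<in> {0..1}" for i
    using cell_bounds[of "Suc i" u] z by (auto simp: q_def)
  have "(\<lambda>i. q i (cell (Suc i) u)) \<longlonglongrightarrow> u"
  proof (rule LIM_zero_cancel, rule Lim_null_comparison)
    show "eventually (\<lambda>i. norm (q i (cell (Suc i) u) - u) \<le> 1 / (real (Suc i) + 1)) sequentially" using b(1) by simp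
    show "(\<lambda>i. 1 / (real (Suc i) + 1)) \<longlonglongrightarrow> 0" by real_asymp
  qed
  then have "(\<lambda>i. \<beta> (q i (cell (Suc i) u)) x) \<longlonglongrightarrow> \<beta> u x"
    by (rule continuous_on_tendsto_compose[OF c[OF z(3)]]) (use z b in auto)
  then show "(\<lambda>i. case z of (u, x) \<Rightarrow> (if q i (cell (Suc i) u) \<in> {0..1} then \<beta> (q i (cell (Suc i) u)) x else 0)) \<longlonglongrightarrow> (case z of (u, x) \<Rightarrow> \<beta> u x)"
    using b(2) by (simp add: z)
qed

section \<open>Tail bounds for uniform integrability\<close>

lemma integrable_process_tail:
  fixes Y :: "'i \<Rightarrow> 'b \<Rightarrow> real"
  assumes \<nu>: "sigma_finite_measure \<nu>" and N: "sigma_finite_measure N"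
    and Y: "(\<lambda>(u, x). Y u x) \<in> borel_measurable (\<nu> \<Otimes>\<^sub>M N)"
    and fin: "(\<integral>\<^sup>+u. \<integral>\<^sup>+x. ennreal (\<bar>Y u x\<bar> powr r) \<partial>N \<partial>\<nu>) < \<infinity>" and e: "0 < e"
  shows "\<exists>K. (\<integral>\<^sup>+u. \<integral>\<^sup>+x. ennreal (\<bar>Y u x\<bar> powr r * indicator {K<..} \<bar>Y u x\<bar>) \<partial>N \<partial>\<nu>) \<le> ennreal e"
proof -
  interpret N: sigma_finite_measure N by (rule N)
  have [measurable]: "(\<lambda>z. Y (fst z) (snd z)) \<in> borel_measurable (\<nu> \<Otimes>\<^sub>M N)"
    using Y by (simp add: case_prod_unfold)
  have iter: "(\<integral>\<^sup>+u. \<integral>\<^sup>+x. ennreal (h (Y u x)) \<partial>N \<partial>\<nu>) = (\<integral>\<^sup>+z. ennreal (h (Y (fst z) (snd z))) \<partial>(\<nu> \<Otimes>\<^sub>M N))"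
    if [measurable]: "h \<in> borel_measurable borel" for h
    by (subst N.nn_integral_fst[symmetric]) auto
  have hm: "(\<lambda>y::real. \<bar>y\<bar> powr r) \<in> borel_measurable borel" "(\<lambda>y::real. \<bar>y\<bar> powr r * indicator {K<..} \<bar>y\<bar>) \<in> borel_measurable borel" for K
    by measurable
  have "(\<lambda>n. \<integral>\<^sup>+z. ennreal (\<bar>Y (fst z) (snd z)\<bar> powr r * indicator {real n<..} \<bar>Y (fst z) (snd z)\<bar>) \<partial>(\<nu> \<Otimes>\<^sub>M N))
      \<longlonglongrightarrow> (\<integral>\<^sup>+z. 0 \<partial>(\<nu> \<Otimes>\<^sub>M N))"
  proof (rule nn_integral_dominated_convergence[where w="\<lambda>z. ennreal (\<bar>Y (fst z) (snd z)\<bar> powr r)"])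
    show "(\<integral>\<^sup>+z. ennreal (\<bar>Y (fst z) (snd z)\<bar> powr r) \<partial>(\<nu> \<Otimes>\<^sub>M N)) < \<infinity>"
      using fin iter[OF hm(1)] by simp
    show "AE z in \<nu> \<Otimes>\<^sub>M N. ennreal (\<bar>Y (fst z) (snd z)\<bar> powr r * indicator {real n<..} \<bar>Y (fst z) (snd z)\<bar>) \<le> ennreal (\<bar>Y (fst z) (snd z)\<bar> powr r)" for n
      by (auto intro!: ennreal_leI simp: indicator_def)
    show "AE z in \<nu> \<Otimes>\<^sub>M N. (\<lambda>n. ennreal (\<bar>Y (fst z) (snd z)\<bar> powr r * indicator {real n<..} \<bar>Y (fst z) (snd z)\<bar>)) \<longlonglongrightarrow> 0"
    proof (rule AE_I2, rule tendsto_eventually)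
      fix z
      have "eventually (\<lambda>n. \<bar>Y (fst z) (snd z)\<bar> \<le> real n) sequentially" by real_asymp
      then show "eventually (\<lambda>n. ennreal (\<bar>Y (fst z) (snd z)\<bar> powr r * indicator {real n<..} \<bar>Y (fst z) (snd z)\<bar>) = 0) sequentially"
        by eventually_elim (simp add: indicator_def)
    qed
  qed measurable
  then have "(\<lambda>n. \<integral>\<^sup>+z. ennreal (\<bar>Y (fst z) (snd z)\<bar> powr r * indicator {real n<..} \<bar>Y (fst z) (snd z)\<bar>) \<partial>(\<nu> \<Otimes>\<^sub>M N)) \<longlonglongrightarrow> 0" by simp
  then have "eventually (\<lambda>n. (\<integral>\<^sup>+z. ennreal (\<bar>Y (fst z) (snd z)\<bar> powr r * indicator {real n<..} \<bar>Y (fst z) (snd z)\<bar>) \<partial>(\<nu> \<Otimes>\<^sub>M N)) < ennreal e) sequentially"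
    using e by (intro order_tendstoD) auto
  then obtain n :: nat where "(\<integral>\<^sup>+z. ennreal (\<bar>Y (fst z) (snd z)\<bar> powr r * indicator {real n<..} \<bar>Y (fst z) (snd z)\<bar>) \<partial>(\<nu> \<Otimes>\<^sub>M N)) < ennreal e"
    using eventually_happens'[OF sequentially_bot] by blast
  then show ?thesis using iter[OF hm(2)[of "real n"]] by (intro exI[of _ "real n"]) auto
qed

text \<open>Where |D| exceeds \<open>K\<close>, the \<open>r\<close>-th power is at most the
  \<open>2 * r\<close>-th power divided by \<open>K powr r\<close>; so bounded moments of order
  \<open>2 * r\<close> make the tail small on \<open>A\<close>. Outside \<open>A\<close> nothing is
  gained from \<open>K\<close>, and the \<open>r\<close>-th moment itself has to be small.\<close>

lemma process_tail_split:
  fixes D :: "'i \<Rightarrow> 'a \<Rightarrow> real"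
  assumes \<nu>: "prob_space \<nu>" and D: "\<And>u. u \<in> space \<nu> \<Longrightarrow> D u \<in> borel_measurable M"
    and A: "A \<in> sets \<nu>" and K: "0 < K" and r: "0 < r" and B: "0 \<le> B"
    and h: "h \<in> borel_measurable \<nu>"
    and out: "\<And>u. u \<in> space \<nu> \<Longrightarrow> u \<notin> A \<Longrightarrow> (\<integral>\<^sup>+x. ennreal (\<bar>D u x\<bar> powr r) \<partial>M) \<le> h u"
    and mid: "\<And>u. u \<in> space \<nu> \<Longrightarrow> u \<in> A \<Longrightarrow> (\<integral>\<^sup>+x. ennreal (\<bar>D u x\<bar> powr (2 * r)) \<partial>M) \<le> ennreal B"
  shows "(\<integral>\<^sup>+u. \<integral>\<^sup>+x. ennreal (\<bar>D u x\<bar> powr r * indicator {K<..} \<bar>D u x\<bar>) \<partial>M \<partial>\<nu>) \<le> (\<integral>\<^sup>+u. h u \<partial>\<nu>) + ennreal (B / K powr r)"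
proof -
  interpret prob_space \<nu> by (rule \<nu>)
  have "(\<integral>\<^sup>+u. \<integral>\<^sup>+x. ennreal (\<bar>D u x\<bar> powr r * indicator {K<..} \<bar>D u x\<bar>) \<partial>M \<partial>\<nu>) \<le> (\<integral>\<^sup>+u. h u + ennreal (B / K powr r) \<partial>\<nu>)"
  proof (rule nn_integral_mono)
    fix u assume u: "u \<in> space \<nu>"
    have [measurable]: "D u \<in> borel_measurable M" by (rule D[OF u])
    show "(\<integral>\<^sup>+x. ennreal (\<bar>D u x\<bar> powr r * indicator {K<..} \<bar>D u x\<bar>) \<partial>M) \<le> h u + ennreal (B / K powr r)"
    proof (cases "u \<in> A")
      case False
      have "(\<integral>\<^sup>+x. ennreal (\<bar>D u x\<bar> powr r * indicator {K<..} \<bar>D u x\<bar>) \<partial>M) \<le> (\<integral>\<^sup>+x. ennreal (\<bar>D u x\<bar> powr r) \<partial>M)"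
        by (intro nn_integral_mono ennreal_leI) (auto simp: indicator_def)
      also have "\<dots> \<le> h u" by (rule out[OF u False])
      finally show ?thesis by (rule add_increasing2[rotated]) simp
    next
      case True
      have "(\<integral>\<^sup>+x. ennreal (\<bar>D u x\<bar> powr r * indicator {K<..} \<bar>D u x\<bar>) \<partial>M) \<le> (\<integral>\<^sup>+x. ennreal (1 / K powr r) * ennreal (\<bar>D u x\<bar> powr (2 * r)) \<partial>M)"
      proof (rule nn_integral_mono)
        fix x
        have "\<bar>D u x\<bar> powr r * indicator {K<..} \<bar>D u x\<bar> \<le> 1 / K powr r * \<bar>D u x\<bar> powr (2 * r)"
        proof (cases "K < \<bar>D u x\<bar>")
          case True
          have "K powr r \<le> \<bar>D u x\<bar> powr r" using True K r by (intro powr_mono2) auto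
          then have "K powr r * \<bar>D u x\<bar> powr r \<le> \<bar>D u x\<bar> powr r * \<bar>D u x\<bar> powr r" by (intro mult_right_mono) auto
          also have "\<dots> = \<bar>D u x\<bar> powr (2 * r)" by (simp add: powr_add[symmetric])
          finally show ?thesis using True K by (simp add: field_simps)
        qed (simp add: indicator_def)
        then have "ennreal (\<bar>D u x\<bar> powr r * indicator {K<..} \<bar>D u x\<bar>) \<le> ennreal (1 / K powr r * \<bar>D u x\<bar> powr (2 * r))" by (rule ennreal_leI)
        then show "ennreal (\<bar>D u x\<bar> powr r * indicator {K<..} \<bar>D u x\<bar>) \<le> ennreal (1 / K powr r) * ennreal (\<bar>D u x\<bar> powr (2 * r))"
          by (subst ennreal_mult[symmetric]) auto
      qed
      also have "\<dots> = ennreal (1 / K powr r) * (\<integral>\<^sup>+x. ennreal (\<bar>D u x\<bar> powr (2 * r)) \<partial>M)"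
        by (rule nn_integral_cmult) measurable
      also have "\<dots> \<le> ennreal (1 / K powr r) * ennreal B" by (intro mult_left_mono mid u True) simp
      also have "\<dots> = ennreal (B / K powr r)" using B by (subst ennreal_mult[symmetric]) auto
      finally show ?thesis by (rule add_increasing[rotated]) simp
    qed
  qed
  also have "\<dots> = (\<integral>\<^sup>+u. h u \<partial>\<nu>) + ennreal (B / K powr r)"
    using h by (subst nn_integral_add) (auto simp: emeasure_space_1)
  finally show ?thesis .
qed

subsection \<open>The truncated quantile process\<close>

text \<open>\<open>comparable\<close> is the common consequence of the two alternatives in
  hypothesis (ii): control of the quantile density near those \<open>u\<close> at which the weight
  does not vanish. The majorant \<open>g\<close> bounds the \<open>r\<close>-th power of the scale
  \<open>a\<close> introduced below.\<close>

locale quantile_functional = smooth_df F f + iid_uniform M U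
  for F f :: "real \<Rightarrow> real" and M :: "'a measure" and U :: "nat \<Rightarrow> 'a \<Rightarrow> real" +
  fixes r :: real and \<omega> g :: "real \<Rightarrow> real" and N :: "'b measure" and \<beta> :: "real \<Rightarrow> 'b \<Rightarrow> real"
  assumes r: "1 \<le> r"
    and \<omega>_nonneg: "\<And>x. 0 \<le> \<omega> x"
    and \<omega>_cont: "continuous_on UNIV \<omega>"
    and comparable: "\<And>L. 1 \<le> L \<Longrightarrow> \<exists>C\<ge>1. \<forall>u\<in>{0<..<1}. \<omega> (quantile F u) \<noteq> 0 \<longrightarrow>
       (\<forall>\<theta>\<in>{0<..<1}. close_ratio L u \<theta> \<longrightarrow> quantile_density F f \<theta> \<le> C * quantile_density F f u)"
    and g_rv: "regularly_varying_at_endpoints g"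
    and g_int: "integrable (lebesgue_on {0<..<1}) g"
    and dominated: "\<And>u. u \<in> {0<..<1} \<Longrightarrow> \<omega> (quantile F u) * (quantile_density F f u * sqrt (u * (1 - u))) powr r \<le> g u"
    and bridge: "standard_brownian_bridge N \<beta>"
begin

text \<open>The weight enters the process as its \<open>r\<close>-th root, so that the statistic
  becomes a plain integral of |.|^r.\<close>

definition a0 :: "real \<Rightarrow> real" where "a0 u = \<omega> (Q u) powr (1 / r)"

text \<open>The standard deviation of \<open>Y u\<close>, and up to constants the size of the
  truncated process at \<open>u\<close>.\<close>

definition a :: "real \<Rightarrow> real" where "a u = a0 u * \<eta> u * sqrt (u * (1 - u))"

lemma a0_nonneg: "0 \<le> a0 u" by (simp add: a0_def)

lemma a0_powr: "a0 u powr r = \<omega> (Q u)"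
  using r \<omega>_nonneg by (simp add: a0_def powr_powr)

lemma a0_cont: "continuous_on {0<..<1} a0"
proof -
  have "continuous_on {0<..<1} (\<lambda>u. \<omega> (Q u))"
    by (rule continuous_on_compose2[OF \<omega>_cont Q_cont]) auto
  then show ?thesis unfolding a0_def[abs_def]
    using \<omega>_nonneg r by (intro continuous_on_powr' continuous_on_const) auto
qed

lemma a_cont: "continuous_on {0<..<1} a"
  unfolding a_def[abs_def] by (intro continuous_intros a0_cont \<eta>_cont)

lemma a_nonneg: "u \<in> {0<..<1} \<Longrightarrow> 0 \<le> a u"
  using \<eta>_pos[of u] a0_nonneg by (auto simp: a_def intro!: mult_nonneg_nonneg)

lemma a_powr_le: assumes u: "u \<in> {0<..<1}" shows "a u powr r \<le> g u"
proof -
  have "a u powr r = \<omega> (Q u) * (\<eta> u * sqrt (u * (1 - u))) powr r"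
    using u \<eta>_pos[of u] a0_nonneg[of u] by (simp add: a_def mult.assoc powr_mult a0_powr)
  then show ?thesis using dominated[OF u] by simp
qed

lemma continuous_unif01_measurable: "continuous_on {0<..<1} h \<Longrightarrow> (h :: real \<Rightarrow> real) \<in> borel_measurable unif01"
  unfolding unif01_def
  by (subst measurable_cong_sets[OF sets_restrict_space_cong[OF sets_lborel] refl]) (rule borel_measurable_continuous_on_restrict)

lemma g_pos: "u \<in> {0<..<1} \<Longrightarrow> 0 < g u"
  using g_rv by (auto simp: regularly_varying_at_endpoints_def regularly_varying_at_0_def)

definition Y :: "real \<Rightarrow> 'b \<Rightarrow> real" where "Y u x = a0 u * \<eta> u * \<beta> u x"

lemma Y_meas: "(\<lambda>(u, x). Y u x) \<in> borel_measurable (unif01 \<Otimes>\<^sub>M N)"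
proof -
  have [measurable]: "(\<lambda>(u, x). \<beta> u x) \<in> borel_measurable (unif01 \<Otimes>\<^sub>M N)"
    by (rule continuous_paths_joint_measurable) (use bridge in \<open>auto simp: standard_brownian_bridge_def\<close>)
  have [measurable]: "(\<lambda>u. a0 u * \<eta> u) \<in> borel_measurable unif01"
    by (intro continuous_unif01_measurable continuous_intros a0_cont \<eta>_cont)
  have [measurable]: "(\<lambda>z. \<beta> (fst z) (snd z)) \<in> borel_measurable (unif01 \<Otimes>\<^sub>M N)"
    using \<open>(\<lambda>(u, x). \<beta> u x) \<in> _\<close> by (simp add: case_prod_unfold)
  have [measurable]: "(\<lambda>z. a0 (fst z) * \<eta> (fst z)) \<in> borel_measurable (unif01 \<Otimes>\<^sub>M N)"
    by (rule measurable_compose[OF measurable_fst \<open>(\<lambda>u. a0 u * \<eta> u) \<in> _\<close>])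
  show ?thesis unfolding Y_def case_prod_unfold by measurable
qed

lemma Y_powr: "u \<in> {0<..<1} \<Longrightarrow> \<bar>Y u x\<bar> powr r = \<omega> (Q u) * \<eta> u powr r * \<bar>\<beta> u x\<bar> powr r"
  using \<eta>_pos[of u] a0_nonneg[of u] by (simp add: Y_def abs_mult powr_mult a0_powr)

lemma Y_moment:
  assumes u: "u \<in> {0<..<1}" and p: "0 \<le> p" "p \<le> real (2 * m)"
  shows "(\<integral>\<^sup>+x. ennreal (\<bar>Y u x\<bar> powr p) \<partial>N) \<le> ennreal ((1 + fact (2 * m) / (2 ^ m * fact m)) * a u powr p)"
proof -
  define c where "c = a0 u * \<eta> u"
  have c: "0 \<le> c" using \<eta>_pos[of u] a0_nonneg u by (auto simp: c_def)
  have [measurable]: "\<beta> u \<in> borel_measurable N" using bridge_meas[OF bridge, of u] u by auto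
  have "(\<integral>\<^sup>+x. ennreal (\<bar>Y u x\<bar> powr p) \<partial>N) = (\<integral>\<^sup>+x. ennreal (c powr p) * ennreal (\<bar>\<beta> u x\<bar> powr p) \<partial>N)"
    using c by (intro nn_integral_cong) (simp add: Y_def c_def[symmetric] abs_mult powr_mult ennreal_mult)
  also have "\<dots> = ennreal (c powr p) * (\<integral>\<^sup>+x. ennreal (\<bar>\<beta> u x\<bar> powr p) \<partial>N)"
    by (rule nn_integral_cmult) measurable
  also have "\<dots> \<le> ennreal (c powr p) * ennreal ((1 + fact (2 * m) / (2 ^ m * fact m)) * sqrt (u * (1 - u)) powr p)"
    by (intro mult_left_mono bridge_abs_moment[OF bridge _ _ p]) (use u in auto)
  also have "\<dots> = ennreal (c powr p * ((1 + fact (2 * m) / (2 ^ m * fact m)) * sqrt (u * (1 - u)) powr p))"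
    by (rule ennreal_mult[symmetric]) (auto intro!: mult_nonneg_nonneg add_nonneg_nonneg)
  also have "c powr p * ((1 + fact (2 * m) / (2 ^ m * fact m)) * sqrt (u * (1 - u)) powr p)
     = (1 + fact (2 * m) / (2 ^ m * fact m)) * a u powr p"
    using c u by (simp add: a_def c_def[symmetric] powr_mult)
  finally show ?thesis .
qed

lemma Y_tail:
  assumes e: "0 < e"
  shows "\<exists>K. (\<integral>\<^sup>+u. \<integral>\<^sup>+x. ennreal (\<bar>Y u x\<bar> powr r * indicator {K<..} \<bar>Y u x\<bar>) \<partial>N \<partial>unif01) \<le> ennreal e"
proof (rule integrable_process_tail[OF _ _ Y_meas _ e])
  interpret N: prob_space N by (rule bridge_prob_space[OF bridge])
  interpret I: prob_space unif01 by (rule prob_space_unif01)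
  show "sigma_finite_measure unif01" "sigma_finite_measure N" by unfold_locales
  obtain m :: nat where m: "r \<le> real (2 * m)" using real_arch_simple[of r] by (metis le_add2 mult_2 of_nat_le_iff order.trans)
  define C where "C = (1 + fact (2 * m) / (2 ^ m * fact m) :: real)"
  have C: "0 \<le> C" by (simp add: C_def)
  have gi: "(\<integral>\<^sup>+u. ennreal (g u) \<partial>lebesgue_on {0<..<1}) < \<infinity>"
  proof -
    have "AE u in lebesgue_on {0<..<1}. 0 \<le> g u" by (rule AE_I2) (simp add: g_pos less_imp_le)
    then show ?thesis using nn_integral_eq_integral[OF g_int] by simp
  qed
  have am[measurable]: "a \<in> borel_measurable unif01" by (rule continuous_unif01_measurable[OF a_cont])
  have "(\<integral>\<^sup>+u. ennreal (a u powr r) \<partial>unif01) = (\<integral>\<^sup>+u. ennreal (a u powr r) * indicator {0<..<1} u \<partial>lborel)"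
    unfolding unif01_def by (rule nn_integral_restrict_space) auto
  \<comment> \<open>The majorant \<open>g\<close> is only Lebesgue measurable, so the integral is
    moved to the completed measure before comparing.\<close>
  also have "\<dots> = (\<integral>\<^sup>+u. ennreal (a u powr r) * indicator {0<..<1} u \<partial>lebesgue)"
    by (rule nn_integral_completion[symmetric])
  also have "\<dots> = (\<integral>\<^sup>+u. ennreal (a u powr r) \<partial>lebesgue_on {0<..<1})"
    by (rule nn_integral_restrict_space[symmetric]) auto
  also have "\<dots> \<le> (\<integral>\<^sup>+u. ennreal (g u) \<partial>lebesgue_on {0<..<1})"
    by (intro nn_integral_mono ennreal_leI a_powr_le) simp
  finally have ai: "(\<integral>\<^sup>+u. ennreal (a u powr r) \<partial>unif01) < \<infinity>" using gi by simp
  have "(\<integral>\<^sup>+u. \<integral>\<^sup>+x. ennreal (\<bar>Y u x\<bar> powr r) \<partial>N \<partial>unif01) \<le> (\<integral>\<^sup>+u. ennreal C * ennreal (a u powr r) \<partial>unif01)"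
  proof (rule nn_integral_mono)
    fix u assume "u \<in> space unif01"
    then have "(\<integral>\<^sup>+x. ennreal (\<bar>Y u x\<bar> powr r) \<partial>N) \<le> ennreal (C * a u powr r)"
      unfolding C_def using m r by (intro Y_moment) auto
    then show "(\<integral>\<^sup>+x. ennreal (\<bar>Y u x\<bar> powr r) \<partial>N) \<le> ennreal C * ennreal (a u powr r)"
      using C by (simp add: ennreal_mult)
  qed
  also have "\<dots> = ennreal C * (\<integral>\<^sup>+u. ennreal (a u powr r) \<partial>unif01)" by (rule nn_integral_cmult) measurable
  also have "\<dots> < \<infinity>" using ai by (simp add: ennreal_mult_less_top)
  finally show "(\<integral>\<^sup>+u. \<integral>\<^sup>+x. ennreal (\<bar>Y u x\<bar> powr r) \<partial>N \<partial>unif01) < \<infinity>" .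
qed

text \<open>Setting the normalised quantile process to zero where the order statistic is not within a
  factor \<open>L\<close> of its mean is needed to have moments: those of the untruncated process can be
  infinite near the endpoints.\<close>
definition D' :: "real \<Rightarrow> nat \<Rightarrow> nat \<Rightarrow> 'a \<Rightarrow> real" where
  "D' L n k x = (if 1 \<le> k \<and> k \<le> n \<and> close_ratio L (real k / (real n + 1)) (uos n k x)
     then a0 (real k / (real n + 1)) * (sqrt (real n) * (Q (uos n k x) - Q (real k / (real n + 1)))) else 0)"

lemma Q_uos_meas:
  assumes k: "1 \<le> k" "k \<le> n"
  shows "(\<lambda>x. Q (uos n k x)) \<in> borel_measurable M"
proof -
  have "uos n k \<in> measurable M (restrict_space borel {0<..<1})"
    using uos_meas[OF k] uos_range[OF k] by (intro measurable_restrict_space2) auto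
  moreover have "Q \<in> borel_measurable (restrict_space borel {0<..<1})"
    by (rule borel_measurable_mono_on_fnc[OF quantile_mono_on[OF F]])
  ultimately show ?thesis by (rule measurable_compose)
qed

lemma D'_meas: "D' L n k \<in> borel_measurable M"
proof (cases "1 \<le> k \<and> k \<le> n")
  case True
  then have [measurable]: "uos n k \<in> borel_measurable M" "(\<lambda>x. Q (uos n k x)) \<in> borel_measurable M"
    using uos_meas Q_uos_meas by auto
  show ?thesis unfolding D'_def[abs_def] close_ratio_def by measurable
next
  case False
  then have eq: "D' L n k = (\<lambda>_. 0)" by (auto simp: D'_def fun_eq_iff)
  show ?thesis unfolding eq by simp
qed

text \<open>The mean value theorem evaluates the quantile density at a point between the order
  statistic and its mean, and this point has to satisfy the closeness condition too.\<close>

lemma close_ratio_between: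
  assumes "1 \<le> L" "close_ratio L u v" "u \<in> {0<..<1}" "\<theta> \<in> {min v u..max v u}"
  shows "close_ratio L u \<theta>"
proof -
  have "1 * u \<le> L * u" "1 * (1 - u) \<le> L * (1 - u)" using assms by (auto intro!: mult_right_mono)
  then have uu: "u \<le> L * u" "1 - u \<le> L * (1 - u)" by auto
  consider "u \<le> \<theta>" "\<theta> \<le> v" | "v \<le> \<theta>" "\<theta> \<le> u" using assms(4) by (auto simp: min_def max_def split: if_splits)
  then show ?thesis
  proof cases
    case 1
    have "L * u \<le> L * \<theta>" "L * (1 - v) \<le> L * (1 - \<theta>)" using 1 assms(1) by (auto intro!: mult_left_mono)
    then show ?thesis using 1 assms(2) uu unfolding close_ratio_def by auto
  next
    case 2
    have "L * v \<le> L * \<theta>" "L * (1 - u) \<le> L * (1 - \<theta>)" using 2 assms(1) by (auto intro!: mult_left_mono)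
    then show ?thesis using 2 assms(2) uu unfolding close_ratio_def by auto
  qed
qed

text \<open>On the truncation event the intermediate point of the mean value theorem is within a
  factor \<open>L\<close> of the mean, so its quantile density is at most \<open>C\<close> times the
  one at the mean. \<open>C\<close> depends on \<open>L\<close> but not on \<open>n\<close> or
  \<open>k\<close>.\<close>

lemma D'_le_V:
  assumes L: "1 \<le> L"
  shows "\<exists>C\<ge>1. \<forall>n k. \<forall>x\<in>space M. 1 \<le> k \<longrightarrow> k \<le> n \<longrightarrow>
    \<bar>D' L n k x\<bar> \<le> C * (a0 (real k / (real n + 1)) * \<eta> (real k / (real n + 1))) * \<bar>V n k x\<bar>"
proof -
  obtain C where C: "1 \<le> C" and H: "\<And>u \<theta>. u \<in> {0<..<1} \<Longrightarrow> \<omega> (Q u) \<noteq> 0 \<Longrightarrow> \<theta> \<in> {0<..<1} \<Longrightarrow> close_ratio L u \<theta> \<Longrightarrow> \<eta> \<theta> \<le> C * \<eta> u"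
    using comparable[OF L] by blast
  have "\<bar>D' L n k x\<bar> \<le> C * (a0 (real k / (real n + 1)) * \<eta> (real k / (real n + 1))) * \<bar>V n k x\<bar>"
    if x: "x \<in> space M" and k: "1 \<le> k" "k \<le> n" for n k x
  proof -
    define u v where "u = real k / (real n + 1)" and "v = uos n k x"
    have u: "u \<in> {0<..<1}" using k by (auto simp: u_def)
    have v: "v \<in> {0<..<1}" using uos_range[OF k x] by (simp add: v_def)
    have nn: "0 \<le> C * (a0 u * \<eta> u) * \<bar>V n k x\<bar>" using C a0_nonneg \<eta>_pos[of u] u by (auto intro!: mult_nonneg_nonneg)
    show ?thesis
    proof (cases "close_ratio L u v \<and> \<omega> (Q u) \<noteq> 0")
      case True
      obtain \<theta> where th: "\<theta> \<in> {min v u..max v u}" "Q v - Q u = \<eta> \<theta> * (v - u)" using Q_mvt[OF v u] by blast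
      have th01: "\<theta> \<in> {0<..<1}" using th(1) u v by (auto simp: min_def max_def split: if_splits)
      have "close_ratio L u \<theta>" by (rule close_ratio_between[OF L _ u th(1)]) (use True in simp)
      then have eta: "\<eta> \<theta> \<le> C * \<eta> u" using True by (intro H[OF u _ th01]) auto
      have eta_pos: "0 < \<eta> \<theta>" using th01 by (intro \<eta>_pos) auto
      have "\<bar>D' L n k x\<bar> = a0 u * \<eta> \<theta> * \<bar>V n k x\<bar>"
        using True k th(2) a0_nonneg[of u] eta_pos by (simp add: D'_def V_def u_def[symmetric] v_def[symmetric] abs_mult)
      also have "\<dots> \<le> a0 u * (C * \<eta> u) * \<bar>V n k x\<bar>"
        using eta a0_nonneg by (intro mult_right_mono mult_left_mono) auto
      also have "\<dots> = C * (a0 u * \<eta> u) * \<bar>V n k x\<bar>" by (simp only: mult_ac)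
      finally show ?thesis unfolding u_def .
    next
      case False
      \<comment> \<open>Either the truncation is active or the weight vanishes, and then its root
        \<open>a0\<close> is 0 as well.\<close>
      then have "D' L n k x = 0" using r by (auto simp: D'_def u_def[symmetric] v_def[symmetric] a0_def)
      then show ?thesis using nn unfolding u_def by simp
    qed
  qed
  then show ?thesis using C by blast
qed

lemma V_moment:
  assumes k: "1 \<le> k" "k \<le> n" and p: "0 \<le> p" "p \<le> real (2 * m)"
  defines "u \<equiv> real k / (real n + 1)"
  shows "(\<integral>\<^sup>+x. ennreal (\<bar>V n k x\<bar> powr p) \<partial>M) \<le> ennreal ((1 + moment_const (2 * m)) * sqrt (u * (1 - u)) powr p)"
proof -
  have [measurable]: "uos n k \<in> borel_measurable M" by (rule uos_meas[OF k])
  have u01: "0 \<le> u" "u \<le> 1" using k by (auto simp: u_def)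
  have "(\<integral>\<^sup>+x. ennreal (\<bar>V n k x\<bar> powr p) \<partial>M)
     = (\<integral>\<^sup>+x. ennreal (sqrt (real n) powr p) * ennreal (\<bar>uos n k x - real k / (real n + 1)\<bar> powr p) \<partial>M)"
    using k by (intro nn_integral_cong) (simp add: V_def abs_mult powr_mult ennreal_mult)
  also have "\<dots> = ennreal (sqrt (real n) powr p) * (\<integral>\<^sup>+x. ennreal (\<bar>uos n k x - real k / (real n + 1)\<bar> powr p) \<partial>M)"
    by (rule nn_integral_cmult) measurable
  also have "\<dots> \<le> ennreal (sqrt (real n) powr p) * ennreal ((1 + moment_const (2 * m)) * sd n k powr p)"
    by (intro mult_left_mono uos_abs_moment[OF k p]) simp
  also have "\<dots> = ennreal (sqrt (real n) powr p * ((1 + moment_const (2 * m)) * sd n k powr p))"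
    by (rule ennreal_mult[symmetric]) (auto intro!: mult_nonneg_nonneg add_nonneg_nonneg moment_const_nonneg)
  also have "\<dots> \<le> ennreal ((1 + moment_const (2 * m)) * sqrt (u * (1 - u)) powr p)"
  proof (rule ennreal_leI)
    have "sqrt (real n) powr p * sd n k powr p = (sqrt (real n) * sd n k) powr p"
      using sd_pos[OF k] by (simp add: powr_mult)
    also have "\<dots> \<le> sqrt (u * (1 - u)) powr p"
    proof (rule powr_mono2[OF p(1)])
      show "0 \<le> sqrt (real n) * sd n k" using sd_pos[OF k] by simp
      have "sqrt (real n) * sd n k = sqrt (u * (1 - u) * (real n / (real n + 1)))"
        by (simp add: sd_def u_def real_sqrt_mult[symmetric] mult_ac)
      also have "\<dots> \<le> sqrt (u * (1 - u) * 1)" using u01 by (intro real_sqrt_le_mono mult_left_mono) auto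
      finally show "sqrt (real n) * sd n k \<le> sqrt (u * (1 - u))" by simp
    qed
    finally have "sqrt (real n) powr p * sd n k powr p \<le> sqrt (u * (1 - u)) powr p" .
    then have "(1 + moment_const (2 * m)) * (sqrt (real n) powr p * sd n k powr p) \<le> (1 + moment_const (2 * m)) * sqrt (u * (1 - u)) powr p"
      using moment_const_nonneg[of "2 * m"] by (intro mult_left_mono) auto
    then show "sqrt (real n) powr p * ((1 + moment_const (2 * m)) * sd n k powr p) \<le> (1 + moment_const (2 * m)) * sqrt (u * (1 - u)) powr p"
      by (simp only: mult_ac)
  qed
  finally show ?thesis .
qed

lemma D'_moment:
  assumes L: "1 \<le> L" and p: "0 \<le> p"
  shows "\<exists>K\<ge>0. \<forall>n k. 1 \<le> k \<longrightarrow> k \<le> n \<longrightarrow>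
    (\<integral>\<^sup>+x. ennreal (\<bar>D' L n k x\<bar> powr p) \<partial>M) \<le> ennreal (K * a (real k / (real n + 1)) powr p)"
proof -
  obtain C where C: "1 \<le> C" "\<And>n k x. x \<in> space M \<Longrightarrow> 1 \<le> k \<Longrightarrow> k \<le> n \<Longrightarrow>
    \<bar>D' L n k x\<bar> \<le> C * (a0 (real k / (real n + 1)) * \<eta> (real k / (real n + 1))) * \<bar>V n k x\<bar>"
    using D'_le_V[OF L] by blast
  obtain m :: nat where m: "p \<le> real (2 * m)" using real_arch_simple[of p] by (metis le_add2 mult_2 of_nat_le_iff order.trans)
  define K where "K = C powr p * (1 + moment_const (2 * m))"
  have mc: "0 \<le> 1 + moment_const (2 * m)" using moment_const_nonneg[of "2 * m"] by simp
  have "(\<integral>\<^sup>+x. ennreal (\<bar>D' L n k x\<bar> powr p) \<partial>M) \<le> ennreal (K * a (real k / (real n + 1)) powr p)"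
    if k: "1 \<le> k" "k \<le> n" for n k
  proof -
    define u where "u = real k / (real n + 1)"
    define c where "c = C * (a0 u * \<eta> u)"
    have u: "u \<in> {0<..<1}" using k by (auto simp: u_def)
    have c: "0 \<le> c" using C(1) a0_nonneg \<eta>_pos[of u] u by (auto simp: c_def intro!: mult_nonneg_nonneg)
    have "(\<integral>\<^sup>+x. ennreal (\<bar>D' L n k x\<bar> powr p) \<partial>M) \<le> (\<integral>\<^sup>+x. ennreal (c powr p) * ennreal (\<bar>V n k x\<bar> powr p) \<partial>M)"
    proof (rule nn_integral_mono)
      fix x assume x: "x \<in> space M"
      have "\<bar>D' L n k x\<bar> powr p \<le> (c * \<bar>V n k x\<bar>) powr p"
        using C(2)[OF x k] p by (intro powr_mono2) (auto simp: c_def u_def)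
      also have "\<dots> = c powr p * \<bar>V n k x\<bar> powr p" using c by (simp add: powr_mult)
      finally show "ennreal (\<bar>D' L n k x\<bar> powr p) \<le> ennreal (c powr p) * ennreal (\<bar>V n k x\<bar> powr p)"
        by (subst ennreal_mult[symmetric]) (auto intro: ennreal_leI)
    qed
    also have "\<dots> = ennreal (c powr p) * (\<integral>\<^sup>+x. ennreal (\<bar>V n k x\<bar> powr p) \<partial>M)"
      by (rule nn_integral_cmult) measurable
    also have "\<dots> \<le> ennreal (c powr p) * ennreal ((1 + moment_const (2 * m)) * sqrt (u * (1 - u)) powr p)"
      unfolding u_def by (intro mult_left_mono V_moment[OF k p m]) simp
    also have "\<dots> = ennreal (c powr p * ((1 + moment_const (2 * m)) * sqrt (u * (1 - u)) powr p))"
      using mc by (intro ennreal_mult[symmetric]) auto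
    also have "c powr p * ((1 + moment_const (2 * m)) * sqrt (u * (1 - u)) powr p) = K * a u powr p"
      using C(1) a0_nonneg[of u] \<eta>_pos[of u] u by (simp add: c_def K_def a_def powr_mult mult_ac)
    finally show ?thesis unfolding u_def .
  qed
  moreover have "0 \<le> K" using mc by (simp add: K_def)
  ultimately show ?thesis by blast
qed

end

text \<open>Reflection reduces Riemann sums at the endpoint 1 to those at 0.\<close>

lemma integrable_lebesgue_on_reflect:
  fixes g :: "real \<Rightarrow> real"
  assumes "integrable (lebesgue_on {0<..<1}) g"
  shows "integrable (lebesgue_on {0<..<1}) (\<lambda>t. g (1 - t))"
proof -
  define h where "h x = indicator {0<..<1} x *\<^sub>R g x" for x :: real
  have h: "integrable lebesgue h"
    using assms unfolding h_def[abs_def] by (subst (asm) integrable_restrict_space) auto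
  have T: "(\<lambda>x::real. 1 + (-1) * x) \<in> lebesgue \<rightarrow>\<^sub>M lebesgue"
    using lebesgue_affine_measurable[of "\<lambda>_::real. -1" 1] by simp
  have eq: "lebesgue = distr lebesgue lebesgue (\<lambda>x::real. 1 + (-1) * x)"
    using lebesgue_real_affine[of "-1" 1] by (simp add: density_1)
  have "integrable (distr lebesgue lebesgue (\<lambda>x::real. 1 + (-1) * x)) h" using h eq by simp
  then have "integrable lebesgue (\<lambda>x. h (1 + (-1) * x))"
    by (subst (asm) integrable_distr_eq[OF T]) (use h in auto)
  also have "(\<lambda>x. h (1 + (-1) * x)) = (\<lambda>x. indicator {0<..<1} x *\<^sub>R g (1 - x))"
    by (auto simp: h_def fun_eq_iff indicator_def)
  finally show ?thesis by (subst integrable_restrict_space) auto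
qed

section \<open>Limits of the truncated process\<close>

context quantile_functional
begin

text \<open>Differentiability of \<open>Q\<close> at \<open>u\<close> alone would not do, because
  the mean k/(n + 1) and the order statistic both move with \<open>n\<close>. Continuity of
  \<open>a0\<close> and of the derivative at \<open>u\<close> gives a bound uniform over both
  points.\<close>

lemma delta_method_bound:
  assumes u: "u \<in> {0<..<1}" and e: "0 < e" and L: "2 \<le> L"
  shows "\<exists>\<tau>>0. \<forall>u' \<theta>. \<bar>u' - u\<bar> < \<tau> \<longrightarrow> \<bar>\<theta> - u\<bar> < \<tau> \<longrightarrow> close_ratio L u' \<theta> \<and>
     \<bar>a0 u' * (Q \<theta> - Q u') - a0 u * \<eta> u * (\<theta> - u')\<bar> \<le> e * \<bar>\<theta> - u'\<bar>"
proof -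
  have op: "open {0<..<1::real}" by simp
  have ca: "isCont a0 u" and c\<eta>: "isCont \<eta> u"
    using a0_cont \<eta>_cont u by (auto simp: continuous_on_eq_continuous_at[OF op])
  \<comment> \<open>The difference of products is split as a0 u' (\<eta> v - \<eta> u) + (a0 u' - a0
    u) \<eta> u, each part costing e/2; the minimum with 1 bounds |a0 u'| by |a0 u| + 1 in the first
    part.\<close>
  define e1 where "e1 = min 1 (e / (2 * (\<bar>\<eta> u\<bar> + 1)))"
  define e2 where "e2 = e / (2 * (\<bar>a0 u\<bar> + 1))"
  have e12: "0 < e1" "0 < e2" using e by (auto simp: e1_def e2_def intro!: divide_pos_pos add_nonneg_pos)
  obtain d1 where d1: "0 < d1" "\<And>v. \<bar>v - u\<bar> < d1 \<Longrightarrow> \<bar>a0 v - a0 u\<bar> < e1"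
    using ca e12(1) unfolding continuous_at_eps_delta by (auto simp: dist_real_def)
  obtain d2 where d2: "0 < d2" "\<And>v. \<bar>v - u\<bar> < d2 \<Longrightarrow> \<bar>\<eta> v - \<eta> u\<bar> < e2"
    using c\<eta> e12(2) unfolding continuous_at_eps_delta by (auto simp: dist_real_def)
  \<comment> \<open>A quarter of the distance to each endpoint keeps all ratios below (5/4)/(3/4) =
    5/3, hence below \<open>L\<close>: near \<open>u\<close> the truncation is inactive.\<close>
  define \<tau> where "\<tau> = min (min d1 d2) (min (u / 4) ((1 - u) / 4))"
  have \<tau>: "0 < \<tau>" "\<tau> \<le> d1" "\<tau> \<le> d2" "\<tau> \<le> u / 4" "\<tau> \<le> (1 - u) / 4"
  proof -
    have m: "\<tau> \<le> min d1 d2" "\<tau> \<le> min (u / 4) ((1 - u) / 4)" unfolding \<tau>_def by (rule min.cobounded1, rule min.cobounded2)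
    show "\<tau> \<le> d1" "\<tau> \<le> d2" "\<tau> \<le> u / 4" "\<tau> \<le> (1 - u) / 4"
      using order_trans[OF m(1) min.cobounded1] order_trans[OF m(1) min.cobounded2]
        order_trans[OF m(2) min.cobounded1] order_trans[OF m(2) min.cobounded2] by blast+
    show "0 < \<tau>" using d1(1) d2(1) u unfolding \<tau>_def by simp
  qed
  have "close_ratio L u' \<theta> \<and> \<bar>a0 u' * (Q \<theta> - Q u') - a0 u * \<eta> u * (\<theta> - u')\<bar> \<le> e * \<bar>\<theta> - u'\<bar>"
    if h: "\<bar>u' - u\<bar> < \<tau>" "\<bar>\<theta> - u\<bar> < \<tau>" for u' \<theta>
  proof
    have b: "3/4 * u < u'" "u' < 5/4 * u" "3/4 * u < \<theta>" "\<theta> < 5/4 * u"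
      "3/4 * (1 - u) < 1 - u'" "1 - u' < 5/4 * (1 - u)" "3/4 * (1 - u) < 1 - \<theta>" "1 - \<theta> < 5/4 * (1 - u)"
      using h \<tau> by (auto simp: abs_less_iff)
    have u': "u' \<in> {0<..<1}" and th: "\<theta> \<in> {0<..<1}" using b u by auto
    have cr: "p \<le> L * q" if "3/4 * w < q" "p < 5/4 * w" "0 < w" for p q w
    proof -
      have "2 * q \<le> L * q" using L that by (intro mult_right_mono) auto
      then show ?thesis using that by linarith
    qed
    show "close_ratio L u' \<theta>" unfolding close_ratio_def
      using u by (intro conjI cr[OF b(3,2)] cr[OF b(1,4)] cr[OF b(7,6)] cr[OF b(5,8)]) auto
    obtain v where v: "v \<in> {min \<theta> u'..max \<theta> u'}" "Q \<theta> - Q u' = \<eta> v * (\<theta> - u')" using Q_mvt[OF th u'] by blast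
    have "\<bar>v - u\<bar> < \<tau>" using v(1) h by (auto simp: min_def max_def abs_less_iff split: if_splits)
    then have eta: "\<bar>\<eta> v - \<eta> u\<bar> < e2" using d2 \<tau> by auto
    have aa: "\<bar>a0 u' - a0 u\<bar> < e1" using d1 \<tau> h by auto
    then have au: "\<bar>a0 u'\<bar> \<le> \<bar>a0 u\<bar> + 1" by (auto simp: e1_def)
    have "\<bar>a0 u' * \<eta> v - a0 u * \<eta> u\<bar> = \<bar>a0 u' * (\<eta> v - \<eta> u) + (a0 u' - a0 u) * \<eta> u\<bar>" by (simp add: algebra_simps)
    also have "\<dots> \<le> \<bar>a0 u'\<bar> * \<bar>\<eta> v - \<eta> u\<bar> + \<bar>a0 u' - a0 u\<bar> * \<bar>\<eta> u\<bar>"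
      by (rule order_trans[OF abs_triangle_ineq]) (simp add: abs_mult)
    also have "\<dots> \<le> (\<bar>a0 u\<bar> + 1) * e2 + e / (2 * (\<bar>\<eta> u\<bar> + 1)) * (\<bar>\<eta> u\<bar> + 1)"
      using au eta aa e by (intro add_mono mult_mono) (auto simp: e1_def)
    also have "\<dots> = e"
    proof -
      have "\<bar>a0 u\<bar> + 1 \<noteq> 0" "\<bar>\<eta> u\<bar> + 1 \<noteq> 0" using abs_ge_zero[of "a0 u"] abs_ge_zero[of "\<eta> u"] by linarith+
      moreover have "x * (e / (2 * x)) + e / (2 * y) * y = e" if "x \<noteq> 0" "y \<noteq> 0" for x y using that by simp
      ultimately show ?thesis unfolding e2_def by blast
    qed
    finally have "\<bar>a0 u' * \<eta> v - a0 u * \<eta> u\<bar> \<le> e" .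
    then have "\<bar>a0 u' * \<eta> v - a0 u * \<eta> u\<bar> * \<bar>\<theta> - u'\<bar> \<le> e * \<bar>\<theta> - u'\<bar>" by (rule mult_right_mono) simp
    then show "\<bar>a0 u' * (Q \<theta> - Q u') - a0 u * \<eta> u * (\<theta> - u')\<bar> \<le> e * \<bar>\<theta> - u'\<bar>"
      unfolding v(2) abs_mult[symmetric] by (simp add: algebra_simps)
  qed
  then show ?thesis using \<tau>(1) by blast
qed

text \<open>On |V| < R, which has probability close to 1 by Chebyshev, the order statistic is within
  R/sqrt n of its mean. The delta bound then applies, and its error is \<open>e\<close> times
  |V|.\<close>

lemma D'_linearised:
  assumes u: "u \<in> {0<..<1}" and L: "2 \<le> L"
  shows "prob_null M (\<lambda>n x. D' L n (cell n u) x - a0 u * \<eta> u * V n (cell n u) x)"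
proof (rule prob_nullI)
  show m: "(\<lambda>x. D' L n (cell n u) x - a0 u * \<eta> u * V n (cell n u) x) \<in> borel_measurable M" for n
    using D'_meas[of L n "cell n u"] by measurable
  fix e0 :: real assume e0: "0 < e0"
  obtain R where R: "0 < R" "moment_const 2 / R\<^sup>2 \<le> e0 / 2"
    using ex_second_moment_cutoff[of "moment_const 2" "e0 / 2"] e0 moment_const_nonneg by auto
  \<comment> \<open>With this choice the linearisation error on |V| < R is at most e0/2, the other
    half being left for the exceptional event.\<close>
  define e where "e = e0 / (2 * R)"
  have e: "0 < e" "e * R = e0 / 2" using e0 R by (auto simp: e_def)
  obtain \<tau> where \<tau>: "0 < \<tau>" "\<And>u' \<theta>. \<bar>u' - u\<bar> < \<tau> \<Longrightarrow> \<bar>\<theta> - u\<bar> < \<tau> \<Longrightarrow> close_ratio L u' \<theta> \<and>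
     \<bar>a0 u' * (Q \<theta> - Q u') - a0 u * \<eta> u * (\<theta> - u')\<bar> \<le> e * \<bar>\<theta> - u'\<bar>"
    using delta_method_bound[OF u e(1) L] by blast
  have "eventually (\<lambda>n. 1 / (real n + 1) < \<tau> / 2) sequentially"
    by (rule order_tendstoD(2)[of _ 0]) (real_asymp, use \<tau> in simp)
  moreover have "eventually (\<lambda>n. R / sqrt (real n) < \<tau> / 2) sequentially"
    by (rule order_tendstoD(2)[of _ 0]) (real_asymp, use \<tau> in simp)
  moreover have "eventually (\<lambda>n::nat. 1 \<le> n) sequentially" by (rule eventually_ge_at_top)
  ultimately show "eventually (\<lambda>n. expectation (\<lambda>x. min 1 \<bar>D' L n (cell n u) x - a0 u * \<eta> u * V n (cell n u) x\<bar>) \<le> e0) sequentially"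
  proof eventually_elim
    case (elim n)
    define k where "k = cell n u"
    define uk where "uk = real k / (real n + 1)"
    have k: "1 \<le> k" "k \<le> n" "\<bar>uk - u\<bar> \<le> 1 / (real n + 1)"
      using cell_bounds[OF elim(3), of u] u by (auto simp: k_def uk_def)
    define A where "A = {x\<in>space M. R \<le> \<bar>V n k x\<bar>}"
    have A: "A \<in> sets M" unfolding A_def by measurable
    have "prob A \<le> expectation (\<lambda>x. (V n k x)\<^sup>2) / R\<^sup>2"
      unfolding A_def by (rule second_moment_method[OF _ V_second_moment(1)[OF elim(3)] R(1)]) measurable
    also have "\<dots> \<le> moment_const 2 / R\<^sup>2" by (intro divide_right_mono V_second_moment(2)[OF elim(3)]) simp
    finally have pA: "prob A \<le> e0 / 2" using R(2) by (rule order_trans)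
    have sn: "0 < sqrt (real n)" using elim(3) by simp
    have "expectation (\<lambda>x. min 1 \<bar>D' L n (cell n u) x - a0 u * \<eta> u * V n (cell n u) x\<bar>) \<le> e0 / 2 + prob A"
    proof (rule expectation_min_1_le[OF m A])
      fix x assume x: "x \<in> space M" "x \<notin> A"
      define \<theta> where "\<theta> = uos n k x"
      have V: "V n k x = sqrt (real n) * (\<theta> - uk)" using k by (simp add: V_def \<theta>_def uk_def)
      have VR: "\<bar>V n k x\<bar> < R" using x by (auto simp: A_def)
      have "\<bar>\<theta> - uk\<bar> = \<bar>V n k x\<bar> / sqrt (real n)" using sn by (simp add: V abs_mult)
      also have "\<dots> < R / sqrt (real n)" using VR sn by (rule divide_strict_right_mono)
      finally have "\<bar>\<theta> - uk\<bar> < \<tau> / 2" using elim(2) by (rule less_trans)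
      moreover have "\<bar>uk - u\<bar> < \<tau> / 2" using k(3) elim(1) by simp
      ultimately have "\<bar>uk - u\<bar> < \<tau>" "\<bar>\<theta> - u\<bar> < \<tau>" by linarith+
      from \<tau>(2)[OF this] have cr: "close_ratio L uk \<theta>"
        and b: "\<bar>a0 uk * (Q \<theta> - Q uk) - a0 u * \<eta> u * (\<theta> - uk)\<bar> \<le> e * \<bar>\<theta> - uk\<bar>" by auto
      have "D' L n k x = a0 uk * (sqrt (real n) * (Q \<theta> - Q uk))"
        using cr k by (simp add: D'_def uk_def \<theta>_def)
      then have "D' L n k x - a0 u * \<eta> u * V n k x = sqrt (real n) * (a0 uk * (Q \<theta> - Q uk) - a0 u * \<eta> u * (\<theta> - uk))"
        by (simp add: V algebra_simps)
      then have "\<bar>D' L n k x - a0 u * \<eta> u * V n k x\<bar> = sqrt (real n) * \<bar>a0 uk * (Q \<theta> - Q uk) - a0 u * \<eta> u * (\<theta> - uk)\<bar>"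
        using sn by (simp add: abs_mult)
      also have "\<dots> \<le> sqrt (real n) * (e * \<bar>\<theta> - uk\<bar>)" using b sn by (intro mult_left_mono) auto
      also have "\<dots> = e * \<bar>V n k x\<bar>" using sn by (simp add: V abs_mult)
      also have "\<dots> \<le> e * R" using VR e(1) by (intro mult_left_mono) auto
      finally show "\<bar>D' L n (cell n u) x - a0 u * \<eta> u * V n (cell n u) x\<bar> \<le> e0 / 2"
        using e(2) by (simp add: k_def)
    qed (use e0 in auto)
    then show ?case using pA by simp
  qed
qed

text \<open>Two replacements that are negligible in probability, linearisation and the Bahadur
  representation, lead to the empirical process \<open>W\<close>, whose combinations have the bridge
  as limit. The limit does not involve \<open>L\<close>.\<close>

lemma D'_fdd:
  assumes L: "2 \<le> L"
  shows "fdd_convergence {0<..<1} (\<lambda>_. M) (\<lambda>n u x. D' L n (cell n u) x) N Y"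
  unfolding fdd_convergence_def
proof (intro allI impI)
  fix J :: "real set" and c :: "real \<Rightarrow> real" assume J: "finite J" "J \<subseteq> {0<..<1}"
  have J01: "J \<subseteq> {0..1}" by (rule subset_trans[OF J(2)]) auto
  define b where "b u = c u * (a0 u * \<eta> u)" for u
  have "(\<lambda>n. expectation (\<lambda>x. iexp (\<Sum>u\<in>J. b u * W n u x))) \<longlonglongrightarrow> (\<integral>x. iexp (\<Sum>u\<in>J. b u * \<beta> u x) \<partial>N)"
    using W_combination_char[OF J(1) J01, of b] bridge_combination_char[OF bridge J(1) J01, of b] by simp
  also have "(\<integral>x. iexp (\<Sum>u\<in>J. b u * \<beta> u x) \<partial>N) = (\<integral>x. iexp (\<Sum>u\<in>J. c u * Y u x) \<partial>N)"
    by (simp add: b_def Y_def mult.assoc)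
  finally have lW: "(\<lambda>n. expectation (\<lambda>x. iexp (\<Sum>u\<in>J. b u * W n u x))) \<longlonglongrightarrow> (\<integral>x. iexp (\<Sum>u\<in>J. c u * Y u x) \<partial>N)" .
  have "prob_null M (\<lambda>n x. (\<Sum>u\<in>J. b u * V n (cell n u) x) - (\<Sum>u\<in>J. b u * W n u x))"
  proof -
    have "prob_null M (\<lambda>n x. \<Sum>u\<in>J. b u * (V n (cell n u) x - W n u x))"
      by (rule prob_null_sum[OF J(1)], rule bahadur) (use J in auto)
    then show ?thesis by (simp add: sum_subtractf right_diff_distrib)
  qed
  then have lV: "(\<lambda>n. expectation (\<lambda>x. iexp (\<Sum>u\<in>J. b u * V n (cell n u) x))) \<longlonglongrightarrow> (\<integral>x. iexp (\<Sum>u\<in>J. c u * Y u x) \<partial>N)"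
    by (rule prob_null_iexp[OF _ _ _ lW]) measurable
  have "prob_null M (\<lambda>n x. (\<Sum>u\<in>J. c u * D' L n (cell n u) x) - (\<Sum>u\<in>J. b u * V n (cell n u) x))"
  proof -
    have "prob_null M (\<lambda>n x. \<Sum>u\<in>J. c u * (D' L n (cell n u) x - a0 u * \<eta> u * V n (cell n u) x))"
      by (rule prob_null_sum[OF J(1)], rule D'_linearised[OF _ L]) (use J in auto)
    then show ?thesis by (simp add: sum_subtractf right_diff_distrib b_def mult.assoc)
  qed
  then show "(\<lambda>n. expectation (\<lambda>x. iexp (\<Sum>u\<in>J. c u * D' L n (cell n u) x))) \<longlonglongrightarrow> (\<integral>x. iexp (\<Sum>u\<in>J. c u * Y u x) \<partial>N)"
    by (rule prob_null_iexp[OF _ _ _ lV]) (intro borel_measurable_sum borel_measurable_times borel_measurable_const D'_meas, measurable)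
qed

text \<open>Near the endpoints the contribution is a Riemann sum of \<open>g\<close>; on the remaining compact
  interval the moments of order \<open>2 * r\<close> are bounded.\<close>
lemma D'_tail:
  assumes L: "1 \<le> L" and e: "0 < e"
  shows "\<exists>K. eventually (\<lambda>n. (\<integral>\<^sup>+u. \<integral>\<^sup>+x. ennreal (\<bar>D' L n (cell n u) x\<bar> powr r * indicator {K<..} \<bar>D' L n (cell n u) x\<bar>) \<partial>M \<partial>unif01) \<le> ennreal e) sequentially"
proof -
  have r0: "0 < r" "0 \<le> r" using r by auto
  obtain K1 where K1: "0 \<le> K1" "\<And>n k. 1 \<le> k \<Longrightarrow> k \<le> n \<Longrightarrow>
    (\<integral>\<^sup>+x. ennreal (\<bar>D' L n k x\<bar> powr r) \<partial>M) \<le> ennreal (K1 * a (real k / (real n + 1)) powr r)"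
    using D'_moment[OF L r0(2)] by blast
  obtain K2 where K2: "0 \<le> K2" "\<And>n k. 1 \<le> k \<Longrightarrow> k \<le> n \<Longrightarrow>
    (\<integral>\<^sup>+x. ennreal (\<bar>D' L n k x\<bar> powr (2 * r)) \<partial>M) \<le> ennreal (K2 * a (real k / (real n + 1)) powr (2 * r))"
    using D'_moment[OF L, of "2 * r"] r0 by auto
  obtain \<rho>0 \<rho>1 where rv: "regularly_varying_at_0 g \<rho>0" "regularly_varying_at_0 (\<lambda>t. g (1 - t)) \<rho>1"
    using g_rv by (auto simp: regularly_varying_at_endpoints_def regularly_varying_at_1_def)
  \<comment> \<open>The two endpoints together contribute at most \<open>K1 * (2 * e1)\<close>,
    which has to stay below e/2; adding 1 to \<open>K1\<close> avoids a zero denominator.\<close>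
  define e1 where "e1 = e / (4 * (K1 + 1))"
  have e1: "0 < e1" "K1 * (2 * e1) \<le> e / 2"
  proof -
    show "0 < e1" using e K1 by (simp add: e1_def)
    have "K1 * (2 * e1) \<le> (K1 + 1) * (2 * e1)" using \<open>0 < e1\<close> by (intro mult_right_mono) auto
    also have "\<dots> = e / 2" using K1 by (simp add: e1_def field_simps)
    finally show "K1 * (2 * e1) \<le> e / 2" .
  qed
  obtain t0 where t0: "0 < t0" "\<And>n m. 1 \<le> n \<Longrightarrow> real m / (real n + 1) \<le> t0 \<Longrightarrow> (\<Sum>k = 1..m. g (real k / (real n + 1)) / real n) \<le> e1"
    using regularly_varying_riemann_sum_tail[OF rv(1) g_int e1(1)] by blast
  obtain t1 where t1: "0 < t1" "\<And>n m. 1 \<le> n \<Longrightarrow> real m / (real n + 1) \<le> t1 \<Longrightarrow> (\<Sum>k = 1..m. g (1 - real k / (real n + 1)) / real n) \<le> e1"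
    using regularly_varying_riemann_sum_tail[OF rv(2) integrable_lebesgue_on_reflect[OF g_int] e1(1)] by blast
  \<comment> \<open>Rounding lets the Riemann sums reach as far as \<open>2 * \<delta>\<close>,
    hence the final halving; the bound 1/2 ensures \<open>m \<le> n\<close>.\<close>
  define \<delta> where "\<delta> = min (min t0 t1) (1/2) / 2"
  have \<delta>: "0 < \<delta>" "2 * \<delta> \<le> t0" "2 * \<delta> \<le> t1" "2 * \<delta> < 1" using t0 t1 by (auto simp: \<delta>_def)
  \<comment> \<open>The margin \<open>\<delta> / 2\<close> allows for the distance between
    \<open>u\<close> and the mean k/(n + 1) of its cell.\<close>
  have "\<exists>Am\<ge>0. \<forall>u\<in>{\<delta>/2..1-\<delta>/2}. a u \<le> Am"
  proof -
    have "continuous_on {\<delta>/2..1-\<delta>/2} a" by (rule continuous_on_subset[OF a_cont]) (use \<delta> in auto)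
    then obtain p where "p \<in> {\<delta>/2..1-\<delta>/2}" "\<And>u. u \<in> {\<delta>/2..1-\<delta>/2} \<Longrightarrow> a u \<le> a p"
      using continuous_attains_sup[of "{\<delta>/2..1-\<delta>/2}" a] \<delta> by auto
    moreover have "0 \<le> a p" using a_nonneg[of p] calculation(1) \<delta> by auto
    ultimately show ?thesis by blast
  qed
  then obtain Am where Am: "0 \<le> Am" "\<And>u. u \<in> {\<delta>/2..1-\<delta>/2} \<Longrightarrow> a u \<le> Am" by blast
  define B where "B = K2 * Am powr (2 * r)"
  have B: "0 \<le> B" using K2 by (simp add: B_def)
  \<comment> \<open>Solved from the requirement that \<open>B / K powr r\<close> be at most
    e/2.\<close>
  define K where "K = (2 * B / e + 1) powr (1 / r)"
  have pos: "0 < 2 * B / e + 1" using B e by (intro add_nonneg_pos) auto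
  have K: "0 < K" "K powr r = 2 * B / e + 1" using pos r0 by (auto simp: K_def powr_powr)
  have BK: "B / K powr r \<le> e / 2"
  proof -
    have "B \<le> e / 2 * (2 * B / e + 1)" using e B by (simp add: field_simps)
    then show ?thesis using pos by (simp add: K(2) pos_divide_le_eq)
  qed
  have "eventually (\<lambda>n. 2 / (real n + 1) < \<delta>) sequentially"
    by (rule order_tendstoD(2)[of _ 0]) (real_asymp, use \<delta> in simp)
  moreover have "eventually (\<lambda>n::nat. 1 \<le> n) sequentially" by (rule eventually_ge_at_top)
  ultimately have "eventually (\<lambda>n. (\<integral>\<^sup>+u. \<integral>\<^sup>+x. ennreal (\<bar>D' L n (cell n u) x\<bar> powr r * indicator {K<..} \<bar>D' L n (cell n u) x\<bar>) \<partial>M \<partial>unif01) \<le> ennreal e) sequentially"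
  proof eventually_elim
    case (elim n)
    \<comment> \<open>A cell meeting (0,\<delta>) or (1-\<delta>,1) has index at most
      \<open>real n * \<delta> + 1\<close>, counted from the respective end.\<close>
    define m where "m = nat \<lceil>real n * \<delta>\<rceil> + 1"
    have "0 < real n * \<delta>" using elim \<delta> by simp
    then have m: "real n * \<delta> + 1 \<le> real m" "real m \<le> real n * \<delta> + 2" unfolding m_def by linarith+
    have mn: "real m / (real n + 1) \<le> 2 * \<delta>"
    proof -
      have "real m / (real n + 1) \<le> (real n * \<delta> + 2) / (real n + 1)" using m by (intro divide_right_mono) auto
      also have "\<dots> = real n / (real n + 1) * \<delta> + 2 / (real n + 1)" by (simp add: add_divide_distrib)
      also have "real n / (real n + 1) * \<delta> \<le> 1 * \<delta>" using \<delta> by (intro mult_right_mono) auto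
      finally show ?thesis using elim by linarith
    qed
    have mlen: "m \<le> n"
    proof -
      have "real m / (real n + 1) < 1" using mn \<delta> by linarith
      then have "real m < real (n + 1)" by (simp add: divide_less_eq)
      then show ?thesis by linarith
    qed
    define q where "q k = g (real k / (real n + 1))" for k
    \<comment> \<open>An index counted at both ends does no harm, as only an upper bound is wanted
      and \<open>q\<close> is nonnegative.\<close>
    define \<phi> where "\<phi> k = K1 * ((if k \<le> m then q k else 0) + (if n + 1 - k \<le> m then q k else 0))" for k
    have q0: "0 \<le> q k" if "k \<in> {1..n}" for k using g_pos[of "real k / (real n + 1)"] that by (auto simp: q_def)
    have \<phi>0: "0 \<le> \<phi> k" if "k \<in> {1..n}" for k using q0[OF that] K1 by (auto simp: \<phi>_def intro!: mult_nonneg_nonneg)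
    have s1: "(\<Sum>k=1..n. (if k \<le> m then q k else 0)) / real n \<le> e1"
    proof -
      have "(\<Sum>k=1..n. (if k \<le> m then q k else 0)) = (\<Sum>k=1..m. q k)"
        using mlen by (intro sum.mono_neutral_cong_right) auto
      then show ?thesis using t0(2)[OF elim(2), of m] mn \<delta> by (simp add: sum_divide_distrib q_def)
    qed
    have s2: "(\<Sum>k=1..n. (if n + 1 - k \<le> m then q k else 0)) / real n \<le> e1"
    proof -
      have "(\<Sum>k=1..n. (if n + 1 - k \<le> m then q k else 0)) = (\<Sum>j=1..n. (if j \<le> m then q (n + 1 - j) else 0))"
        by (rule sum.reindex_bij_witness[where i="\<lambda>k. n + 1 - k" and j="\<lambda>k. n + 1 - k"]) auto
      also have "\<dots> = (\<Sum>j=1..m. q (n + 1 - j))"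
        using mlen by (intro sum.mono_neutral_cong_right) auto
      also have "\<dots> = (\<Sum>j=1..m. g (1 - real j / (real n + 1)))"
      proof (intro sum.cong refl)
        fix j assume "j \<in> {1..m}"
        then have "real (n + 1 - j) / (real n + 1) = 1 - real j / (real n + 1)" using mlen by (simp add: field_simps)
        then show "q (n + 1 - j) = g (1 - real j / (real n + 1))" by (simp only: q_def)
      qed
      finally show ?thesis using t1(2)[OF elim(2), of m] mn \<delta> by (simp add: sum_divide_distrib)
    qed
    have h_int: "(\<integral>\<^sup>+u. ennreal (\<phi> (cell n u)) \<partial>unif01) \<le> ennreal (e / 2)"
    proof -
      have "(\<integral>\<^sup>+u. ennreal (\<phi> (cell n u)) \<partial>unif01) = (\<Sum>k=1..n. ennreal (\<phi> k) * ennreal (1 / real n))"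
        by (rule nn_integral_cell[OF elim(2)])
      also have "\<dots> = (\<Sum>k=1..n. ennreal (\<phi> k * (1 / real n)))"
        by (intro sum.cong refl ennreal_mult[symmetric]) (use \<phi>0 in auto)
      also have "\<dots> = ennreal (\<Sum>k=1..n. \<phi> k * (1 / real n))" using \<phi>0 by (intro sum_ennreal) auto
      also have "(\<Sum>k=1..n. \<phi> k * (1 / real n)) = K1 * ((\<Sum>k=1..n. (if k \<le> m then q k else 0)) / real n + (\<Sum>k=1..n. (if n + 1 - k \<le> m then q k else 0)) / real n)"
        unfolding \<phi>_def by (simp only: sum_divide_distrib[symmetric] sum_distrib_left[symmetric] sum_distrib_right[symmetric] sum.distrib add_divide_distrib distrib_left times_divide_eq_right mult_1_right)
      also have "\<dots> \<le> K1 * (e1 + e1)" using K1 s1 s2 by (intro mult_left_mono add_mono)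
      also have "\<dots> \<le> e / 2" using e1 by simp
      finally show ?thesis by (simp add: ennreal_leI)
    qed
    have "(\<integral>\<^sup>+u. \<integral>\<^sup>+x. ennreal (\<bar>D' L n (cell n u) x\<bar> powr r * indicator {K<..} \<bar>D' L n (cell n u) x\<bar>) \<partial>M \<partial>unif01)
       \<le> (\<integral>\<^sup>+u. ennreal (\<phi> (cell n u)) \<partial>unif01) + ennreal (B / K powr r)"
    proof (rule process_tail_split[where A="{\<delta>..1-\<delta>} \<inter> {0<..<1}", OF prob_space_unif01 D'_meas _ K(1) r0(1) B])
      show "{\<delta>..1-\<delta>} \<inter> {0<..<1} \<in> sets unif01" unfolding unif01_def by (auto simp: sets_restrict_space)
      show "(\<lambda>u. ennreal (\<phi> (cell n u))) \<in> borel_measurable unif01"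
        by (rule measurable_compose[OF cell_measurable]) simp
      fix u assume u: "u \<in> space unif01"
      then have u01: "0 < u" "u < 1" by auto
      define k where "k = cell n u"
      have k: "1 \<le> k" "k \<le> n" "\<bar>real k / (real n + 1) - u\<bar> \<le> 1 / (real n + 1)"
        using cell_bounds[OF elim(2) u01] by (auto simp: k_def)
      have kc: "real n * u \<le> real k" "real k < real n * u + 1"
        using elim(2) u01 mult_pos_pos[of "real n" u] unfolding k_def cell_def by linarith+
      have uk: "real k / (real n + 1) \<in> {0<..<1}" using k by auto
      {
        assume "u \<notin> {\<delta>..1-\<delta>} \<inter> {0<..<1}"
        then consider "u < \<delta>" | "1 - \<delta> < u" using u01 by fastforce
        then have "k \<le> m \<or> n + 1 - k \<le> m"
        proof cases
          case 1
          then have "real n * u \<le> real n * \<delta>" by (intro mult_left_mono) auto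
          then have "real k \<le> real m" using kc m by linarith
          then show ?thesis by simp
        next
          case 2
          then have "real n * (1 - u) \<le> real n * \<delta>" by (intro mult_left_mono) auto
          then have "real (n + 1 - k) \<le> real m" using kc m k by (simp add: algebra_simps of_nat_diff)
          then show ?thesis by linarith
        qed
        then have "K1 * q k \<le> \<phi> k" unfolding \<phi>_def using q0[of k] k K1 by (intro mult_left_mono) auto
        moreover have "K1 * a (real k / (real n + 1)) powr r \<le> K1 * q k"
          unfolding q_def by (intro mult_left_mono a_powr_le uk K1)
        ultimately have "ennreal (K1 * a (real k / (real n + 1)) powr r) \<le> ennreal (\<phi> k)" by (intro ennreal_leI) linarith
        then show "(\<integral>\<^sup>+x. ennreal (\<bar>D' L n (cell n u) x\<bar> powr r) \<partial>M) \<le> ennreal (\<phi> (cell n u))"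
          using order_trans[OF K1(2)[OF k(1,2)]] by (simp add: k_def)
      }
      {
        assume "u \<in> {\<delta>..1-\<delta>} \<inter> {0<..<1}"
        then have "real k / (real n + 1) \<in> {\<delta>/2..1-\<delta>/2}" using k(3) elim(1) by (auto simp: abs_le_iff)
        then have "a (real k / (real n + 1)) powr (2 * r) \<le> Am powr (2 * r)"
          using Am r0 a_nonneg[OF uk] by (intro powr_mono2) auto
        then have "ennreal (K2 * a (real k / (real n + 1)) powr (2 * r)) \<le> ennreal B"
          unfolding B_def using K2 by (intro ennreal_leI mult_left_mono)
        then show "(\<integral>\<^sup>+x. ennreal (\<bar>D' L n (cell n u) x\<bar> powr (2 * r)) \<partial>M) \<le> ennreal B"
          using order_trans[OF K2(2)[OF k(1,2)]] by (simp add: k_def)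
      }
    qed
    also have "\<dots> \<le> ennreal (e / 2) + ennreal (e / 2)" using h_int BK by (intro add_mono ennreal_leI)
    also have "\<dots> = ennreal e" using e by (subst ennreal_plus[symmetric]) auto
    finally show ?case .
  qed
  then show ?thesis by blast
qed

lemma Y_limit:
  shows Y_integrable: "AE x in N. integrable unif01 (\<lambda>u. \<bar>Y u x\<bar> powr r)"
    and Y_integral_meas: "(\<lambda>x. \<integral>u. \<bar>Y u x\<bar> powr r \<partial>unif01) \<in> borel_measurable N"
    and D'_char: "2 \<le> L \<Longrightarrow> (\<lambda>n. expectation (\<lambda>x. iexp (\<theta> * (\<integral>u. \<bar>D' L n (cell n u) x\<bar> powr r \<partial>unif01))))
       \<longlonglongrightarrow> (\<integral>x. iexp (\<theta> * (\<integral>u. \<bar>Y u x\<bar> powr r \<partial>unif01)) \<partial>N)"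
proof -
  have r0: "0 < r" using r by simp
  have H: "fdd_convergence (space unif01) (\<lambda>_. M) (\<lambda>n u x. D' L n (cell n u) x) N Y" if "2 \<le> L" for L
    using D'_fdd[OF that] by simp
  have L1: "1 \<le> L" if "2 \<le> L" for L :: real using that by simp
  note conv = integral_powr_functional_converges[OF prob_space_unif01 prob_space_axioms bridge_prob_space[OF bridge]
      cell_joint_measurable[OF D'_meas] Y_meas r0 H D'_tail[OF L1] Y_tail]
  show "AE x in N. integrable unif01 (\<lambda>u. \<bar>Y u x\<bar> powr r)"
    "(\<lambda>x. \<integral>u. \<bar>Y u x\<bar> powr r \<partial>unif01) \<in> borel_measurable N"
    \<comment> \<open>Any admissible \<open>L\<close> serves here, because these facts concern the
      limit process only.\<close>
    using conv(1,2)[of 2] by auto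
  show "(\<lambda>n. expectation (\<lambda>x. iexp (\<theta> * (\<integral>u. \<bar>D' L n (cell n u) x\<bar> powr r \<partial>unif01))))
       \<longlonglongrightarrow> (\<integral>x. iexp (\<theta> * (\<integral>u. \<bar>Y u x\<bar> powr r \<partial>unif01)) \<partial>N)" if "2 \<le> L"
    using conv(3)[of L] that by simp
qed

section \<open>Removing the truncation\<close>

definition X :: "nat \<Rightarrow> 'a \<Rightarrow> real" where
  "X n x = real n powr (r / 2 - 1) *
     (\<Sum>k = 1..n. \<omega> (Q (real k / (real n + 1))) * \<bar>Q (uos n k x) - Q (real k / (real n + 1))\<bar> powr r)"

lemma X_meas: "X n \<in> borel_measurable M"
proof -
  have "(\<lambda>x. \<omega> (Q (real k / (real n + 1))) * \<bar>Q (uos n k x) - Q (real k / (real n + 1))\<bar> powr r) \<in> borel_measurable M"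
    if "k \<in> {1..n}" for k
  proof -
    have [measurable]: "(\<lambda>x. Q (uos n k x)) \<in> borel_measurable M" using that by (intro Q_uos_meas) auto
    show ?thesis by measurable
  qed
  then show ?thesis unfolding X_def[abs_def]
    by (rule borel_measurable_times[OF borel_measurable_const borel_measurable_sum])
qed

text \<open>Off \<open>far_event\<close> no order statistic is truncated. Of the prefactor, n^(r/2)
  is the \<open>r\<close>-th power of sqrt n inside \<open>D'\<close>, and 1/n is the measure of a
  cell.\<close>

lemma X_eq:
  assumes n: "1 \<le> n" and x: "x \<in> space M" "x \<notin> far_event L n"
  shows "X n x = (\<integral>u. \<bar>D' L n (cell n u) x\<bar> powr r \<partial>unif01)"
proof -
  have "\<bar>D' L n k x\<bar> powr r / real n
     = real n powr (r / 2 - 1) * (\<omega> (Q (real k / (real n + 1))) * \<bar>Q (uos n k x) - Q (real k / (real n + 1))\<bar> powr r)"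
    if k: "k \<in> {1..n}" for k
  proof -
    have cr: "close_ratio L (real k / (real n + 1)) (uos n k x)" using x k by (auto simp: far_event_def)
    have "\<bar>D' L n k x\<bar> powr r = \<omega> (Q (real k / (real n + 1))) * (sqrt (real n) powr r * \<bar>Q (uos n k x) - Q (real k / (real n + 1))\<bar> powr r)"
      using cr k a0_nonneg by (simp add: D'_def abs_mult powr_mult a0_powr)
    moreover have "sqrt (real n) powr r = real n powr (r / 2)"
      using n by (simp add: powr_half_sqrt[symmetric] powr_powr)
    moreover have "real n powr (r / 2 - 1) = real n powr (r / 2) / real n"
      using n by (simp add: powr_diff)
    ultimately show ?thesis by simp
  qed
  then have "(\<Sum>k=1..n. \<bar>D' L n k x\<bar> powr r) / real n = X n x"
    unfolding X_def sum_distrib_left sum_divide_distrib by (intro sum.cong refl)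
  then show ?thesis using integral_cell[OF n, of "\<lambda>k. \<bar>D' L n k x\<bar> powr r"] by simp
qed

text \<open>\<open>L\<close> is chosen with \<open>far_event\<close> of probability at most e/2 for
  all \<open>n\<close> at once, so truncation changes each characteristic function by at most
  \<open>e\<close>; the truncated ones converge to a limit free of \<open>L\<close>.\<close>

theorem statistic_char_converges:
  "(\<lambda>n. expectation (\<lambda>x. iexp (\<theta> * X n x))) \<longlonglongrightarrow> (\<integral>x. iexp (\<theta> * (\<integral>u. \<bar>Y u x\<bar> powr r \<partial>unif01)) \<partial>N)"
proof (rule tendsto_approx)
  fix e :: real assume e: "0 < e"
  obtain L where L: "2 \<le> L" "\<And>n. prob (far_event L n) \<le> e / 2"
    using prob_far_event_small[of "e / 2"] e by auto
  let ?D = "\<lambda>n x. \<integral>u. \<bar>D' L n (cell n u) x\<bar> powr r \<partial>unif01"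
  have "eventually (\<lambda>n. cmod (expectation (\<lambda>x. iexp (\<theta> * X n x)) - expectation (\<lambda>x. iexp (\<theta> * ?D n x))) \<le> e) sequentially"
    using eventually_ge_at_top[of 1]
  proof eventually_elim
    case (elim n)
    have Dm: "?D n \<in> borel_measurable M"
    proof -
      have "?D n = (\<lambda>x. (\<Sum>k=1..n. \<bar>D' L n k x\<bar> powr r) / real n)"
        using integral_cell[OF elim, of "\<lambda>k. \<bar>D' L n k _\<bar> powr r"] by (simp add: fun_eq_iff)
      then show ?thesis using D'_meas by simp
    qed
    have "cmod (expectation (\<lambda>x. iexp (\<theta> * X n x)) - expectation (\<lambda>x. iexp (\<theta> * ?D n x)))
       \<le> 2 * expectation (\<lambda>x. min 1 \<bar>\<theta> * X n x - \<theta> * ?D n x\<bar>)"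
      by (rule iexp_expectation_diff; intro borel_measurable_times borel_measurable_const X_meas Dm)
    also have "expectation (\<lambda>x. min 1 \<bar>\<theta> * X n x - \<theta> * ?D n x\<bar>) \<le> 0 + prob (far_event L n)"
      by (rule expectation_min_1_le)
         (use X_eq[OF elim] in \<open>auto intro!: borel_measurable_diff borel_measurable_times X_meas Dm\<close>)
    finally show ?case using L(2)[of n] by simp
  qed
  moreover have "norm ((\<integral>x. iexp (\<theta> * (\<integral>u. \<bar>Y u x\<bar> powr r \<partial>unif01)) \<partial>N) - (\<integral>x. iexp (\<theta> * (\<integral>u. \<bar>Y u x\<bar> powr r \<partial>unif01)) \<partial>N)) \<le> e"
    using e by simp
  ultimately show "\<exists>b l. b \<longlonglongrightarrow> l \<and> eventually (\<lambda>n. norm (expectation (\<lambda>x. iexp (\<theta> * X n x)) - b n) \<le> e) sequentially \<and>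
     norm ((\<integral>x. iexp (\<theta> * (\<integral>u. \<bar>Y u x\<bar> powr r \<partial>unif01)) \<partial>N) - l) \<le> e"
    using D'_char[OF L(1)] by blast
qed

end

subsection \<open>Transfer to the given samples\<close>

definition uniform_seq :: "(nat \<Rightarrow> real) measure" where
  "uniform_seq = PiM UNIV (\<lambda>_. unif01)"

lemma iid_uniform_uniform_seq: "iid_uniform uniform_seq (\<lambda>i x. x i)"
proof -
  interpret product_prob_space "\<lambda>_. unif01" "UNIV :: nat set"
    by (intro product_prob_spaceI prob_space_unif01)
  have bor: "(\<lambda>x. x) \<in> borel_measurable unif01"
    by (rule measurable_unif01_borel) simp
  show ?thesis unfolding iid_uniform_def iid_uniform_axioms_def uniform_seq_def
  proof (intro conjI allI impI)
    show P: "prob_space (PiM UNIV (\<lambda>_. unif01))" by (rule prob_space_PiM) (rule prob_space_unif01)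
    then interpret P: prob_space "PiM (UNIV :: nat set) (\<lambda>_. unif01)" .
    have c: "(\<lambda>x. x i) \<in> measurable (PiM (UNIV :: nat set) (\<lambda>_. unif01)) unif01" for i
      by (rule measurable_component_singleton) simp
    have d: "distr (PiM (UNIV :: nat set) (\<lambda>_. unif01)) unif01 (\<lambda>x. x i) = unif01" for i
      by (rule PiM_component) simp
    have "P.indep_vars (\<lambda>_. unif01) (\<lambda>i x. x i) UNIV"
      unfolding P.indep_vars_iff_distr_eq_PiM[OF UNIV_not_empty c] d by (simp add: restrict_UNIV distr_id2)
    then show "P.indep_vars (\<lambda>_. borel) (\<lambda>i x. x i) UNIV"
      by (rule P.indep_vars_compose2[where Y="\<lambda>_ x. x"]) (rule bor)
    fix i
    show "x i \<in> {0<..<1}" if "x \<in> space (PiM (UNIV :: nat set) (\<lambda>_. unif01))" for x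
      using that by (auto simp: space_PiM PiE_iff)
    fix t :: real assume t: "0 \<le> t" "t \<le> 1"
    have S: "{u\<in>space unif01. u \<le> t} \<in> sets unif01" using bor by measurable
    have "measure (PiM (UNIV :: nat set) (\<lambda>_. unif01)) {x\<in>space (PiM (UNIV :: nat set) (\<lambda>_. unif01)). x i \<le> t}
       = measure (distr (PiM (UNIV :: nat set) (\<lambda>_. unif01)) unif01 (\<lambda>x. x i)) {u\<in>space unif01. u \<le> t}"
      by (subst measure_distr[OF c S]) (auto intro!: arg_cong[where f="measure _"] simp: space_PiM PiE_iff)
    also have "\<dots> = measure unif01 {u\<in>space unif01. u \<le> t}" by (simp only: d)
    also have "\<dots> = measure lborel {u\<in>{0<..<1}. u \<le> t}"
      unfolding unif01_def by (subst measure_restrict_space) (auto simp: space_restrict_space)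
    also have "\<dots> = t"
    proof (cases "t = 1")
      case True
      then have "{u\<in>{0<..<1}. u \<le> t} = {0<..<1}" by auto
      then show ?thesis using True by simp
    next
      case False
      then have "{u\<in>{0<..<1}. u \<le> t} = {0<..t}" using t by auto
      then show ?thesis using t by simp
    qed
    finally show "measure (PiM (UNIV :: nat set) (\<lambda>_. unif01)) {x\<in>space (PiM (UNIV :: nat set) (\<lambda>_. unif01)). x i \<le> t} = t" .
  qed
qed

context quantile_functional
begin

definition stat :: "nat \<Rightarrow> (nat \<Rightarrow> real) \<Rightarrow> real" where
  "stat n z = real n powr (r / 2 - 1) *
     (\<Sum>k = 1..n. \<omega> (Q (real k / (real n + 1))) * \<bar>order_stat n z k - Q (real k / (real n + 1))\<bar> powr r)"

lemma stat_cong: "(\<And>j. j \<in> {1..n} \<Longrightarrow> z j = z' j) \<Longrightarrow> stat n z = stat n z'"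
  unfolding stat_def using order_stat_cong[of n z z'] by simp

lemma stat_meas:
  assumes "\<And>j. j \<in> {1..n} \<Longrightarrow> (\<lambda>x. Z j x) \<in> borel_measurable M'"
  shows "(\<lambda>x. stat n (\<lambda>j. Z j x)) \<in> borel_measurable M'"
proof -
  have "(\<lambda>x. \<omega> (Q (real k / (real n + 1))) * \<bar>order_stat n (\<lambda>j. Z j x) k - Q (real k / (real n + 1))\<bar> powr r) \<in> borel_measurable M'"
    if "k \<in> {1..n}" for k
  proof -
    have [measurable]: "(\<lambda>x. order_stat n (\<lambda>j. Z j x) k) \<in> borel_measurable M'"
      using that assms by (intro borel_measurable_order_stat) auto
    show ?thesis by measurable
  qed
  then show ?thesis unfolding stat_def
    by (rule borel_measurable_times[OF borel_measurable_const borel_measurable_sum])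
qed

lemma stat_quantile:
  assumes x: "x \<in> space M"
  shows "stat n (\<lambda>j. Q (U j x)) = X n x"
proof -
  have m: "mono_on ((\<lambda>j. U j x) ` {1..n}) Q"
    by (rule mono_on_subset[OF quantile_mono_on[OF F]]) (use U_range[OF x] in auto)
  have "order_stat n (\<lambda>j. Q (U j x)) k = Q (uos n k x)" if "k \<in> {1..n}" for k
    unfolding uos_def using that by (intro order_stat_mono m) auto
  then show ?thesis unfolding stat_def X_def by simp
qed

lemma Q_U_meas: "(\<lambda>x. Q (U j x)) \<in> borel_measurable M"
proof -
  have "U j \<in> measurable M (restrict_space borel {0<..<1})"
    using U_range by (intro measurable_restrict_space2) auto
  then show ?thesis
    by (rule measurable_compose) (rule borel_measurable_mono_on_fnc[OF quantile_mono_on[OF F]])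
qed

lemma Q_U_cdf: "cdf (distr M borel (\<lambda>x. Q (U j x))) = F"
proof
  fix t
  have "cdf (distr M borel (\<lambda>x. Q (U j x))) t = prob {x\<in>space M. Q (U j x) \<le> t}"
    using Q_U_meas[of j] by (simp add: cdf_def measure_distr) (auto intro!: arg_cong[where f=prob])
  also have "{x\<in>space M. Q (U j x) \<le> t} = {x\<in>space M. U j x \<le> F t}"
    using U_range quantile_le_iff[OF F] by auto
  also have "prob \<dots> = F t" using distribution_function_bounds[OF F] by (rule U_cdf)
  finally show "cdf (distr M borel (\<lambda>x. Q (U j x))) t = F t" .
qed

text \<open>The law of the statistic depends only on the joint law of the sample, which by
  independence is the product of marginals with distribution function \<open>F\<close>. Hence each
  row, on whatever space, may be replaced by quantile transforms of the same uniform
  sequence.\<close>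

lemma stat_distr:
  assumes M': "prob_space M'" and ind: "prob_space.indep_vars M' (\<lambda>_. borel) Z {1..n}"
    and cdf: "\<And>k. k \<in> {1..n} \<Longrightarrow> cdf (distr M' borel (Z k)) = F"
  shows "distr M' borel (\<lambda>x. stat n (\<lambda>j. Z j x)) = distr M borel (X n)"
\<comment> \<open>The description of independence by product measures asks for a nonempty index set;
  for \<open>n = 0\<close> the statistic is constant.\<close>
proof (cases "n = 0")
  case True
  interpret M': prob_space M' by fact
  have c: "stat n z = stat n (\<lambda>_. 0)" for z by (rule stat_cong) (simp add: True)
  have "distr M' borel (\<lambda>x. stat n (\<lambda>j. Z j x)) = return borel (stat n (\<lambda>_. 0))"
    unfolding c[of "\<lambda>j. Z j _"] by (rule M'.distr_const) simp
  moreover have "distr M borel (X n) = distr M borel (\<lambda>x. stat n (\<lambda>_. 0))"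
    by (intro distr_cong refl) (simp add: stat_quantile[symmetric] c[of "\<lambda>j. Q (U j _)"])
  ultimately show ?thesis by (simp add: distr_const)
next
  case False
  then have ne: "{1..n} \<noteq> {}" by simp
  interpret M': prob_space M' by fact
  define \<mu> where "\<mu> = distr M borel (\<lambda>x. Q (U 0 x))"
  have Zm: "Z j \<in> borel_measurable M'" if "j \<in> {1..n}" for j
    using ind that unfolding M'.indep_vars_def by auto
  have eqU: "distr M borel (\<lambda>x. Q (U j x)) = \<mu>" for j
    unfolding \<mu>_def using Q_U_meas by (intro cdf_unique) (auto simp: Q_U_cdf)
  have eqZ: "distr M' borel (Z j) = \<mu>" if "j \<in> {1..n}" for j
    unfolding \<mu>_def using Q_U_meas Zm[OF that] cdf[OF that] by (intro cdf_unique) (auto simp: Q_U_cdf)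
  have indU: "indep_vars (\<lambda>_. borel) (\<lambda>j x. Q (U j x)) {1..n}"
  proof -
    have "indep_vars (\<lambda>_. borel) U {1..n}" by (rule indep_vars_subset[OF indep]) simp
    \<comment> \<open>Independence is preserved under Borel maps of the whole line, so the quantile
      function is first continued by 0 outside (0,1), where the variables never are.\<close>
    then have "indep_vars (\<lambda>_. borel) (\<lambda>j x. (if U j x \<in> {0<..<1} then Q (U j x) else 0)) {1..n}"
    proof (rule indep_vars_compose2)
      show "(\<lambda>y. if y \<in> {0<..<1} then Q y else 0) \<in> borel_measurable borel"
      proof -
        have "Q \<in> borel_measurable (restrict_space borel {0<..<1})"
          by (rule borel_measurable_mono_on_fnc[OF quantile_mono_on[OF F]])
        then have "(\<lambda>y. indicator {0<..<1} y *\<^sub>R Q y) \<in> borel_measurable borel"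
          by (subst (asm) borel_measurable_restrict_space_iff) auto
        also have "(\<lambda>y. indicator {0<..<1} y *\<^sub>R Q y) = (\<lambda>y. if y \<in> {0<..<1} then Q y else 0)"
          by (auto simp: fun_eq_iff indicator_def)
        finally show ?thesis .
      qed
    qed
    moreover have "indep_vars (\<lambda>_. borel) (\<lambda>j x. (if U j x \<in> {0<..<1} then Q (U j x) else 0)) {1..n}
        \<longleftrightarrow> indep_vars (\<lambda>_. borel) (\<lambda>j x. Q (U j x)) {1..n}"
    proof -
      have eq: "(\<lambda>x. if U j x \<in> {0<..<1} then Q (U j x) else 0) -` A \<inter> space M = (\<lambda>x. Q (U j x)) -` A \<inter> space M" for j A
        using U_range by auto
      have m: "(\<lambda>x. if U j x \<in> {0<..<1} then Q (U j x) else 0) \<in> borel_measurable M" for j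
        using Q_U_meas[of j] U_range by (subst measurable_cong[where g="\<lambda>x. Q (U j x)"]) auto
      show ?thesis unfolding indep_vars_def2 eq using m Q_U_meas by simp
    qed
    ultimately show ?thesis by simp
  qed
  have jU: "distr M (PiM {1..n} (\<lambda>_. borel)) (\<lambda>x. \<lambda>j\<in>{1..n}. Q (U j x)) = PiM {1..n} (\<lambda>_. \<mu>)"
    using indep_vars_iff_distr_eq_PiM'[OF ne, of "\<lambda>j x. Q (U j x)" "\<lambda>_. borel"] indU Q_U_meas by (simp add: eqU)
  have jZ: "distr M' (PiM {1..n} (\<lambda>_. borel)) (\<lambda>x. \<lambda>j\<in>{1..n}. Z j x) = PiM {1..n} (\<lambda>_. \<mu>)"
  proof -
    have "distr M' (PiM {1..n} (\<lambda>_. borel)) (\<lambda>x. \<lambda>j\<in>{1..n}. Z j x) = PiM {1..n} (\<lambda>j. distr M' borel (Z j))"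
      using M'.indep_vars_iff_distr_eq_PiM'[OF ne, of Z "\<lambda>_. borel"] ind Zm by simp
    also have "\<dots> = PiM {1..n} (\<lambda>_. \<mu>)" by (intro PiM_cong refl eqZ)
    finally show ?thesis .
  qed
  have sm: "stat n \<in> borel_measurable (PiM {1..n} (\<lambda>_. borel))"
    using stat_meas[of n "\<lambda>j z. z j" "PiM {1..n} (\<lambda>_. borel)"] by simp
  have "distr M' borel (\<lambda>x. stat n (\<lambda>j. Z j x)) = distr M' borel (stat n \<circ> (\<lambda>x. \<lambda>j\<in>{1..n}. Z j x))"
    by (intro distr_cong refl) (auto intro!: stat_cong)
  also have "\<dots> = distr (distr M' (PiM {1..n} (\<lambda>_. borel)) (\<lambda>x. \<lambda>j\<in>{1..n}. Z j x)) borel (stat n)"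
    using Zm by (intro distr_distr[symmetric] sm measurable_restrict) auto
  also have "\<dots> = distr (distr M (PiM {1..n} (\<lambda>_. borel)) (\<lambda>x. \<lambda>j\<in>{1..n}. Q (U j x))) borel (stat n)"
    by (simp only: jU jZ)
  also have "\<dots> = distr M borel (stat n \<circ> (\<lambda>x. \<lambda>j\<in>{1..n}. Q (U j x)))"
    using Q_U_meas by (intro distr_distr sm measurable_restrict) auto
  also have "\<dots> = distr M borel (X n)"
    by (intro distr_cong refl) (auto simp: stat_quantile[symmetric] intro!: stat_cong)
  finally show ?thesis .
qed

end

text \<open>The first conclusion ensures that the limit variable is almost surely a genuine integral
  and not the default value 0 of a non-integrable function.\<close>

theorem theorem4p4:
  fixes r :: real
    and \<Psi> \<Psi>' \<omega> \<kappa> \<eta> :: "real \<Rightarrow> real"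
    and M :: "nat \<Rightarrow> 'a measure" and Z :: "nat \<Rightarrow> nat \<Rightarrow> 'a \<Rightarrow> real"
    and \<psi> :: "nat \<Rightarrow> nat \<Rightarrow> real"
    and N :: "'b measure" and \<beta> :: "real \<Rightarrow> 'b \<Rightarrow> real"
  assumes r: "1 \<le> r"
    and \<Psi>: "distribution_function \<Psi>"
    and \<omega>_nonneg: "\<And>x. 0 \<le> \<omega> x"
    and \<omega>_bounded: "bounded (range \<omega>)"
    and \<omega>_continuous: "continuous_on UNIV \<omega>"
    and M_prob: "\<And>n. prob_space (M n)"
    and Z_indep: "\<And>n. prob_space.indep_vars (M n) (\<lambda>_. borel) (Z n) {1..n}"
    and Z_law: "\<And>n k. k \<in> {1..n} \<Longrightarrow> cdf (distr (M n) borel (Z n k)) = \<Psi>"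
    and \<psi>_def: "\<psi> = (\<lambda>n k. quantile \<Psi> (real k / (real n + 1)))"
    and \<eta>_def: "\<eta> = quantile_density \<Psi> \<Psi>'"
    and \<kappa>_ge_1: "\<And>u. u \<in> {0<..<1} \<Longrightarrow> 1 \<le> \<kappa> u"
    and \<kappa>_measurable: "\<kappa> \<in> borel_measurable (lebesgue_on {0<..<1})"
    and \<kappa>_lim: "filterlim (\<lambda>u. min (\<kappa> u) (\<kappa> (1 - u)) / sqrt (ln (ln (1 / u)))) at_top (at_right 0)"
    and quantile_differentiable: "\<And>u. u \<in> {0<..<1} \<Longrightarrow> quantile \<Psi> differentiable at u"
    and i_density: "has_density \<Psi> \<Psi>'"
    and i_continuous: "continuous_on UNIV \<Psi>'"
    and i_positive: "\<And>x. x \<in> interior (df_support \<Psi>) \<Longrightarrow> 0 < \<Psi>' x"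
    and ii: "(\<exists>K. compact K \<and> K \<subseteq> {0<..<1} \<and> (\<forall>u\<in>{0<..<1} - K. \<omega> (quantile \<Psi> u) = 0)) \<or>
             regularly_varying_at_endpoints \<eta>"
    and iii: "\<exists>g. integrable (lebesgue_on {0<..<1}) g \<and> regularly_varying_at_endpoints g \<and>
                (\<forall>u\<in>{0<..<1}. \<omega> (quantile \<Psi> u) * (\<kappa> u * \<eta> u * sqrt (u * (1 - u))) powr r \<le> g u)"
    and bridge: "standard_brownian_bridge N \<beta>"
  shows "(AE x in N. set_integrable lborel {0<..<1}
            (\<lambda>u. \<omega> (quantile \<Psi> u) * \<eta> u powr r * \<bar>\<beta> u x\<bar> powr r)) \<and>
         converges_in_distribution
           M (\<lambda>n x. real n powr (r / 2 - 1) *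
                (\<Sum>k = 1..n. \<omega> (\<psi> n k) * \<bar>order_stat n (\<lambda>j. Z n j x) k - \<psi> n k\<bar> powr r))
           N (\<lambda>x. LINT u:{0<..<1}|lborel. \<omega> (quantile \<Psi> u) * \<eta> u powr r * \<bar>\<beta> u x\<bar> powr r)"
proof -
  interpret Q: smooth_df \<Psi> \<Psi>'
    by unfold_locales (fact \<Psi> i_density i_continuous i_positive quantile_differentiable)+
  obtain g where g: "integrable (lebesgue_on {0<..<1}) g" "regularly_varying_at_endpoints g"
    "\<And>u. u \<in> {0<..<1} \<Longrightarrow> \<omega> (quantile \<Psi> u) * (\<kappa> u * \<eta> u * sqrt (u * (1 - u))) powr r \<le> g u"
    using iii by blast
  have eta_pos: "0 < \<eta> u" if "u \<in> {0<..<1}" for u using Q.\<eta>_pos[of u] that by (simp add: \<eta>_def)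
  \<comment> \<open>Since \<kappa> is at least 1, the majorant in (iii) also dominates the function
    with \<eta> alone, whose size is that of the limit process.\<close>
  have dom: "\<omega> (quantile \<Psi> u) * (quantile_density \<Psi> \<Psi>' u * sqrt (u * (1 - u))) powr r \<le> g u" if u: "u \<in> {0<..<1}" for u
  proof -
    have e: "0 \<le> \<eta> u * sqrt (u * (1 - u))" using eta_pos[OF u] u by (intro mult_nonneg_nonneg) auto
    have "1 * (\<eta> u * sqrt (u * (1 - u))) \<le> \<kappa> u * (\<eta> u * sqrt (u * (1 - u)))"
      using \<kappa>_ge_1[OF u] e by (rule mult_right_mono)
    then have "(\<eta> u * sqrt (u * (1 - u))) powr r \<le> (\<kappa> u * \<eta> u * sqrt (u * (1 - u))) powr r"
      using e r by (intro powr_mono2) (auto simp: mult.assoc)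
    then have "\<omega> (quantile \<Psi> u) * (\<eta> u * sqrt (u * (1 - u))) powr r \<le> \<omega> (quantile \<Psi> u) * (\<kappa> u * \<eta> u * sqrt (u * (1 - u))) powr r"
      by (rule mult_left_mono) (rule \<omega>_nonneg)
    then show ?thesis using g(3)[OF u] by (simp add: \<eta>_def)
  qed
  \<comment> \<open>Both alternatives of (ii) lead to the same comparability: a compactly supported
    weight confines \<open>u\<close>, and regular variation controls \<eta> up to the
    endpoints.\<close>
  have comp: "\<exists>C\<ge>1. \<forall>u\<in>{0<..<1}. \<omega> (quantile \<Psi> u) \<noteq> 0 \<longrightarrow>
       (\<forall>\<theta>\<in>{0<..<1}. close_ratio L u \<theta> \<longrightarrow> quantile_density \<Psi> \<Psi>' \<theta> \<le> C * quantile_density \<Psi> \<Psi>' u)" if L: "1 \<le> L" for L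
    using ii
  proof
    assume "\<exists>K. compact K \<and> K \<subseteq> {0<..<1} \<and> (\<forall>u\<in>{0<..<1} - K. \<omega> (quantile \<Psi> u) = 0)"
    then obtain K where K: "compact K" "K \<subseteq> {0<..<1}" "\<And>u. u \<in> {0<..<1} - K \<Longrightarrow> \<omega> (quantile \<Psi> u) = 0" by blast
    obtain C where "1 \<le> C" "\<forall>u\<in>K. \<forall>\<theta>\<in>{0<..<1}. close_ratio L u \<theta> \<longrightarrow> quantile_density \<Psi> \<Psi>' \<theta> \<le> C * quantile_density \<Psi> \<Psi>' u"
      using compact_subset_comparable[OF Q.\<eta>_cont _ L K(1,2)] eta_pos unfolding \<eta>_def by blast
    then show ?thesis using K(3) by blast
  next
    assume "regularly_varying_at_endpoints \<eta>"
    then show ?thesis using regularly_varying_comparable[OF Q.\<eta>_cont _ L] unfolding \<eta>_def by blast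
  qed
  interpret C: iid_uniform uniform_seq "\<lambda>i x. x i" by (rule iid_uniform_uniform_seq)
  interpret A: quantile_functional \<Psi> \<Psi>' uniform_seq "\<lambda>i x. x i" r \<omega> g N \<beta>
    by unfold_locales (fact r \<omega>_nonneg \<omega>_continuous comp g(1,2) dom bridge)+
  interpret N: prob_space N by (rule bridge_prob_space[OF bridge])
  let ?X = "\<lambda>n x. real n powr (r / 2 - 1) *
                (\<Sum>k = 1..n. \<omega> (\<psi> n k) * \<bar>order_stat n (\<lambda>j. Z n j x) k - \<psi> n k\<bar> powr r)"
  let ?Y = "\<lambda>x. LINT u:{0<..<1}|lborel. \<omega> (quantile \<Psi> u) * \<eta> u powr r * \<bar>\<beta> u x\<bar> powr r"
  have X_eq: "?X n x = A.stat n (\<lambda>j. Z n j x)" for n x by (simp add: A.stat_def \<psi>_def)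
  have Y_eq: "?Y x = (\<integral>u. \<bar>A.Y u x\<bar> powr r \<partial>unif01)" for x
  proof -
    have "(\<integral>u. \<bar>A.Y u x\<bar> powr r \<partial>unif01) = (LINT u:{0<..<1}|lborel. \<bar>A.Y u x\<bar> powr r)"
      unfolding unif01_def set_lebesgue_integral_def by (rule integral_restrict_space) simp
    also have "\<dots> = ?Y x"
      unfolding set_lebesgue_integral_def
      by (intro Bochner_Integration.integral_cong refl) (auto simp: indicator_def A.Y_powr \<eta>_def)
    finally show ?thesis by simp
  qed
  have Zm: "Z n j \<in> borel_measurable (M n)" if "j \<in> {1..n}" for n j
    using Z_indep[of n] that unfolding prob_space.indep_vars_def[OF M_prob] by auto
  have Xm: "?X n \<in> borel_measurable (M n)" for n
    unfolding X_eq by (rule A.stat_meas) (rule Zm)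
  have Ym: "?Y \<in> borel_measurable N" unfolding Y_eq by (rule A.Y_integral_meas)
  have "AE x in N. set_integrable lborel {0<..<1} (\<lambda>u. \<omega> (quantile \<Psi> u) * \<eta> u powr r * \<bar>\<beta> u x\<bar> powr r)"
    using A.Y_integrable
  proof eventually_elim
    case (elim x)
    then have "integrable lborel (\<lambda>u. indicator {0<..<1} u *\<^sub>R \<bar>A.Y u x\<bar> powr r)"
      unfolding unif01_def by (subst (asm) integrable_restrict_space) auto
    also have "(\<lambda>u. indicator {0<..<1} u *\<^sub>R \<bar>A.Y u x\<bar> powr r)
       = (\<lambda>u. indicator {0<..<1} u *\<^sub>R (\<omega> (quantile \<Psi> u) * \<eta> u powr r * \<bar>\<beta> u x\<bar> powr r))"
      by (auto simp: fun_eq_iff indicator_def A.Y_powr \<eta>_def)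
    finally show ?case by (simp add: set_integrable_def)
  qed
  moreover have "weak_conv_m (\<lambda>n. distr (M n) borel (?X n)) (distr N borel ?Y)"
  proof (rule levy_continuity)
    show "real_distribution (distr (M n) borel (?X n))" for n
      using Xm by (intro prob_space.real_distribution_distr M_prob)
    show "real_distribution (distr N borel ?Y)" using Ym by (rule N.real_distribution_distr)
    fix \<theta>
    \<comment> \<open>The change of probability space happens here, and only through the law of the
      statistic for each \<open>n\<close>.\<close>
    have "char (distr (M n) borel (?X n)) \<theta> = C.expectation (\<lambda>x. iexp (\<theta> * A.X n x))" for n
    proof -
      have "distr (M n) borel (?X n) = distr uniform_seq borel (A.X n)"
        unfolding X_eq by (rule A.stat_distr[OF M_prob Z_indep Z_law])
      then show ?thesis using A.X_meas[of n] by (simp add: char_def integral_distr)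
    qed
    moreover have "char (distr N borel ?Y) \<theta> = (\<integral>x. iexp (\<theta> * (\<integral>u. \<bar>A.Y u x\<bar> powr r \<partial>unif01)) \<partial>N)"
      unfolding Y_eq char_def using A.Y_integral_meas by (subst integral_distr) auto
    ultimately show "(\<lambda>n. char (distr (M n) borel (?X n)) \<theta>) \<longlonglongrightarrow> char (distr N borel ?Y) \<theta>"
      using A.statistic_char_converges[of \<theta>] by simp
  qed
  ultimately show ?thesis using Xm Ym unfolding converges_in_distribution_def by blast
qed

end
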